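(* Let $L=2\pi$. Then $0\in L^{2}(0,L)$ is locally asymptotically stable for the nonlinear KdV system \[ y_{t}+y_{x}+yy_{x}+y_{xxx}=0,\quad y(t,0)=y(t,L)=0,\quad y_{x}(t,L)=0,\quad y(0,x)=y_{0}\in L^{2}(0,L). \] More precisely: (i) for every $\varepsilon>0$ there exists $\delta=\delta(\varepsilon)>0$ such that if $\|y_{0}\|_{L^{2}(0,L)}<\delta$, then $\|y(t,\cdot)\|_{L^{2}(0,L)}<\varepsilon$ for all $t\geq0$; (ii) there exists $\delta_{1}>0$ such that if $\|y_{0}\|_{L^{2}(0,L)}<\delta_{1}$, then $\lim_{t\to+\infty}\|y(t,\cdot)\|_{L^{2}(0,L)}=0$.
   Context: We consider the initial-boundary-value problem for the Korteweg-de Vries equation on the interval $(0,L)$ with $L=2\pi$: $y_{t}+y_{x}+yy_{x}+y_{xxx}=0$, $y(t,0)=y(t,L)=0$, $y_{x}(t,L)=0$, $y(0,x)=y_{0}\in L^{2}(0,L)$. The length $L=2\pi$ is a critical length, i.e. it belongs to Rosier's set $\{2\pi\sqrt{(j^{2}+l^{2}+jl)/3};\ j,l\in\mathbb{N}^{*}\}$, for which the linearized system around $0$ (obtained by dropping $yy_{x}$) has the nontrivial steady states $a(1-\cos x)$, $a\in\mathbb{R}$, so $0$ is not asymptotically stable for the linearized system. *)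

theory Defs
  imports "HOL-Analysis.Analysis"
begin

text \<open>Functions of space are of type real => real; only their values on [0,L] matter.
  A state y at time t is y t, a function of x.\<close>

definition in_L2 :: "real \<Rightarrow> (real \<Rightarrow> real) \<Rightarrow> bool" where
  "in_L2 L f \<longleftrightarrow> set_borel_measurable lborel {0..L} f \<and>
                    set_integrable lborel {0..L} (\<lambda>x. (f x)^2)"

definition L2norm :: "real \<Rightarrow> (real \<Rightarrow> real) \<Rightarrow> real" where
  "L2norm L f = sqrt (LINT x:{0..L}|lborel. (f x)^2)"

text \<open>Test functions: the domain of the adjoint operator, i.e. C^3 functions b with
  b(0) = b(L) = 0 and b'(0) = 0 (b1, b2, b3 are the first three derivatives).\<close>

definition kdv_test :: "real \<Rightarrow> (real \<Rightarrow> real) \<Rightarrow> (real \<Rightarrow> real) \<Rightarrow> (real \<Rightarrow> real)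
    \<Rightarrow> (real \<Rightarrow> real) \<Rightarrow> bool" where
  "kdv_test L b b1 b2 b3 \<longleftrightarrow>
     (\<forall>x. (b has_real_derivative b1 x) (at x)) \<and>
     (\<forall>x. (b1 has_real_derivative b2 x) (at x)) \<and>
     (\<forall>x. (b2 has_real_derivative b3 x) (at x)) \<and>
     continuous_on UNIV b3 \<and> b 0 = 0 \<and> b L = 0 \<and> b1 0 = 0"

text \<open>Global (t \<ge> 0) solution of
  y_t + y_x + y y_x + y_xxx = 0, y(t,0)=y(t,L)=0, y_x(t,L)=0, y(0)=y0,
  in the class C([0,T];L^2(0,L)) \<inter> L^2(0,T;H^1_0(0,L)) for every T,
  with the equation holding in the weak sense against the domain of the adjoint
  (this encodes the boundary condition y_x(t,L)=0).\<close>

definition kdv_solution :: "real \<Rightarrow> (real \<Rightarrow> real) \<Rightarrow> (real \<Rightarrow> real \<Rightarrow> real) \<Rightarrow> bool" where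
  "kdv_solution L y0 y \<longleftrightarrow>
     in_L2 L y0 \<and>
     set_borel_measurable lborel ({0..} \<times> {0..L}) (\<lambda>(t,x). y t x) \<and>
     (\<forall>t\<ge>0. in_L2 L (y t)) \<and>
     (\<forall>t0\<ge>0. ((\<lambda>t. L2norm L (\<lambda>x. y t x - y t0 x)) \<longlongrightarrow> 0) (at t0 within {0..})) \<and>
     L2norm L (\<lambda>x. y 0 x - y0 x) = 0 \<and>
     (\<exists>yx :: real \<Rightarrow> real \<Rightarrow> real.
        set_borel_measurable lborel ({0..} \<times> {0..L}) (\<lambda>(t,x). yx t x) \<and>
        (\<forall>T\<ge>0. set_integrable lborel ({0..T} \<times> {0..L}) (\<lambda>(t,x). (yx t x)^2)) \<and>
        (AE t in lborel. t \<ge> 0 \<longrightarrow>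
           (\<forall>x\<in>{0..L}. set_integrable lborel {0..x} (yx t) \<and>
                        y t x = (LINT s:{0..x}|lborel. yx t s)) \<and> y t L = 0)) \<and>
     (\<forall>b b1 b2 b3. kdv_test L b b1 b2 b3 \<longrightarrow>
        (\<forall>t\<ge>0. (LINT x:{0..L}|lborel. y t x * b x) - (LINT x:{0..L}|lborel. y0 x * b x) =
           (LINT s:{0..t}|lborel. LINT x:{0..L}|lborel.
               y s x * (b1 x + b3 x) + (y s x)^2 / 2 * b1 x)))"

end

theory Submission
  imports Defs
begin

text \<open>
  Write \<open>y = a phi + w\<close> with \<open>phi = 1 - cos\<close>, which spans the kernel of the linearization and of its adjoint,
  and \<open>w\<close> orthogonal to \<open>phi\<close>. On the complement of \<open>phi\<close> the Poincare constant is 1, so for the linear flow the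
  multiplier \<open>(1 + x) w\<close> gives
  \<open>d/dt 1/2 \<integral> (1 + x) w\<^sup>2 \<le> 1/2 \<integral> w\<^sup>2 - 3/2 \<integral> w'\<^sup>2 \<le> - \<integral> w'\<^sup>2\<close>. The quadratic coupling
  of \<open>a\<close> with \<open>w\<close> is removed by a corrector \<open>b\<close> with \<open>b' + b''' = phi phi'\<close> in the domain of the adjoint, and what
  remains is the cubic damping \<open>3 \<pi> a a' = - \<pi>\<^sup>2/2 a\<^sup>4 + ...\<close>. Hence, for small \<open>K\<close>, the functional
  \<open>(3\<pi>/2 - \<integral> y b) a\<^sup>2 + K/2 \<integral> (1 + x) w\<^sup>2\<close> is equivalent to the squared norm near \<open>0\<close> and decays at a
  rate of order \<open>|y|\<^sup>4\<close>.

  A weak solution is too rough for these computations. They are carried out for its Steklov averages \<open>u\<close> over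
  \<open>[t, t + h]\<close>: their time derivative is a difference quotient in L2, so the weak equation makes them \<open>C\<^sup>2\<close> in space
  with all boundary conditions. The averaged nonlinearity differs from \<open>u\<^sup>2/2\<close> by a variance in time, which vanishes
  as \<open>h \<rightarrow> 0\<close> because \<open>y\<close> is uniformly continuous in time with values in L2.
\<close>

section \<open>The space L2(0,L)\<close>

lemma set_integral_nonneg:
  fixes f :: "'a \<Rightarrow> real"
  assumes "\<And>x. x \<in> A \<Longrightarrow> 0 \<le> f x"
  shows "0 \<le> (LINT x:A|M. f x)"
  unfolding set_lebesgue_integral_def
  by (rule integral_nonneg_AE) (use assms in \<open>auto simp: indicator_def\<close>)

lemma integrable_mult_of_square:
  fixes f g :: "'a \<Rightarrow> real"
  assumes [measurable]: "f \<in> borel_measurable M" "g \<in> borel_measurable M"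
    and "integrable M (\<lambda>x. (f x)\<^sup>2)" "integrable M (\<lambda>x. (g x)\<^sup>2)"
  shows "integrable M (\<lambda>x. f x * g x)"
proof (rule Bochner_Integration.integrable_bound)
  show "integrable M (\<lambda>x. (f x)\<^sup>2 + (g x)\<^sup>2)"
    using assms by simp
  show "AE x in M. norm (f x * g x) \<le> norm ((f x)\<^sup>2 + (g x)\<^sup>2)"
  proof (rule AE_I2)
    fix x
    have "2 * (\<bar>f x\<bar> * \<bar>g x\<bar>) \<le> (f x)\<^sup>2 + (g x)\<^sup>2"
      using sum_squares_bound[of "\<bar>f x\<bar>" "\<bar>g x\<bar>"] by simp
    moreover have "0 \<le> \<bar>f x\<bar> * \<bar>g x\<bar>"
      by simp
    ultimately have "\<bar>f x * g x\<bar> \<le> (f x)\<^sup>2 + (g x)\<^sup>2"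
      unfolding abs_mult by linarith
    then show "norm (f x * g x) \<le> norm ((f x)\<^sup>2 + (g x)\<^sup>2)"
      by simp
  qed
qed simp

lemma Cauchy_Schwarz_integral:
  fixes f g :: "'a \<Rightarrow> real"
  assumes [measurable]: "f \<in> borel_measurable M" "g \<in> borel_measurable M"
    and square_integrable: "integrable M (\<lambda>x. (f x)\<^sup>2)" "integrable M (\<lambda>x. (g x)\<^sup>2)"
  shows "\<bar>LINT x|M. f x * g x\<bar> \<le> sqrt (LINT x|M. (f x)\<^sup>2) * sqrt (LINT x|M. (g x)\<^sup>2)"
proof -
  have "integrable M (\<lambda>x. \<bar>f x\<bar> * \<bar>g x\<bar>)"
    using integrable_abs[OF integrable_mult_of_square[OF assms]] by (simp add: abs_mult)
  then have nn: "(\<integral>\<^sup>+x. ennreal \<bar>f x\<bar> * ennreal \<bar>g x\<bar> \<partial>M) = ennreal (LINT x|M. \<bar>f x\<bar> * \<bar>g x\<bar>)"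
    by (simp add: nn_integral_eq_integral flip: ennreal_mult)
  have nn_square: "(\<integral>\<^sup>+x. (ennreal \<bar>h x\<bar>)\<^sup>2 \<partial>M) = ennreal (LINT x|M. (h x)\<^sup>2)"
    if "integrable M (\<lambda>x. (h x)\<^sup>2)" for h :: "'a \<Rightarrow> real"
    using nn_integral_eq_integral[OF that] by (simp add: ennreal_power)
  have "ennreal ((LINT x|M. \<bar>f x\<bar> * \<bar>g x\<bar>)\<^sup>2) \<le> ennreal ((LINT x|M. (f x)\<^sup>2) * (LINT x|M. (g x)\<^sup>2))"
    using Cauchy_Schwarz_nn_integral[of "\<lambda>x. ennreal \<bar>f x\<bar>" M "\<lambda>x. ennreal \<bar>g x\<bar>"]
    unfolding nn nn_square[OF square_integrable(1)] nn_square[OF square_integrable(2)]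
    by (simp add: ennreal_power flip: ennreal_mult)
  then have "(LINT x|M. \<bar>f x\<bar> * \<bar>g x\<bar>)\<^sup>2 \<le> (LINT x|M. (f x)\<^sup>2) * (LINT x|M. (g x)\<^sup>2)"
    by (simp add: ennreal_le_iff)
  then have "(LINT x|M. \<bar>f x\<bar> * \<bar>g x\<bar>) \<le> sqrt (LINT x|M. (f x)\<^sup>2) * sqrt (LINT x|M. (g x)\<^sup>2)"
    unfolding real_sqrt_mult[symmetric] by (rule real_le_rsqrt)
  moreover have "\<bar>LINT x|M. f x * g x\<bar> \<le> (LINT x|M. \<bar>f x\<bar> * \<bar>g x\<bar>)"
    using integral_abs_bound[of M "\<lambda>x. f x * g x"] by (simp add: abs_mult)
  ultimately show ?thesis
    by linarith
qed

definition L2inner :: "real \<Rightarrow> (real \<Rightarrow> real) \<Rightarrow> (real \<Rightarrow> real) \<Rightarrow> real" where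
  "L2inner L f g = (LINT x:{0..L}|lborel. f x * g x)"

abbreviation lborel_upto :: "real \<Rightarrow> real measure" where
  "lborel_upto L \<equiv> restrict_space lborel {0..L}"

lemma in_L2_iff:
  "in_L2 L f \<longleftrightarrow> f \<in> borel_measurable (lborel_upto L) \<and> integrable (lborel_upto L) (\<lambda>x. (f x)\<^sup>2)"
  by (simp add: in_L2_def set_borel_measurable_def set_integrable_eq
      borel_measurable_restrict_space_iff)

lemma L2inner_eq_integral: "L2inner L f g = (LINT x|lborel_upto L. f x * g x)"
  by (simp add: L2inner_def set_lebesgue_integral_def integral_restrict_space)

lemma L2norm_eq_integral: "L2norm L f = sqrt (LINT x|lborel_upto L. (f x)\<^sup>2)"
  by (simp add: L2norm_def set_lebesgue_integral_def integral_restrict_space)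

lemma L2norm_nonneg [simp]: "0 \<le> L2norm L f"
  by (simp add: L2norm_def set_integral_nonneg)

lemma L2norm_power2: "(L2norm L f)\<^sup>2 = L2inner L f f"
  by (simp add: L2norm_def L2inner_def set_integral_nonneg power2_eq_square)

lemma L2norm_zero [simp]: "L2norm L (\<lambda>x. 0) = 0"
  by (simp add: L2norm_def)

lemma L2norm_cong: "(\<And>x. x \<in> {0..L} \<Longrightarrow> f x = g x) \<Longrightarrow> L2norm L f = L2norm L g"
  unfolding L2norm_def by (intro arg_cong[of _ _ sqrt] set_lebesgue_integral_cong) auto

lemma L2inner_cong:
  "(\<And>x. x \<in> {0..L} \<Longrightarrow> f x * g x = f' x * g' x) \<Longrightarrow> L2inner L f g = L2inner L f' g'"
  unfolding L2inner_def by (rule set_lebesgue_integral_cong) auto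

lemma L2inner_commute: "L2inner L f g = L2inner L g f"
  by (simp add: L2inner_def mult.commute)

lemma L2norm_minus_commute: "L2norm L (\<lambda>x. f x - g x) = L2norm L (\<lambda>x. g x - f x)"
  by (simp add: L2norm_def power2_commute)

lemma set_integrable_mult_L2:
  "in_L2 L f \<Longrightarrow> in_L2 L g \<Longrightarrow> set_integrable lborel {0..L} (\<lambda>x. f x * g x)"
  by (simp add: in_L2_iff set_integrable_eq integrable_mult_of_square)

lemma set_borel_measurable_continuous_Icc:
  fixes f :: "real \<Rightarrow> real"
  assumes "continuous_on {a..b} f"
  shows "set_borel_measurable lborel {a..b} f"
  using borel_integrable_atLeastAtMost'[OF assms]
  unfolding set_integrable_def set_borel_measurable_def by (rule borel_measurable_integrable)

lemma in_L2_continuous: "continuous_on {0..L} f \<Longrightarrow> in_L2 L f"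
  unfolding in_L2_def
  by (auto intro!: set_borel_measurable_continuous_Icc borel_integrable_atLeastAtMost' continuous_intros)

lemma in_L2_const [simp]: "in_L2 L (\<lambda>x. c)"
  by (simp add: in_L2_continuous)

lemma in_L2_integrable: "in_L2 L f \<Longrightarrow> set_integrable lborel {0..L} f"
  using set_integrable_mult_L2[OF _ in_L2_const, of L f 1] by simp

lemma in_L2_cong:
  assumes "\<And>x. x \<in> {0..L} \<Longrightarrow> f x = g x"
  shows "in_L2 L f \<longleftrightarrow> in_L2 L g"
proof -
  have "f x = g x" if "x \<in> space (lborel_upto L)" for x
    using that assms by simp
  then show ?thesis
    unfolding in_L2_iff
    by (intro arg_cong2[where f = "(\<and>)"] measurable_cong Bochner_Integration.integrable_cong) auto
qed

lemma in_L2_add [simp]: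
  assumes "in_L2 L f" "in_L2 L g"
  shows "in_L2 L (\<lambda>x. f x + g x)"
proof -
  have "integrable (lborel_upto L) (\<lambda>x. (f x)\<^sup>2 + (g x)\<^sup>2 + 2 * (f x * g x))"
    using assms integrable_mult_of_square[of f "lborel_upto L" g] by (simp add: in_L2_iff)
  moreover have "(\<lambda>x. f x + g x) \<in> borel_measurable (lborel_upto L)"
    using assms by (auto simp: in_L2_iff)
  ultimately show ?thesis
    by (simp add: in_L2_iff power2_sum mult.assoc)
qed

lemma in_L2_mult_bounded:
  assumes f: "in_L2 L f" and g: "g \<in> borel_measurable (lborel_upto L)"
    and B: "\<And>x. x \<in> {0..L} \<Longrightarrow> \<bar>g x\<bar> \<le> B"
  shows "in_L2 L (\<lambda>x. g x * f x)"
proof -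
  have measurable: "(\<lambda>x. g x * f x) \<in> borel_measurable (lborel_upto L)"
    using f g by (auto simp: in_L2_iff)
  have "integrable (lborel_upto L) (\<lambda>x. (g x * f x)\<^sup>2)"
  proof (rule Bochner_Integration.integrable_bound)
    show "integrable (lborel_upto L) (\<lambda>x. B\<^sup>2 * (f x)\<^sup>2)"
      using f by (simp add: in_L2_iff)
    show "(\<lambda>x. (g x * f x)\<^sup>2) \<in> borel_measurable (lborel_upto L)"
      using measurable by (rule borel_measurable_power)
    show "AE x in lborel_upto L. norm ((g x * f x)\<^sup>2) \<le> norm (B\<^sup>2 * (f x)\<^sup>2)"
      using power_mono[OF B, of _ 2] by (intro AE_I2) (simp add: power_mult_distrib mult_right_mono)
  qed
  then show ?thesis
    using measurable by (simp add: in_L2_iff)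
qed

lemma continuous_on_Icc_bounded:
  fixes g :: "real \<Rightarrow> real"
  assumes "continuous_on {a..b} g"
  obtains B where "0 \<le> B" "\<And>x. x \<in> {a..b} \<Longrightarrow> \<bar>g x\<bar> \<le> B"
proof -
  obtain B where "\<forall>x\<in>{a..b}. \<bar>g x\<bar> \<le> B"
    using compact_imp_bounded[OF compact_continuous_image[OF assms compact_Icc]]
    by (auto simp: bounded_iff)
  then show ?thesis
    using that[of "max 0 B"] by (simp add: le_max_iff_disj)
qed

lemma in_L2_mult_continuous:
  assumes "in_L2 L f" and g: "continuous_on {0..L} g"
  shows "in_L2 L (\<lambda>x. g x * f x)"
proof -
  obtain B where "\<And>x. x \<in> {0..L} \<Longrightarrow> \<bar>g x\<bar> \<le> B"
    using continuous_on_Icc_bounded[OF g] by blast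
  moreover have "g \<in> borel_measurable (lborel_upto L)"
    using in_L2_continuous[OF g] by (simp add: in_L2_iff)
  ultimately show ?thesis
    using assms(1) by (intro in_L2_mult_bounded)
qed

lemma in_L2_scale [simp]: "in_L2 L f \<Longrightarrow> in_L2 L (\<lambda>x. c * f x)"
  by (simp add: in_L2_mult_continuous)

lemma in_L2_divide [simp]: "in_L2 L f \<Longrightarrow> in_L2 L (\<lambda>x. f x / c)"
  using in_L2_scale[of L f "1 / c"] by simp

lemma in_L2_diff [simp]: "in_L2 L f \<Longrightarrow> in_L2 L g \<Longrightarrow> in_L2 L (\<lambda>x. f x - g x)"
  using in_L2_add[OF _ in_L2_scale[where c = "-1"], of L f g] by simp

lemma L2inner_add_left:
  "in_L2 L f \<Longrightarrow> in_L2 L g \<Longrightarrow> in_L2 L k \<Longrightarrow> L2inner L (\<lambda>x. f x + g x) k = L2inner L f k + L2inner L g k"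
  unfolding L2inner_def distrib_right by (intro set_integral_add set_integrable_mult_L2)

lemma L2inner_diff_left:
  "in_L2 L f \<Longrightarrow> in_L2 L g \<Longrightarrow> in_L2 L k \<Longrightarrow> L2inner L (\<lambda>x. f x - g x) k = L2inner L f k - L2inner L g k"
  unfolding L2inner_def left_diff_distrib by (intro set_integral_diff set_integrable_mult_L2)

lemma L2inner_scale_left: "L2inner L (\<lambda>x. c * f x) k = c * L2inner L f k"
  by (simp add: L2inner_def mult.assoc)

lemma L2inner_divide_left: "L2inner L (\<lambda>x. f x / c) k = L2inner L f k / c"
  using L2inner_scale_left[of L "1 / c" f k] by simp

lemma L2inner_add_right:
  "in_L2 L f \<Longrightarrow> in_L2 L g \<Longrightarrow> in_L2 L k \<Longrightarrow> L2inner L k (\<lambda>x. f x + g x) = L2inner L k f + L2inner L k g"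
  by (simp add: L2inner_commute[of L k] L2inner_add_left)

lemma L2inner_diff_right:
  "in_L2 L f \<Longrightarrow> in_L2 L g \<Longrightarrow> in_L2 L k \<Longrightarrow> L2inner L k (\<lambda>x. f x - g x) = L2inner L k f - L2inner L k g"
  by (simp add: L2inner_commute[of L k] L2inner_diff_left)

lemma L2inner_scale_right: "L2inner L k (\<lambda>x. c * f x) = c * L2inner L k f"
  by (simp add: L2inner_commute[of L k] L2inner_scale_left)

lemma L2inner_mult_assoc: "L2inner L (\<lambda>x. f x * g x) k = L2inner L f (\<lambda>x. g x * k x)"
  by (simp add: L2inner_def mult.assoc)

lemmas L2inner_bilinear =
  L2inner_add_left L2inner_diff_left L2inner_scale_left L2inner_divide_left
  L2inner_add_right L2inner_diff_right L2inner_scale_right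

lemma L2_Cauchy_Schwarz:
  "in_L2 L f \<Longrightarrow> in_L2 L g \<Longrightarrow> \<bar>L2inner L f g\<bar> \<le> L2norm L f * L2norm L g"
  unfolding in_L2_iff L2inner_eq_integral L2norm_eq_integral by (intro Cauchy_Schwarz_integral) auto

lemma L2norm_scale: "L2norm L (\<lambda>x. c * f x) = \<bar>c\<bar> * L2norm L f"
  by (simp add: L2norm_def power_mult_distrib real_sqrt_mult)

lemma L2norm_diff_power2:
  assumes "in_L2 L f" "in_L2 L g"
  shows "(L2norm L (\<lambda>x. f x - g x))\<^sup>2 = (L2norm L f)\<^sup>2 - 2 * L2inner L f g + (L2norm L g)\<^sup>2"
  using assms by (simp add: L2norm_power2 L2inner_bilinear L2inner_commute[of L g f])

lemma L2norm_diff_scale_power2: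
  assumes "in_L2 L f" "in_L2 L g"
  shows "(L2norm L (\<lambda>x. f x - k * g x))\<^sup>2 = (L2norm L f)\<^sup>2 - 2 * k * L2inner L f g + k\<^sup>2 * (L2norm L g)\<^sup>2"
  using L2norm_diff_power2[OF assms(1) in_L2_scale[OF assms(2)], of k]
  by (simp add: L2inner_scale_right L2norm_scale power_mult_distrib)

lemma L2norm_add_le:
  assumes f: "in_L2 L f" and g: "in_L2 L g"
  shows "L2norm L (\<lambda>x. f x + g x) \<le> L2norm L f + L2norm L g"
proof (rule power2_le_imp_le)
  have "(L2norm L (\<lambda>x. f x + g x))\<^sup>2 = (L2norm L f)\<^sup>2 + 2 * L2inner L f g + (L2norm L g)\<^sup>2"
    using f g by (simp add: L2norm_power2 L2inner_bilinear L2inner_commute[of L g f])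
  also have "\<dots> \<le> (L2norm L f + L2norm L g)\<^sup>2"
    using L2_Cauchy_Schwarz[OF f g] by (simp add: power2_sum)
  finally show "(L2norm L (\<lambda>x. f x + g x))\<^sup>2 \<le> (L2norm L f + L2norm L g)\<^sup>2" .
qed simp

lemma L2norm_diff_le:
  assumes "in_L2 L f" "in_L2 L g"
  shows "L2norm L (\<lambda>x. f x - g x) \<le> L2norm L f + L2norm L g"
  using L2norm_add_le[OF assms(1) in_L2_scale[OF assms(2), of "-1"]] L2norm_scale[of L "-1" g] by simp

lemma abs_L2norm_diff_le:
  assumes "in_L2 L f" "in_L2 L g"
  shows "\<bar>L2norm L f - L2norm L g\<bar> \<le> L2norm L (\<lambda>x. f x - g x)"
  using L2norm_add_le[OF in_L2_diff[OF assms] assms(2)]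
    L2norm_add_le[OF in_L2_diff[OF assms(2,1)] assms(1)]
  by (simp add: L2norm_minus_commute[of L g])

lemma L2norm_mult_le:
  assumes f: "in_L2 L f" and g: "continuous_on {0..L} g"
    and B: "\<And>x. x \<in> {0..L} \<Longrightarrow> \<bar>g x\<bar> \<le> B" "0 \<le> B"
  shows "L2norm L (\<lambda>x. g x * f x) \<le> B * L2norm L f"
proof -
  have "(LINT x:{0..L}|lborel. (g x * f x)\<^sup>2) \<le> (LINT x:{0..L}|lborel. (B * f x)\<^sup>2)"
  proof (rule set_integral_mono)
    show "(g x * f x)\<^sup>2 \<le> (B * f x)\<^sup>2" if "x \<in> {0..L}" for x
      using power_mono[OF B(1)[OF that], of 2] by (simp add: power_mult_distrib mult_right_mono)
  qed (use in_L2_mult_continuous[OF f g] in_L2_scale[OF f, of B] in \<open>auto simp: in_L2_def\<close>)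
  then have "L2norm L (\<lambda>x. g x * f x) \<le> L2norm L (\<lambda>x. B * f x)"
    by (simp add: L2norm_def)
  then show ?thesis
    using B(2) by (simp add: L2norm_scale)
qed

lemma abs_L2inner_mult_le:
  assumes f: "in_L2 L f" and h: "in_L2 L h" and g: "continuous_on {0..L} g"
    and B: "\<And>x. x \<in> {0..L} \<Longrightarrow> \<bar>g x\<bar> \<le> B" "0 \<le> B"
  shows "\<bar>L2inner L f (\<lambda>x. g x * h x)\<bar> \<le> B * L2norm L f * L2norm L h"
proof -
  have "\<bar>L2inner L f (\<lambda>x. g x * h x)\<bar> \<le> L2norm L f * L2norm L (\<lambda>x. g x * h x)"
    by (intro L2_Cauchy_Schwarz f in_L2_mult_continuous h g)
  also have "\<dots> \<le> L2norm L f * (B * L2norm L h)"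
    by (intro mult_left_mono L2norm_mult_le h g B) simp_all
  finally show ?thesis
    by (simp add: mult_ac)
qed

lemma L2norm_one: "0 \<le> L \<Longrightarrow> L2norm L (\<lambda>x. 1) = sqrt L"
  by (simp add: L2norm_def set_lebesgue_integral_def)

lemma abs_L2inner_bounded_le:
  assumes L: "0 \<le> L" and f: "in_L2 L f" and g: "continuous_on {0..L} g"
    and B: "\<And>x. x \<in> {0..L} \<Longrightarrow> \<bar>g x\<bar> \<le> B" "0 \<le> B"
  shows "\<bar>L2inner L f g\<bar> \<le> sqrt L * B * L2norm L f"
  using abs_L2inner_mult_le[OF f in_L2_const g B, of 1] L by (simp add: L2norm_one mult_ac)

lemma LINT_abs_le_L2norm:
  assumes "0 \<le> L" "in_L2 L f"
  shows "(LINT x:{0..L}|lborel. \<bar>f x\<bar>) \<le> sqrt L * L2norm L f"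
proof -
  have "in_L2 L (\<lambda>x. \<bar>f x\<bar>)"
    using assms(2) by (auto simp: in_L2_iff)
  then have "\<bar>L2inner L (\<lambda>x. \<bar>f x\<bar>) (\<lambda>x. 1)\<bar> \<le> L2norm L (\<lambda>x. \<bar>f x\<bar>) * L2norm L (\<lambda>x. 1)"
    by (intro L2_Cauchy_Schwarz) auto
  moreover have "L2norm L (\<lambda>x. \<bar>f x\<bar>) = L2norm L f"
    by (simp add: L2norm_def)
  ultimately show ?thesis
    using assms(1) by (simp add: L2inner_def L2norm_one mult.commute)
qed

lemma abs_primitive_le_L2norm:
  assumes L: "0 \<le> L" and f: "in_L2 L f" and x: "x \<in> {0..L}"
  shows "\<bar>LINT s:{0..x}|lborel. f s\<bar> \<le> sqrt L * L2norm L f"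
proof -
  note integrable = in_L2_integrable[OF f]
  have "\<bar>LINT s:{0..x}|lborel. f s\<bar> \<le> (LINT s:{0..x}|lborel. \<bar>f s\<bar>)"
    using set_integral_norm_bound[of lborel "{0..x}" f] set_integrable_subset[OF integrable] x by simp
  also have "\<dots> \<le> (LINT s:{0..L}|lborel. \<bar>f s\<bar>)"
    unfolding set_lebesgue_integral_def
    using set_integrable_subset[OF set_integrable_abs[OF integrable], of "{0..x}"]
      set_integrable_abs[OF integrable] x
    by (intro integral_mono) (auto simp: set_integrable_def indicator_def)
  also have "\<dots> \<le> sqrt L * L2norm L f"
    by (rule LINT_abs_le_L2norm[OF L f])
  finally show ?thesis .
qed

lemma L2inner_self_eq_0_imp_eq_0:
  assumes "0 < L" and e: "continuous_on {0..L} e" and "L2inner L e e = 0" and "x \<in> {0..L}"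
  shows "e x = 0"
proof -
  have cont: "continuous_on {0..L} (\<lambda>x. e x * e x)"
    by (intro continuous_intros e)
  have "integral {0..L} (\<lambda>x. e x * e x) = 0"
    using assms(3) set_borel_integral_eq_integral(2)[OF borel_integrable_atLeastAtMost'[OF cont]]
    by (simp add: L2inner_def)
  then show ?thesis
    using integral_eq_0_iff[OF cont assms(1)] assms(4) by simp
qed

section \<open>Convergence and differentiation in L2(0,L)\<close>

definition L2_tendsto :: "real \<Rightarrow> ('a \<Rightarrow> real \<Rightarrow> real) \<Rightarrow> (real \<Rightarrow> real) \<Rightarrow> 'a filter \<Rightarrow> bool" where
  "L2_tendsto L U u F \<longleftrightarrow>
     (\<forall>\<^sub>F n in F. in_L2 L (U n)) \<and> in_L2 L u \<and> ((\<lambda>n. L2norm L (\<lambda>x. U n x - u x)) \<longlongrightarrow> 0) F"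

lemma L2_tendsto_eventually_in_L2: "L2_tendsto L U u F \<Longrightarrow> \<forall>\<^sub>F n in F. in_L2 L (U n)"
  by (simp add: L2_tendsto_def)

lemma L2_tendstoI:
  assumes "\<forall>\<^sub>F n in F. in_L2 L (U n)" "in_L2 L u"
    and "\<And>e. 0 < e \<Longrightarrow> \<forall>\<^sub>F n in F. L2norm L (\<lambda>x. U n x - u x) \<le> e"
  shows "L2_tendsto L U u F"
proof -
  have "((\<lambda>n. L2norm L (\<lambda>x. U n x - u x)) \<longlongrightarrow> 0) F"
  proof (rule tendstoI)
    fix e :: real assume "0 < e"
    then show "\<forall>\<^sub>F n in F. dist (L2norm L (\<lambda>x. U n x - u x)) 0 < e"
      using assms(3)[of "e / 2"] by (auto elim!: eventually_mono)
  qed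
  then show ?thesis
    using assms(1,2) by (simp add: L2_tendsto_def)
qed

lemma L2_tendsto_norm_bound:
  assumes "\<forall>\<^sub>F n in F. in_L2 L (U n) \<and> L2norm L (\<lambda>x. U n x - u x) \<le> e n"
    and "in_L2 L u" and "(e \<longlongrightarrow> 0) F"
  shows "L2_tendsto L U u F"
proof -
  have "((\<lambda>n. L2norm L (\<lambda>x. U n x - u x)) \<longlongrightarrow> 0) F"
    using assms(3) by (rule Lim_null_comparison[rotated]) (use assms(1) in \<open>auto elim: eventually_mono\<close>)
  then show ?thesis
    using assms(1,2) by (auto simp: L2_tendsto_def elim: eventually_mono)
qed

lemma L2_tendsto_cong:
  assumes "\<forall>\<^sub>F n in F. \<forall>x\<in>{0..L}. U n x = V n x"
  shows "L2_tendsto L U u F \<longleftrightarrow> L2_tendsto L V u F"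
proof -
  have "\<forall>\<^sub>F n in F. in_L2 L (U n) \<longleftrightarrow> in_L2 L (V n)"
    using assms by eventually_elim (rule in_L2_cong, blast)
  then have "(\<forall>\<^sub>F n in F. in_L2 L (U n)) \<longleftrightarrow> (\<forall>\<^sub>F n in F. in_L2 L (V n))"
    by (rule eventually_subst)
  moreover have "((\<lambda>n. L2norm L (\<lambda>x. U n x - u x)) \<longlongrightarrow> 0) F \<longleftrightarrow> ((\<lambda>n. L2norm L (\<lambda>x. V n x - u x)) \<longlongrightarrow> 0) F"
  proof (rule tendsto_cong)
    show "\<forall>\<^sub>F n in F. L2norm L (\<lambda>x. U n x - u x) = L2norm L (\<lambda>x. V n x - u x)"
      using assms by eventually_elim (rule L2norm_cong, simp)
  qed
  ultimately show ?thesis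
    unfolding L2_tendsto_def by blast
qed

lemma L2_tendsto_const: "in_L2 L u \<Longrightarrow> L2_tendsto L (\<lambda>n. u) u F"
  by (simp add: L2_tendsto_def)

lemma L2_tendsto_compose:
  assumes U: "L2_tendsto L U u G" and g: "filterlim g G F"
  shows "L2_tendsto L (\<lambda>n. U (g n)) u F"
proof -
  have "\<forall>\<^sub>F n in F. in_L2 L (U (g n))"
    by (rule eventually_compose_filterlim[OF _ g]) (use U in \<open>simp add: L2_tendsto_def\<close>)
  moreover have "((\<lambda>n. L2norm L (\<lambda>x. U (g n) x - u x)) \<longlongrightarrow> 0) F"
    by (rule filterlim_compose[OF _ g]) (use U in \<open>simp add: L2_tendsto_def\<close>)
  ultimately show ?thesis
    using U by (simp add: L2_tendsto_def)
qed

lemma L2_tendsto_diff: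
  assumes U: "L2_tendsto L U u F" and V: "L2_tendsto L V v F"
  shows "L2_tendsto L (\<lambda>n x. U n x - V n x) (\<lambda>x. u x - v x) F"
proof (rule L2_tendsto_norm_bound)
  show "\<forall>\<^sub>F n in F. in_L2 L (\<lambda>x. U n x - V n x) \<and> L2norm L (\<lambda>x. U n x - V n x - (u x - v x))
      \<le> L2norm L (\<lambda>x. U n x - u x) + L2norm L (\<lambda>x. V n x - v x)"
    using L2_tendsto_eventually_in_L2[OF U] L2_tendsto_eventually_in_L2[OF V]
  proof eventually_elim
    case (elim n)
    then show ?case
      using L2norm_diff_le[of L "\<lambda>x. U n x - u x" "\<lambda>x. V n x - v x"] U V
      by (simp add: L2_tendsto_def algebra_simps)
  qed
  show "((\<lambda>n. L2norm L (\<lambda>x. U n x - u x) + L2norm L (\<lambda>x. V n x - v x)) \<longlongrightarrow> 0) F"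
    using U V unfolding L2_tendsto_def by (auto intro: tendsto_add_zero)
qed (use U V in \<open>auto simp: L2_tendsto_def\<close>)

lemma L2_tendsto_mult_continuous:
  assumes U: "L2_tendsto L U u F" and g: "continuous_on {0..L} g"
  shows "L2_tendsto L (\<lambda>n x. g x * U n x) (\<lambda>x. g x * u x) F"
proof -
  obtain B where B: "0 \<le> B" "\<And>x. x \<in> {0..L} \<Longrightarrow> \<bar>g x\<bar> \<le> B"
    using continuous_on_Icc_bounded[OF g] by blast
  show ?thesis
  proof (rule L2_tendsto_norm_bound)
    show "\<forall>\<^sub>F n in F. in_L2 L (\<lambda>x. g x * U n x)
        \<and> L2norm L (\<lambda>x. g x * U n x - g x * u x) \<le> B * L2norm L (\<lambda>x. U n x - u x)"
      using L2_tendsto_eventually_in_L2[OF U]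
    proof eventually_elim
      case (elim n)
      then show ?case
        using L2norm_mult_le[of L "\<lambda>x. U n x - u x" g B] U B g
        by (simp add: L2_tendsto_def in_L2_mult_continuous right_diff_distrib)
    qed
    show "((\<lambda>n. B * L2norm L (\<lambda>x. U n x - u x)) \<longlongrightarrow> 0) F"
      using U unfolding L2_tendsto_def by (auto intro: tendsto_mult_right_zero)
  qed (use U g in \<open>auto simp: L2_tendsto_def in_L2_mult_continuous\<close>)
qed

lemma L2_tendsto_scale_fixed:
  assumes c: "(c \<longlongrightarrow> k) F" and f: "in_L2 L f"
  shows "L2_tendsto L (\<lambda>n x. c n * f x) (\<lambda>x. k * f x) F"
proof (rule L2_tendsto_norm_bound)
  show "\<forall>\<^sub>F n in F. in_L2 L (\<lambda>x. c n * f x) \<and> L2norm L (\<lambda>x. c n * f x - k * f x) \<le> \<bar>c n - k\<bar> * L2norm L f"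
    using f by (simp add: L2norm_scale flip: left_diff_distrib)
  show "((\<lambda>n. \<bar>c n - k\<bar> * L2norm L f) \<longlongrightarrow> 0) F"
    using tendsto_mult_left_zero[OF tendsto_rabs_zero[OF LIM_zero[OF c]]] .
qed (simp add: f)

lemma L2_tendsto_L2inner:
  assumes U: "L2_tendsto L U u F" and V: "L2_tendsto L V v F"
  shows "((\<lambda>n. L2inner L (U n) (V n)) \<longlongrightarrow> L2inner L u v) F"
proof -
  define dU where "dU n = L2norm L (\<lambda>x. U n x - u x)" for n
  define dV where "dV n = L2norm L (\<lambda>x. V n x - v x)" for n
  have u: "in_L2 L u" and v: "in_L2 L v"
    using U V by (auto simp: L2_tendsto_def)
  have "\<forall>\<^sub>F n in F. norm (L2inner L (U n) (V n) - L2inner L u v)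
      \<le> dU n * dV n + dU n * L2norm L v + L2norm L u * dV n"
    using L2_tendsto_eventually_in_L2[OF U] L2_tendsto_eventually_in_L2[OF V]
  proof eventually_elim
    case (elim n)
    then have dU: "in_L2 L (\<lambda>x. U n x - u x)" and dV: "in_L2 L (\<lambda>x. V n x - v x)"
      using u v by auto
    have "L2inner L (U n) (V n) - L2inner L u v
        = L2inner L (\<lambda>x. U n x - u x) (\<lambda>x. V n x - v x)
          + L2inner L (\<lambda>x. U n x - u x) v + L2inner L u (\<lambda>x. V n x - v x)"
      using elim u v by (simp add: L2inner_bilinear)
    moreover note L2_Cauchy_Schwarz[OF dU dV] L2_Cauchy_Schwarz[OF dU v] L2_Cauchy_Schwarz[OF u dV]
    ultimately show ?case
      unfolding dU_def dV_def by simp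
  qed
  moreover have "(dU \<longlongrightarrow> 0) F" "(dV \<longlongrightarrow> 0) F"
    using U V by (auto simp: L2_tendsto_def dU_def[abs_def] dV_def[abs_def])
  then have "((\<lambda>n. dU n * dV n + dU n * L2norm L v + L2norm L u * dV n) \<longlongrightarrow> 0) F"
    by (auto intro!: tendsto_eq_intros)
  ultimately show ?thesis
    by (rule LIM_zero_cancel[OF Lim_null_comparison])
qed

lemma L2_tendsto_L2norm:
  assumes "L2_tendsto L U u F"
  shows "((\<lambda>n. L2norm L (U n)) \<longlongrightarrow> L2norm L u) F"
  using tendsto_real_sqrt[OF L2_tendsto_L2inner[OF assms assms]] by (simp flip: L2norm_power2)

definition has_L2_derivative :: "real \<Rightarrow> (real \<Rightarrow> real \<Rightarrow> real) \<Rightarrow> (real \<Rightarrow> real) \<Rightarrow> real \<Rightarrow> bool" where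
  "has_L2_derivative L U D t \<longleftrightarrow>
     in_L2 L (U t) \<and> L2_tendsto L (\<lambda>s x. (U s x - U t x) / (s - t)) D (at t)"

lemma has_L2_derivative_imp_L2_tendsto:
  assumes "has_L2_derivative L U D t"
  shows "L2_tendsto L U (U t) (at t)"
proof (rule L2_tendsto_norm_bound)
  let ?Q = "\<lambda>s x. (U s x - U t x) / (s - t)"
  have U: "in_L2 L (U t)" and Q: "L2_tendsto L ?Q D (at t)"
    using assms by (auto simp: has_L2_derivative_def)
  show "in_L2 L (U t)"
    by (rule U)
  show "\<forall>\<^sub>F s in at t. in_L2 L (U s) \<and> L2norm L (\<lambda>x. U s x - U t x) \<le> \<bar>s - t\<bar> * L2norm L (?Q s)"
    using L2_tendsto_eventually_in_L2[OF Q] eventually_neq_at_within[of t t UNIV]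
  proof eventually_elim
    case (elim s)
    then have "U s x = U t x + (s - t) * ?Q s x" for x
      by simp
    then have "U s = (\<lambda>x. U t x + (s - t) * ?Q s x)"
      by blast
    moreover have "in_L2 L (\<lambda>x. U t x + (s - t) * ?Q s x)"
      using elim U by (intro in_L2_add in_L2_scale)
    moreover have "L2norm L (\<lambda>x. U s x - U t x) = L2norm L (\<lambda>x. (s - t) * ?Q s x)"
      using elim by (intro L2norm_cong) simp
    ultimately show ?case
      by (simp only: L2norm_scale) simp
  qed
  show "((\<lambda>s. \<bar>s - t\<bar> * L2norm L (?Q s)) \<longlongrightarrow> 0) (at t)"
    using L2_tendsto_L2norm[OF Q] by (auto intro!: tendsto_eq_intros)
qed

lemma has_L2_derivative_L2inner:
  assumes U: "has_L2_derivative L U D t" and V: "has_L2_derivative L V E t"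
  shows "((\<lambda>s. L2inner L (U s) (V s)) has_real_derivative L2inner L D (V t) + L2inner L (U t) E) (at t)"
  unfolding has_field_derivative_iff
proof (rule tendsto_cong[THEN iffD1])
  let ?dU = "\<lambda>s x. (U s x - U t x) / (s - t)" and ?dV = "\<lambda>s x. (V s x - V t x) / (s - t)"
  note U_tendsto = has_L2_derivative_imp_L2_tendsto[OF U] and V_tendsto = has_L2_derivative_imp_L2_tendsto[OF V]
  show "((\<lambda>s. L2inner L (?dU s) (V s) + L2inner L (U t) (?dV s)) \<longlongrightarrow> L2inner L D (V t) + L2inner L (U t) E) (at t)"
    using U V unfolding has_L2_derivative_def
    by (intro tendsto_add L2_tendsto_L2inner V_tendsto L2_tendsto_const) auto
  show "\<forall>\<^sub>F s in at t. L2inner L (?dU s) (V s) + L2inner L (U t) (?dV s)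
      = (L2inner L (U s) (V s) - L2inner L (U t) (V t)) / (s - t)"
    using L2_tendsto_eventually_in_L2[OF U_tendsto] L2_tendsto_eventually_in_L2[OF V_tendsto]
  proof eventually_elim
    case (elim s)
    moreover have "in_L2 L (U t)" "in_L2 L (V t)"
      using U V by (auto simp: has_L2_derivative_def)
    ultimately show ?case
      by (simp add: L2inner_bilinear L2inner_commute[of L "U t"] flip: add_divide_distrib)
  qed
qed

lemma has_L2_derivative_diff:
  assumes "has_L2_derivative L U D t" "has_L2_derivative L V E t"
  shows "has_L2_derivative L (\<lambda>s x. U s x - V s x) (\<lambda>x. D x - E x) t"
proof -
  have "L2_tendsto L (\<lambda>s x. (U s x - U t x) / (s - t) - (V s x - V t x) / (s - t)) (\<lambda>x. D x - E x) (at t)"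
    using assms by (intro L2_tendsto_diff) (auto simp: has_L2_derivative_def)
  then show ?thesis
    using assms by (simp add: has_L2_derivative_def algebra_simps flip: diff_divide_distrib)
qed

lemma has_L2_derivative_mult_continuous:
  assumes "has_L2_derivative L U D t" and g: "continuous_on {0..L} g"
  shows "has_L2_derivative L (\<lambda>s x. g x * U s x) (\<lambda>x. g x * D x) t"
  using assms L2_tendsto_mult_continuous[OF _ g, of "\<lambda>s x. (U s x - U t x) / (s - t)" D "at t"]
  by (simp add: has_L2_derivative_def in_L2_mult_continuous right_diff_distrib)

lemma has_L2_derivative_divide:
  "has_L2_derivative L U D t \<Longrightarrow> has_L2_derivative L (\<lambda>s x. U s x / c) (\<lambda>x. D x / c) t"
  using has_L2_derivative_mult_continuous[of L U D t "\<lambda>x. 1 / c"] by simp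

lemma has_L2_derivative_scale_fixed:
  assumes c: "(c has_real_derivative c') (at t)" and f: "in_L2 L f"
  shows "has_L2_derivative L (\<lambda>s x. c s * f x) (\<lambda>x. c' * f x) t"
  using L2_tendsto_scale_fixed[OF _ f, of "\<lambda>s. (c s - c t) / (s - t)" c' "at t"] c f
  by (simp add: has_L2_derivative_def has_field_derivative_iff left_diff_distrib)

lemma has_L2_derivative_shift:
  assumes "has_L2_derivative L U D (t + h)"
  shows "has_L2_derivative L (\<lambda>s. U (s + h)) D t"
proof -
  have "filterlim (\<lambda>s. s + h) (at (t + h)) (at t)"
    unfolding filterlim_at by (auto intro!: tendsto_eq_intros simp: eventually_at_filter)
  then show ?thesis
    using assms L2_tendsto_compose[of L "\<lambda>s x. (U s x - U (t + h) x) / (s - (t + h))" D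
        "at (t + h)" "\<lambda>s. s + h" "at t"]
    by (simp add: has_L2_derivative_def)
qed

lemma has_L2_derivative_transform_on_open:
  assumes U: "has_L2_derivative L U D t" and S: "open S" "t \<in> S"
    and eq: "\<And>s x. s \<in> S \<Longrightarrow> x \<in> {0..L} \<Longrightarrow> U s x = V s x"
  shows "has_L2_derivative L V D t"
proof -
  have "\<forall>\<^sub>F s in at t. s \<in> S"
    using S by (rule eventually_at_in_open')
  then have "\<forall>\<^sub>F s in at t. \<forall>x\<in>{0..L}. (U s x - U t x) / (s - t) = (V s x - V t x) / (s - t)"
    by eventually_elim (simp add: eq S)
  from iffD1[OF L2_tendsto_cong[OF this]]
  have "L2_tendsto L (\<lambda>s x. (V s x - V t x) / (s - t)) D (at t)"
    using U by (simp add: has_L2_derivative_def)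
  moreover have "in_L2 L (V t)"
    using U in_L2_cong[OF eq[OF S(2)]] by (simp add: has_L2_derivative_def)
  ultimately show ?thesis
    by (simp add: has_L2_derivative_def)
qed

section \<open>Curves in L2(0,L) and their Steklov averages\<close>

lemma (in pair_sigma_finite) integrable_mult_pair:
  fixes f :: "'a \<Rightarrow> real" and g :: "'b \<Rightarrow> real"
  assumes f: "integrable M1 f" and g: "integrable M2 g"
  shows "integrable (M1 \<Otimes>\<^sub>M M2) (\<lambda>(x, y). f x * g y)"
proof (rule Fubini_integrable)
  have [measurable]: "f \<in> borel_measurable M1" "g \<in> borel_measurable M2"
    using f g by auto
  show "(\<lambda>(x, y). f x * g y) \<in> borel_measurable (M1 \<Otimes>\<^sub>M M2)"
    by measurable
  show "integrable M1 (\<lambda>x. LINT y|M2. norm (case (x, y) of (x, y) \<Rightarrow> f x * g y))"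
    using f by (simp add: abs_mult)
  show "AE x in M1. integrable M2 (\<lambda>y. case (x, y) of (x, y) \<Rightarrow> f x * g y)"
    using g by simp
qed

lemma (in pair_sigma_finite) integrable_dominated_pair:
  fixes Z :: "'a \<Rightarrow> 'b \<Rightarrow> real" and k :: "'a \<Rightarrow> real" and f :: "'b \<Rightarrow> real"
  assumes Z: "case_prod Z \<in> borel_measurable (M1 \<Otimes>\<^sub>M M2)"
    and k: "integrable M1 k" and f: "integrable M2 f"
    and dominated: "AE t in M1. \<forall>x. \<bar>Z t x\<bar> \<le> k t"
  shows "integrable (M1 \<Otimes>\<^sub>M M2) (\<lambda>(t, x). Z t x * f x)"
proof (rule Bochner_Integration.integrable_bound[OF integrable_mult_pair[OF k integrable_abs[OF f]]])
  have [measurable]: "(\<lambda>p. Z (fst p) (snd p)) \<in> borel_measurable (M1 \<Otimes>\<^sub>M M2)"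
    "f \<in> borel_measurable M2" "k \<in> borel_measurable M1"
    using Z k f by (auto simp: case_prod_unfold)
  show "(\<lambda>(t, x). Z t x * f x) \<in> borel_measurable (M1 \<Otimes>\<^sub>M M2)"
    unfolding case_prod_unfold by measurable
  have "AE p in M1 \<Otimes>\<^sub>M M2. \<bar>Z (fst p) (snd p)\<bar> \<le> k (fst p)"
  proof (rule AE_pair_measure)
    show "AE t in M1. AE x in M2. \<bar>Z (fst (t, x)) (snd (t, x))\<bar> \<le> k (fst (t, x))"
      using dominated by eventually_elim simp
  qed measurable
  then show "AE p in M1 \<Otimes>\<^sub>M M2. norm (case p of (t, x) \<Rightarrow> Z t x * f x) \<le> norm (case p of (t, x) \<Rightarrow> k t * \<bar>f x\<bar>)"
    by eventually_elim
      (auto simp: abs_mult split: prod.splits intro!: mult_right_mono elim: order_trans[OF _ abs_ge_self])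
qed

locale dominated_curve =
  fixes L :: real and Z :: "real \<Rightarrow> real \<Rightarrow> real" and k :: "real \<Rightarrow> real"
  assumes measurable_curve: "set_borel_measurable lborel ({0..} \<times> {0..L}) (\<lambda>(t, x). Z t x)"
    and dominated: "AE t in lborel. 0 \<le> t \<longrightarrow> (\<forall>x\<in>{0..L}. \<bar>Z t x\<bar> \<le> k t)"
    and set_integrable_bound: "\<And>T. set_integrable lborel {0..T} k"
begin

lemma set_integrable_bound_Icc: "0 \<le> s \<Longrightarrow> set_integrable lborel {s..t} k"
  by (rule set_integrable_subset[OF set_integrable_bound[of t]]) auto

lemma measurable_extension:
  "(\<lambda>(t, x). indicator ({0..} \<times> {0..L}) (t, x) * Z t x) \<in> borel_measurable (lborel \<Otimes>\<^sub>M lborel)"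
  using measurable_curve unfolding set_borel_measurable_def lborel_prod
  by (simp add: case_prod_unfold)

lemma set_integrable_slice:
  assumes s: "0 \<le> s" and x: "x \<in> {0..L}"
  shows "set_integrable lborel {s..t} (\<lambda>\<tau>. Z \<tau> x)"
proof (rule Set_Integral.set_integrable_bound[OF set_integrable_bound_Icc[OF s, of t]])
  have "(\<lambda>\<tau>. indicator ({0..} \<times> {0..L}) (\<tau>, x) * Z \<tau> x) \<in> borel_measurable lborel"
    using measurable_Pair1[OF measurable_extension, of x] by simp
  then have "(\<lambda>\<tau>. indicator {s..t} \<tau> * (indicator ({0..} \<times> {0..L}) (\<tau>, x) * Z \<tau> x)) \<in> borel_measurable lborel"
    by (rule borel_measurable_times[rotated]) simp
  also have "(\<lambda>\<tau>. indicator {s..t} \<tau> * (indicator ({0..} \<times> {0..L}) (\<tau>, x) * Z \<tau> x))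
      = (\<lambda>\<tau>. indicator {s..t} \<tau> *\<^sub>R Z \<tau> x)"
    using s x by (auto simp: indicator_def)
  finally show "set_borel_measurable lborel {s..t} (\<lambda>\<tau>. Z \<tau> x)"
    unfolding set_borel_measurable_def .
  show "AE \<tau> in lborel. \<tau> \<in> {s..t} \<longrightarrow> norm (Z \<tau> x) \<le> norm (k \<tau>)"
    using dominated by eventually_elim (use s x in fastforce)
qed

lemma
  assumes s: "0 \<le> s" and f: "set_integrable lborel {0..L} f"
  shows set_integrable_LINT_space: "set_integrable lborel {s..t} (\<lambda>\<tau>. LINT x:{0..L}|lborel. Z \<tau> x * f x)"
    and LINT_time_space_swap: "(LINT x:{0..L}|lborel. (LINT \<tau>:{s..t}|lborel. Z \<tau> x) * f x)
       = (LINT \<tau>:{s..t}|lborel. LINT x:{0..L}|lborel. Z \<tau> x * f x)"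
proof -
  define H where "H \<tau> x = indicator {s..t} \<tau> * (indicator ({0..} \<times> {0..L}) (\<tau>, x) * Z \<tau> x)" for \<tau> x
  define f0 where "f0 x = indicator {0..L} x * f x" for x
  have H_eq: "H \<tau> x * f0 x = indicator {s..t} \<tau> * (indicator {0..L} x * (Z \<tau> x * f x))" for \<tau> x
    using s by (auto simp: H_def f0_def indicator_def)
  have integrable: "integrable (lborel \<Otimes>\<^sub>M lborel) (\<lambda>(\<tau>, x). H \<tau> x * f0 x)"
  proof (rule lborel_pair.integrable_dominated_pair)
    have [measurable]:
      "(\<lambda>p. indicator ({0..} \<times> {0..L}) p * Z (fst p) (snd p)) \<in> borel_measurable (lborel \<Otimes>\<^sub>M lborel)"
      using measurable_extension by (simp add: case_prod_unfold)
    show "case_prod H \<in> borel_measurable (lborel \<Otimes>\<^sub>M lborel)"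
      unfolding H_def[abs_def] case_prod_unfold by simp
    show "integrable lborel (\<lambda>\<tau>. indicator {s..t} \<tau> * \<bar>k \<tau>\<bar>)"
      using set_integrable_abs[OF set_integrable_bound_Icc[OF s]] by (simp add: set_integrable_def)
    show "integrable lborel f0"
      using f by (simp add: f0_def[abs_def] set_integrable_def)
    show "AE \<tau> in lborel. \<forall>x. \<bar>H \<tau> x\<bar> \<le> indicator {s..t} \<tau> * \<bar>k \<tau>\<bar>"
      using dominated
      by eventually_elim (use s in \<open>auto simp: H_def indicator_def intro: order_trans[OF _ abs_ge_self]\<close>)
  qed
  have over_space: "(LINT x|lborel. H \<tau> x * f0 x)
      = indicator {s..t} \<tau> *\<^sub>R (LINT x:{0..L}|lborel. Z \<tau> x * f x)" for \<tau>
    by (simp add: H_eq set_lebesgue_integral_def)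
  have over_time: "(LINT \<tau>|lborel. H \<tau> x * f0 x)
      = indicator {0..L} x *\<^sub>R ((LINT \<tau>:{s..t}|lborel. Z \<tau> x) * f x)" for x
  proof -
    have "(LINT \<tau>|lborel. H \<tau> x * f0 x) = (LINT \<tau>|lborel. (indicator {s..t} \<tau> *\<^sub>R Z \<tau> x) * f0 x)"
      using s by (intro Bochner_Integration.integral_cong) (auto simp: H_def f0_def indicator_def)
    then show ?thesis
      by (simp add: set_lebesgue_integral_def f0_def)
  qed
  show "set_integrable lborel {s..t} (\<lambda>\<tau>. LINT x:{0..L}|lborel. Z \<tau> x * f x)"
    using lborel_pair.integrable_fst[OF integrable] unfolding over_space by (simp add: set_integrable_def)
  show "(LINT x:{0..L}|lborel. (LINT \<tau>:{s..t}|lborel. Z \<tau> x) * f x)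
      = (LINT \<tau>:{s..t}|lborel. LINT x:{0..L}|lborel. Z \<tau> x * f x)"
    using lborel_pair.Fubini_integral[OF integrable] unfolding over_space over_time
    by (simp add: set_lebesgue_integral_def)
qed

lemma continuous_on_LINT_time:
  assumes continuous: "AE t in lborel. 0 \<le> t \<longrightarrow> continuous_on {0..L} (Z t)" and s: "0 \<le> s"
  shows "continuous_on {0..L} (\<lambda>x. LINT \<tau>:{s..t}|lborel. Z \<tau> x)"
  unfolding continuous_on_sequentially
proof (intro allI ballI impI, elim conjE)
  fix X a assume a: "a \<in> {0..L}" and X: "\<forall>n. X n \<in> {0..L}" and X_tendsto: "X \<longlonglongrightarrow> a"
  have slice_measurable: "(\<lambda>\<tau>. indicator {s..t} \<tau> *\<^sub>R Z \<tau> x) \<in> borel_measurable lborel" if "x \<in> {0..L}" for x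
    using set_integrable_slice[OF s that] unfolding set_integrable_def by (rule borel_measurable_integrable)
  have "(\<lambda>n. LINT \<tau>|lborel. indicator {s..t} \<tau> *\<^sub>R Z \<tau> (X n)) \<longlonglongrightarrow> (LINT \<tau>|lborel. indicator {s..t} \<tau> *\<^sub>R Z \<tau> a)"
  proof (rule integral_dominated_convergence[where w = "\<lambda>\<tau>. indicator {s..t} \<tau> *\<^sub>R k \<tau>"])
    show "integrable lborel (\<lambda>\<tau>. indicator {s..t} \<tau> *\<^sub>R k \<tau>)"
      using set_integrable_bound_Icc[OF s] by (simp add: set_integrable_def)
    show "AE \<tau> in lborel. norm (indicator {s..t} \<tau> *\<^sub>R Z \<tau> (X n)) \<le> indicator {s..t} \<tau> *\<^sub>R k \<tau>" for n
      using dominated by eventually_elim (use s X in \<open>auto simp: indicator_def\<close>)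
    show "AE \<tau> in lborel. (\<lambda>n. indicator {s..t} \<tau> *\<^sub>R Z \<tau> (X n)) \<longlonglongrightarrow> indicator {s..t} \<tau> *\<^sub>R Z \<tau> a"
      using continuous
    proof eventually_elim
      case (elim \<tau>)
      have "(\<lambda>n. Z \<tau> (X n)) \<longlonglongrightarrow> Z \<tau> a" if "\<tau> \<in> {s..t}"
        using elim that s a X X_tendsto unfolding continuous_on_sequentially comp_def by auto
      then show ?case
        by (cases "\<tau> \<in> {s..t}") (auto intro!: tendsto_intros)
    qed
  qed (use a X in \<open>blast intro: slice_measurable\<close>)+
  then show "((\<lambda>x. LINT \<tau>:{s..t}|lborel. Z \<tau> x) \<circ> X) \<longlonglongrightarrow> (LINT \<tau>:{s..t}|lborel. Z \<tau> a)"
    by (simp add: comp_def set_lebesgue_integral_def)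
qed

end

definition steklov :: "(real \<Rightarrow> real \<Rightarrow> real) \<Rightarrow> real \<Rightarrow> real \<Rightarrow> real \<Rightarrow> real" where
  "steklov Z h t x = (LINT s:{t..t+h}|lborel. Z s x) / h"

context dominated_curve
begin

lemma continuous_on_steklov:
  assumes "AE t in lborel. 0 \<le> t \<longrightarrow> continuous_on {0..L} (Z t)" "0 \<le> t"
  shows "continuous_on {0..L} (steklov Z h t)"
proof (cases "h = 0")
  case False
  then show ?thesis
    unfolding steklov_def[abs_def] by (intro continuous_intros continuous_on_LINT_time assms) simp
qed (simp add: steklov_def[abs_def])

lemma L2inner_steklov:
  assumes "0 \<le> t" "in_L2 L f"
  shows "L2inner L (steklov Z h t) f = (LINT s:{t..t+h}|lborel. L2inner L (Z s) f) / h"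
  using LINT_time_space_swap[OF assms(1) in_L2_integrable[OF assms(2)]]
  unfolding steklov_def[abs_def] L2inner_divide_left by (simp add: L2inner_def)

end

lemma LINT_Icc_combine:
  fixes f :: "real \<Rightarrow> real"
  assumes "a \<le> b" "b \<le> c" "set_integrable lborel {a..c} f"
  shows "(LINT x:{a..c}|lborel. f x) = (LINT x:{a..b}|lborel. f x) + (LINT x:{b..c}|lborel. f x)"
proof -
  have "set_integrable lborel {a..b} f" "set_integrable lborel {b..c} f"
    using assms by (auto intro: set_integrable_subset)
  then show ?thesis
    using assms(3) Henstock_Kurzweil_Integration.integral_combine[OF assms(1,2)
        set_borel_integral_eq_integral(1)[OF assms(3)]]
    by (simp add: set_borel_integral_eq_integral(2))
qed

lemma LINT_Icc_self:
  fixes f :: "real \<Rightarrow> real"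
  shows "(LINT x:{a..a}|lborel. f x) = 0"
  unfolding set_lebesgue_integral_def
  by (rule integral_eq_zero_AE) (use AE_lborel_singleton[of a] in eventually_elim, simp)

lemma LINT_average_le:
  fixes p :: "real \<Rightarrow> real"
  assumes "0 < h" "continuous_on {t..t+h} p" "\<And>s. s \<in> {t..t+h} \<Longrightarrow> p s \<le> C"
  shows "(LINT s:{t..t+h}|lborel. p s) / h \<le> C"
proof -
  have "(LINT s:{t..t+h}|lborel. p s) \<le> (LINT s:{t..t+h}|lborel. C)"
    using assms by (intro set_integral_mono borel_integrable_atLeastAtMost' continuous_intros) auto
  also have "\<dots> = C * h"
    using assms(1) by (simp add: set_lebesgue_integral_def)
  finally show ?thesis
    using assms(1) by (simp add: divide_le_eq)
qed

lemma integral_from_0_has_derivative: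
  fixes p :: "real \<Rightarrow> real"
  assumes p: "\<And>T. continuous_on {0..T} p" and t: "0 < t"
  shows "((\<lambda>t. integral {0..t} p) has_real_derivative p t) (at t)"
proof -
  have "((\<lambda>t. integral {0..t} p) has_real_derivative p t) (at t within {0..t + 1})"
    using integral_has_real_derivative[OF p[of "t + 1"]] t by simp
  moreover have "at t within {0..t + 1} = at t"
    using t by (intro at_within_Icc_at) auto
  ultimately show ?thesis
    by simp
qed

lemma average_antiderivative:
  fixes m :: "real \<Rightarrow> real"
  assumes m_nonneg: "\<And>t. 0 \<le> m t" and m: "\<And>T. set_integrable lborel {0..T} m" and h: "0 < h"
  obtains F where
    "\<And>t. 0 < t \<Longrightarrow> (F has_real_derivative (LINT s:{t..t+h}|lborel. m s) / h) (at t)"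
    "\<And>t. 0 \<le> t \<Longrightarrow> 0 \<le> F t" "\<And>t. 0 \<le> t \<Longrightarrow> F t \<le> (LINT s:{0..t+h}|lborel. m s)"
proof -
  define M where "M t = (LINT s:{0..t}|lborel. m s)" for t
  have M_diff: "M t - M s = (LINT r:{s..t}|lborel. m r)" if "0 \<le> s" "s \<le> t" for s t
    using LINT_Icc_combine[OF that m] by (simp add: M_def)
  have M_nonneg: "0 \<le> M t" for t
    unfolding M_def by (rule set_integral_nonneg) (rule m_nonneg)
  have M_mono: "M s \<le> M t" if "0 \<le> s" "s \<le> t" for s t
    using M_diff[OF that] set_integral_nonneg[of "{s..t}" m lborel] m_nonneg by simp
  have "M t = integral {0..t} m" for t
    unfolding M_def by (rule set_borel_integral_eq_integral(2)[OF m])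
  then have M: "continuous_on {0..T} M" for T
    using indefinite_integral_continuous_1[OF set_borel_integral_eq_integral(1)[OF m[of T]]]
    by (simp cong: continuous_on_cong)
  define P where "P t = integral {0..t} M" for t
  have P: "(P has_real_derivative M t) (at t)" if "0 < t" for t
    unfolding P_def[abs_def] by (rule integral_from_0_has_derivative[OF M that])
  have P_diff: "P (t + h) - P t = integral {t..t+h} M" if "0 \<le> t" for t
    using Henstock_Kurzweil_Integration.integral_combine[of 0 t "t + h" M] that h
      integrable_continuous_real[OF M[of "t + h"]] by (simp add: P_def)
  show ?thesis
  proof (rule that[of "\<lambda>t. (P (t + h) - P t) / h"])
    show "((\<lambda>t. (P (t + h) - P t) / h) has_real_derivative (LINT s:{t..t+h}|lborel. m s) / h) (at t)"
      if "0 < t" for t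
      using that h P[of t] P[of "t + h"] M_diff[of t "t + h"]
      by (auto intro!: derivative_eq_intros simp: DERIV_shift)
  next
    fix t :: real assume t: "0 \<le> t"
    have M_t: "M integrable_on {t..t+h}"
      using t by (intro integrable_continuous_real continuous_on_subset[OF M[of "t + h"]]) auto
    then have "integral {t..t+h} M \<le> integral {t..t+h} (\<lambda>_. M (t + h))"
      using t by (intro integral_le M_mono) auto
    then show "(P (t + h) - P t) / h \<le> (LINT s:{0..t+h}|lborel. m s)"
      using h t by (simp add: P_diff M_def divide_le_eq mult.commute)
    show "0 \<le> (P (t + h) - P t) / h"
      using h t M_nonneg M_t by (simp add: P_diff Henstock_Kurzweil_Integration.integral_nonneg)
  qed
qed

locale L2_curve =
  fixes L :: real and Z :: "real \<Rightarrow> real \<Rightarrow> real" and m :: "real \<Rightarrow> real"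
  assumes curve_measurable: "set_borel_measurable lborel ({0..} \<times> {0..L}) (\<lambda>(t, x). Z t x)"
    and curve_continuous: "AE t in lborel. 0 \<le> t \<longrightarrow> continuous_on {0..L} (Z t)"
    and curve_square_le: "AE t in lborel. 0 \<le> t \<longrightarrow> (\<forall>x\<in>{0..L}. (Z t x)\<^sup>2 \<le> m t)"
    and bound_nonneg: "\<And>t. 0 \<le> m t"
    and bound_integrable: "\<And>T. set_integrable lborel {0..T} m"
    and curve_tendsto: "\<And>t. 0 \<le> t \<Longrightarrow> L2_tendsto L Z (Z t) (at t within {0..})"

sublocale L2_curve \<subseteq> curve: dominated_curve L Z "\<lambda>t. 1 + m t"
proof
  show "AE t in lborel. 0 \<le> t \<longrightarrow> (\<forall>x\<in>{0..L}. \<bar>Z t x\<bar> \<le> 1 + m t)"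
    using curve_square_le
  proof eventually_elim
    case (elim t)
    show ?case
    proof (intro impI ballI)
      fix x assume "0 \<le> t" "x \<in> {0..L}"
      then have "(Z t x)\<^sup>2 \<le> m t"
        using elim by blast
      moreover have "2 * \<bar>Z t x\<bar> \<le> 1 + (Z t x)\<^sup>2"
        using sum_squares_bound[of 1 "\<bar>Z t x\<bar>"] by simp
      ultimately show "\<bar>Z t x\<bar> \<le> 1 + m t"
        using bound_nonneg[of t] by linarith
    qed
  qed
  show "set_integrable lborel {0..T} (\<lambda>t. 1 + m t)" for T
    by (intro set_integral_add bound_integrable borel_integrable_atLeastAtMost' continuous_intros)
qed (rule curve_measurable)

sublocale L2_curve \<subseteq> energy: dominated_curve L "\<lambda>t x. (Z t x)\<^sup>2 / 2" "\<lambda>t. m t / 2"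
proof
  have "(\<lambda>p. (indicator ({0..} \<times> {0..L}) p *\<^sub>R (case p of (t, x) \<Rightarrow> Z t x))\<^sup>2 / 2) \<in> borel_measurable lborel"
    using curve_measurable unfolding set_borel_measurable_def by measurable
  moreover have "(\<lambda>p. (indicator ({0..} \<times> {0..L}) p *\<^sub>R (case p of (t, x) \<Rightarrow> Z t x))\<^sup>2 / 2)
      = (\<lambda>p. indicator ({0..} \<times> {0..L}) p *\<^sub>R (case p of (t, x) \<Rightarrow> (Z t x)\<^sup>2 / 2))"
    by (auto simp: indicator_def)
  ultimately show "set_borel_measurable lborel ({0..} \<times> {0..L}) (\<lambda>(t, x). (Z t x)\<^sup>2 / 2)"
    by (simp add: set_borel_measurable_def)
  show "AE t in lborel. 0 \<le> t \<longrightarrow> (\<forall>x\<in>{0..L}. \<bar>(Z t x)\<^sup>2 / 2\<bar> \<le> m t / 2)"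
    using curve_square_le by eventually_elim auto
  show "set_integrable lborel {0..T} (\<lambda>t. m t / 2)" for T
    using bound_integrable by simp
qed

context L2_curve
begin

lemma curve_in_L2: "0 \<le> t \<Longrightarrow> in_L2 L (Z t)"
  using curve_tendsto[of t] by (simp add: L2_tendsto_def)

lemma curve_near:
  assumes t: "0 \<le> t" and e: "0 < e"
  shows "\<exists>d>0. \<forall>s\<ge>0. \<bar>s - t\<bar> < d \<longrightarrow> L2norm L (\<lambda>x. Z s x - Z t x) \<le> e"
proof -
  have "\<forall>\<^sub>F s in at t within {0..}. L2norm L (\<lambda>x. Z s x - Z t x) < e"
    using curve_tendsto[OF t] unfolding L2_tendsto_def by (intro order_tendstoD(2)[OF _ e]) blast
  then obtain d where d: "0 < d"
    "\<And>s. 0 \<le> s \<Longrightarrow> s \<noteq> t \<Longrightarrow> \<bar>s - t\<bar> < d \<Longrightarrow> L2norm L (\<lambda>x. Z s x - Z t x) < e"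
    unfolding eventually_at dist_real_def by auto
  show ?thesis
  proof (intro exI[of _ d] conjI allI impI)
    show "L2norm L (\<lambda>x. Z s x - Z t x) \<le> e" if "0 \<le> s" "\<bar>s - t\<bar> < d" for s
      using d(2)[OF that(1) _ that(2)] e by (cases "s = t") auto
  qed (rule d(1))
qed

lemma curve_tendsto_compose:
  assumes f: "(f \<longlongrightarrow> t) F" "\<forall>\<^sub>F n in F. 0 \<le> f n" and t: "0 \<le> t"
  shows "L2_tendsto L (\<lambda>n. Z (f n)) (Z t) F"
proof (rule L2_tendstoI)
  show "\<forall>\<^sub>F n in F. in_L2 L (Z (f n))"
    using f(2) by eventually_elim (rule curve_in_L2)
  fix e :: real assume "0 < e"
  then obtain d where d: "0 < d" "\<And>s. 0 \<le> s \<Longrightarrow> \<bar>s - t\<bar> < d \<Longrightarrow> L2norm L (\<lambda>x. Z s x - Z t x) \<le> e"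
    using curve_near[OF t] by blast
  show "\<forall>\<^sub>F n in F. L2norm L (\<lambda>x. Z (f n) x - Z t x) \<le> e"
    using f(2) tendstoD[OF f(1) d(1)] by eventually_elim (simp add: d(2) dist_real_def)
qed (rule curve_in_L2[OF t])

lemma uniformly_continuous_curve:
  assumes e: "0 < e"
  shows "\<exists>d>0. \<forall>s\<in>{0..T}. \<forall>t\<in>{0..T}. \<bar>s - t\<bar> < d \<longrightarrow> L2norm L (\<lambda>x. Z s x - Z t x) < e"
proof -
  let ?S = "{0..T} \<times> {0..T}"
  define D where "D p = L2norm L (\<lambda>x. Z (fst p) x - Z (snd p) x)" for p
  have "continuous_on ?S D"
    unfolding continuous_on_def D_def
  proof (intro ballI L2_tendsto_L2norm L2_tendsto_diff curve_tendsto_compose tendsto_intros)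
    show "\<forall>\<^sub>F q in at p within ?S. 0 \<le> fst q" "\<forall>\<^sub>F q in at p within ?S. 0 \<le> snd q" for p
      unfolding eventually_at_filter by (auto intro!: always_eventually)
  qed auto
  then have "uniformly_continuous_on ?S D"
    by (intro compact_uniformly_continuous compact_Times compact_Icc)
  then obtain d where d: "0 < d" "\<And>p q. p \<in> ?S \<Longrightarrow> q \<in> ?S \<Longrightarrow> dist q p < d \<Longrightarrow> dist (D q) (D p) < e"
    using e unfolding uniformly_continuous_on_def by metis
  show ?thesis
  proof (intro exI[of _ d] conjI ballI impI)
    fix s t assume st: "s \<in> {0..T}" "t \<in> {0..T}" "\<bar>s - t\<bar> < d"
    then have "dist (D (s, t)) (D (t, t)) < e"
      by (intro d(2)) (auto simp: dist_Pair_Pair dist_real_def)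
    then show "L2norm L (\<lambda>x. Z s x - Z t x) < e"
      by (simp add: D_def)
  qed (rule d(1))
qed

lemma continuous_on_L2inner_curve: "in_L2 L f \<Longrightarrow> continuous_on {0..} (\<lambda>s. L2inner L (Z s) f)"
  unfolding continuous_on_def by (auto intro!: L2_tendsto_L2inner L2_tendsto_const curve_tendsto)

lemma continuous_on_L2norm_curve: "continuous_on {0..} (\<lambda>s. L2norm L (Z s))"
  unfolding continuous_on_def by (auto intro!: L2_tendsto_L2norm curve_tendsto)

lemma in_L2_steklov: "0 \<le> t \<Longrightarrow> in_L2 L (steklov Z h t)"
  by (intro in_L2_continuous curve.continuous_on_steklov curve_continuous)

lemma L2inner_steklov_le:
  assumes t: "0 \<le> t" and h: "0 < h" and f: "in_L2 L f"
    and le: "\<And>s. s \<in> {t..t+h} \<Longrightarrow> L2inner L (Z s) f \<le> C"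
  shows "L2inner L (steklov Z h t) f \<le> C"
  unfolding curve.L2inner_steklov[OF t f] using t
  by (intro LINT_average_le h le continuous_on_subset[OF continuous_on_L2inner_curve[OF f]]) auto

text \<open>Minkowski's inequality for the average, by duality.\<close>

lemma L2norm_steklov_diff_le:
  assumes t: "0 \<le> t" and h: "0 < h" and v: "in_L2 L v"
    and close: "\<And>s. s \<in> {t..t+h} \<Longrightarrow> L2norm L (\<lambda>x. Z s x - v x) \<le> \<omega>"
  shows "L2norm L (\<lambda>x. steklov Z h t x - v x) \<le> \<omega>"
proof -
  define z where "z = (\<lambda>x. steklov Z h t x - v x)"
  have z: "in_L2 L z"
    unfolding z_def by (intro in_L2_diff in_L2_steklov v t)
  have "L2inner L (steklov Z h t) z \<le> L2inner L v z + \<omega> * L2norm L z"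
  proof (rule L2inner_steklov_le[OF t h z])
    fix s assume s: "s \<in> {t..t+h}"
    then have Zs: "in_L2 L (Z s)"
      using t by (intro curve_in_L2) auto
    have "L2inner L (Z s) z - L2inner L v z = L2inner L (\<lambda>x. Z s x - v x) z"
      by (simp add: L2inner_bilinear Zs v z)
    also have "\<dots> \<le> L2norm L (\<lambda>x. Z s x - v x) * L2norm L z"
      by (intro order_trans[OF abs_ge_self L2_Cauchy_Schwarz] in_L2_diff Zs v z)
    also have "\<dots> \<le> \<omega> * L2norm L z"
      by (intro mult_right_mono close s L2norm_nonneg)
    finally show "L2inner L (Z s) z \<le> L2inner L v z + \<omega> * L2norm L z"
      by simp
  qed
  moreover have "L2inner L z z = L2inner L (steklov Z h t) z - L2inner L v z"
    unfolding z_def using z[unfolded z_def] t by (intro L2inner_diff_left in_L2_steklov v)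
  ultimately have "L2norm L z * L2norm L z \<le> \<omega> * L2norm L z"
    by (simp flip: power2_eq_square L2norm_power2)
  moreover have "0 \<le> \<omega>"
    using order_trans[OF L2norm_nonneg close[of t]] h by simp
  ultimately show ?thesis
    unfolding z_def[symmetric] using L2norm_nonneg[of L z] by (cases "L2norm L z = 0") auto
qed

lemma steklov_tendsto:
  assumes t: "0 \<le> t"
  shows "L2_tendsto L (\<lambda>h. steklov Z h t) (Z t) (at_right 0)"
proof (rule L2_tendstoI)
  show "\<forall>\<^sub>F h in at_right 0. in_L2 L (steklov Z h t)"
    by (simp add: in_L2_steklov[OF t])
  fix e :: real assume "0 < e"
  then obtain d where d: "0 < d" "\<And>s. 0 \<le> s \<Longrightarrow> \<bar>s - t\<bar> < d \<Longrightarrow> L2norm L (\<lambda>x. Z s x - Z t x) \<le> e"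
    using curve_near[OF t] by blast
  show "\<forall>\<^sub>F h in at_right 0. L2norm L (\<lambda>x. steklov Z h t x - Z t x) \<le> e"
    unfolding eventually_at_right_field
  proof (intro exI[of _ d] conjI allI impI d(1))
    fix h :: real assume h: "0 < h" "h < d"
    show "L2norm L (\<lambda>x. steklov Z h t x - Z t x) \<le> e"
      using t h by (intro L2norm_steklov_diff_le curve_in_L2 d(2)) auto
  qed
qed (rule curve_in_L2[OF t])

lemma has_L2_derivative_LINT:
  assumes t: "0 < t"
  shows "has_L2_derivative L (\<lambda>t x. LINT s:{0..t}|lborel. Z s x) (Z t) t"
proof -
  define I where "I t x = (LINT s:{0..t}|lborel. Z s x)" for t x
  have I: "in_L2 L (I r)" for r
    unfolding I_def by (intro in_L2_continuous curve.continuous_on_LINT_time curve_continuous order_refl)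
  have "L2_tendsto L (\<lambda>s x. (I s x - I t x) / (s - t)) (Z t) (at t)"
  proof (rule L2_tendstoI)
    show "\<forall>\<^sub>F s in at t. in_L2 L (\<lambda>x. (I s x - I t x) / (s - t))"
      by (simp add: I)
    fix e :: real assume "0 < e"
    then obtain d where d: "0 < d" "\<And>s. 0 \<le> s \<Longrightarrow> \<bar>s - t\<bar> < d \<Longrightarrow> L2norm L (\<lambda>x. Z s x - Z t x) \<le> e"
      using curve_near[of t] t by auto
    show "\<forall>\<^sub>F s in at t. L2norm L (\<lambda>x. (I s x - I t x) / (s - t) - Z t x) \<le> e"
      unfolding eventually_at
    proof (intro exI[of _ "min d t"] conjI ballI impI)
      fix s assume s: "s \<noteq> t \<and> dist s t < min d t"
      then have s_pos: "0 < s"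
        by (auto simp: dist_real_def)
      let ?a = "min s t" and ?k = "\<bar>s - t\<bar>"
      have "(I s x - I t x) / (s - t) = steklov Z ?k ?a x" if x: "x \<in> {0..L}" for x
        using LINT_Icc_combine[of 0 s t "\<lambda>r. Z r x"] LINT_Icc_combine[of 0 t s "\<lambda>r. Z r x"]
          curve.set_integrable_slice[OF order_refl x] s s_pos t
        by (cases "s \<le> t") (auto simp: I_def steklov_def minus_divide_divide[symmetric, of _ "s - t"])
      then have "L2norm L (\<lambda>x. (I s x - I t x) / (s - t) - Z t x) = L2norm L (\<lambda>x. steklov Z ?k ?a x - Z t x)"
        by (intro L2norm_cong) simp
      also have "\<dots> \<le> e"
        using s s_pos t by (intro L2norm_steklov_diff_le curve_in_L2 d(2)) (auto simp: dist_real_def)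
      finally show "L2norm L (\<lambda>x. (I s x - I t x) / (s - t) - Z t x) \<le> e" .
    qed (use d(1) t in simp)
  qed (use t in \<open>simp add: curve_in_L2\<close>)
  with I show ?thesis
    by (simp add: has_L2_derivative_def I_def[abs_def])
qed

lemma has_L2_derivative_steklov:
  assumes t: "0 < t" and h: "0 < h"
  shows "has_L2_derivative L (steklov Z h) (\<lambda>x. (Z (t + h) x - Z t x) / h) t"
proof (rule has_L2_derivative_transform_on_open[where S = "{0<..}"])
  show "has_L2_derivative L (\<lambda>t x. ((LINT s:{0..t+h}|lborel. Z s x) - (LINT s:{0..t}|lborel. Z s x)) / h)
      (\<lambda>x. (Z (t + h) x - Z t x) / h) t"
    using t h by (intro has_L2_derivative_divide has_L2_derivative_diff has_L2_derivative_LINT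
        has_L2_derivative_shift[where U = "\<lambda>t x. LINT s:{0..t}|lborel. Z s x"]) auto
  show "((LINT r:{0..s+h}|lborel. Z r x) - (LINT r:{0..s}|lborel. Z r x)) / h = steklov Z h s x"
    if "s \<in> {0<..}" "x \<in> {0..L}" for s x
    using that h LINT_Icc_combine[of 0 s "s + h" "\<lambda>r. Z r x"] curve.set_integrable_slice[OF order_refl]
    by (simp add: steklov_def)
qed (use t in auto)

definition time_variance :: "real \<Rightarrow> real \<Rightarrow> real \<Rightarrow> real" where
  "time_variance h t x = steklov (\<lambda>s x. (Z s x)\<^sup>2 / 2) h t x - (steklov Z h t x)\<^sup>2 / 2"

lemma energy_continuous: "AE t in lborel. 0 \<le> t \<longrightarrow> continuous_on {0..L} (\<lambda>x. (Z t x)\<^sup>2 / 2)"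
  using curve_continuous by eventually_elim (auto intro!: continuous_intros)

lemma continuous_on_time_variance: "0 \<le> t \<Longrightarrow> continuous_on {0..L} (time_variance h t)"
  unfolding time_variance_def[abs_def]
  by (intro continuous_intros energy.continuous_on_steklov curve.continuous_on_steklov
      curve_continuous energy_continuous) auto

lemma time_variance_nonneg:
  assumes t: "0 \<le> t" and h: "0 < h" and x: "x \<in> {0..L}"
  shows "0 \<le> time_variance h t x"
proof -
  define u where "u = steklov Z h t x"
  have integrable: "set_integrable lborel {t..t+h} (\<lambda>s. Z s x)"
      "set_integrable lborel {t..t+h} (\<lambda>s. (Z s x)\<^sup>2 / 2)" "set_integrable lborel {t..t+h} (\<lambda>s. u\<^sup>2 / 2)"
    by (intro curve.set_integrable_slice energy.set_integrable_slice t x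
        borel_integrable_atLeastAtMost' continuous_intros; simp)+
  have "0 \<le> (LINT s:{t..t+h}|lborel. (Z s x - u)\<^sup>2 / 2)"
    by (rule set_integral_nonneg) simp
  also have "\<dots> = (LINT s:{t..t+h}|lborel. (Z s x)\<^sup>2 / 2 - u * Z s x + u\<^sup>2 / 2)"
    by (simp add: power2_diff algebra_simps add_divide_distrib diff_divide_distrib)
  also have "\<dots> = (LINT s:{t..t+h}|lborel. (Z s x)\<^sup>2 / 2) - u * (LINT s:{t..t+h}|lborel. Z s x)
      + (LINT s:{t..t+h}|lborel. u\<^sup>2 / 2)"
    using integrable
    by (simp only: set_integral_add set_integral_diff set_integrable_mult_right set_integral_mult_right)
  also have "\<dots> = h * time_variance h t x"
    using h
    by (simp add: u_def time_variance_def steklov_def set_lebesgue_integral_def power2_eq_square field_simps)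
  finally show ?thesis
    using h by (simp add: zero_le_mult_iff)
qed

lemma time_variance_le:
  assumes t: "0 \<le> t" and h: "0 < h" and x: "x \<in> {0..L}"
  shows "time_variance h t x \<le> (LINT s:{t..t+h}|lborel. m s) / h / 2"
proof -
  have "(LINT s:{t..t+h}|lborel. (Z s x)\<^sup>2 / 2) \<le> (LINT s:{t..t+h}|lborel. m s / 2)"
  proof (rule set_integral_mono_AE)
    show "AE s\<in>{t..t+h} in lborel. (Z s x)\<^sup>2 / 2 \<le> m s / 2"
      using curve_square_le by eventually_elim (use t x in auto)
  qed (intro energy.set_integrable_slice energy.set_integrable_bound_Icc t x)+
  then have "steklov (\<lambda>s x. (Z s x)\<^sup>2 / 2) h t x \<le> (LINT s:{t..t+h}|lborel. m s) / h / 2"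
    using h by (simp add: steklov_def field_simps)
  then show ?thesis
    unfolding time_variance_def using zero_le_power2[of "steklov Z h t x"] by linarith
qed

lemma L2inner_time_variance_le:
  assumes t: "0 \<le> t" and h: "0 < h"
    and close: "\<And>s. s \<in> {t..t+h} \<Longrightarrow> L2norm L (\<lambda>x. Z s x - Z t x) \<le> \<omega>"
  shows "L2inner L (time_variance h t) (\<lambda>_. 1) \<le> \<omega>\<^sup>2 / 2"
proof -
  let ?u = "steklov Z h t"
  define square_average where "square_average = (LINT s:{t..t+h}|lborel. (L2norm L (Z s))\<^sup>2) / h"
  note in_L2 = curve_in_L2[OF t] in_L2_steklov[OF t]
  have u2: "in_L2 L (\<lambda>x. (?u x)\<^sup>2 / 2)"
    using t by (intro in_L2_continuous continuous_intros curve.continuous_on_steklov curve_continuous) auto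
  have "L2inner L (steklov (\<lambda>s x. (Z s x)\<^sup>2 / 2) h t) (\<lambda>_. 1) = square_average / 2"
    unfolding energy.L2inner_steklov[OF t in_L2_const] square_average_def L2norm_power2
    by (simp add: L2inner_def power2_eq_square)
  moreover have "L2inner L (\<lambda>x. (?u x)\<^sup>2 / 2) (\<lambda>_. 1) = (L2norm L ?u)\<^sup>2 / 2"
    unfolding L2norm_power2 by (simp add: L2inner_def power2_eq_square)
  ultimately have "L2inner L (time_variance h t) (\<lambda>_. 1) = (square_average - (L2norm L ?u)\<^sup>2) / 2"
    unfolding time_variance_def[abs_def] using t
    by (subst L2inner_diff_left) (auto intro!: in_L2_continuous energy.continuous_on_steklov energy_continuous u2
        simp: diff_divide_distrib)
  moreover have "square_average - 2 * L2inner L ?u (Z t) \<le> \<omega>\<^sup>2 - (L2norm L (Z t))\<^sup>2"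
  proof -
    have continuous: "continuous_on {t..t+h} (\<lambda>s. (L2norm L (Z s))\<^sup>2)"
      "continuous_on {t..t+h} (\<lambda>s. L2inner L (Z s) (Z t))"
      using t by (auto intro!: continuous_intros continuous_on_L2inner_curve in_L2
          continuous_on_subset[OF continuous_on_L2norm_curve] continuous_on_subset[of "{0..}" _ "{t..t+h}"])
    have "(LINT s:{t..t+h}|lborel. (L2norm L (Z s))\<^sup>2 - 2 * L2inner L (Z s) (Z t)) / h \<le> \<omega>\<^sup>2 - (L2norm L (Z t))\<^sup>2"
    proof (rule LINT_average_le[OF h])
      show "continuous_on {t..t+h} (\<lambda>s. (L2norm L (Z s))\<^sup>2 - 2 * L2inner L (Z s) (Z t))"
        by (intro continuous_intros continuous)
      fix s assume s: "s \<in> {t..t+h}"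
      then show "(L2norm L (Z s))\<^sup>2 - 2 * L2inner L (Z s) (Z t) \<le> \<omega>\<^sup>2 - (L2norm L (Z t))\<^sup>2"
        using power_mono[OF close[OF s], of 2] t in_L2 by (simp add: L2norm_diff_power2 curve_in_L2)
    qed
    then show ?thesis
      using continuous[THEN borel_integrable_atLeastAtMost']
      by (simp add: square_average_def curve.L2inner_steklov t in_L2 diff_divide_distrib)
  qed
  moreover have "2 * L2inner L ?u (Z t) \<le> (L2norm L ?u)\<^sup>2 + (L2norm L (Z t))\<^sup>2"
    using zero_le_power2[of "L2norm L (\<lambda>x. ?u x - Z t x)"] in_L2 by (simp add: L2norm_diff_power2)
  ultimately show ?thesis
    by simp
qed

lemma L2norm_time_variance_le:
  assumes t: "0 \<le> t" and h: "0 < h" and L: "0 \<le> L"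
    and close: "\<And>s. s \<in> {t..t+h} \<Longrightarrow> L2norm L (\<lambda>x. Z s x - Z t x) \<le> \<omega>"
  shows "(L2norm L (time_variance h t))\<^sup>2 \<le> \<omega>\<^sup>2 / 4 * ((LINT s:{t..t+h}|lborel. m s) / h)"
proof -
  let ?r = "time_variance h t"
  define B where "B = (LINT s:{t..t+h}|lborel. m s) / h / 2"
  note bounds = time_variance_nonneg[OF t h] time_variance_le[OF t h, folded B_def]
  have "L2inner L ?r ?r \<le> (LINT x:{0..L}|lborel. B * (?r x * 1))"
    unfolding L2inner_def
    by (intro set_integral_mono borel_integrable_atLeastAtMost' continuous_intros continuous_on_time_variance t)
      (auto intro!: mult_right_mono bounds)
  also have "\<dots> = B * L2inner L ?r (\<lambda>_. 1)"
    by (simp only: set_integral_mult_right L2inner_def)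
  also have "\<dots> \<le> B * (\<omega>\<^sup>2 / 2)"
    using order_trans[OF bounds, of 0] L by (intro mult_left_mono L2inner_time_variance_le t h close) auto
  finally show ?thesis
    by (simp add: L2norm_power2 B_def mult_ac)
qed

end

section \<open>Continuously differentiable functions on an interval\<close>

definition C1_Icc :: "real \<Rightarrow> real \<Rightarrow> (real \<Rightarrow> real) \<Rightarrow> (real \<Rightarrow> real) \<Rightarrow> bool" where
  "C1_Icc a b f f' \<longleftrightarrow>
     (\<forall>x\<in>{a..b}. (f has_real_derivative f' x) (at x within {a..b})) \<and> continuous_on {a..b} f'"

lemma C1_Icc_has_derivative:
  "C1_Icc a b f f' \<Longrightarrow> x \<in> {a..b} \<Longrightarrow> (f has_real_derivative f' x) (at x within {a..b})"
  by (simp add: C1_Icc_def)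

lemma C1_Icc_continuous_derivative: "C1_Icc a b f f' \<Longrightarrow> continuous_on {a..b} f'"
  by (simp add: C1_Icc_def)

lemma C1_Icc_continuous: "C1_Icc a b f f' \<Longrightarrow> continuous_on {a..b} f"
  by (auto simp: C1_Icc_def intro: DERIV_continuous_on)

lemma C1_IccI:
  "(\<And>x. x \<in> {a..b} \<Longrightarrow> (f has_real_derivative f' x) (at x within {a..b})) \<Longrightarrow>
    continuous_on {a..b} f' \<Longrightarrow> C1_Icc a b f f'"
  by (simp add: C1_Icc_def)

lemma C1_Icc_const: "C1_Icc a b (\<lambda>x. c) (\<lambda>x. 0)"
  by (intro C1_IccI) auto

lemma C1_Icc_diff:
  "C1_Icc a b f f' \<Longrightarrow> C1_Icc a b g g' \<Longrightarrow> C1_Icc a b (\<lambda>x. f x - g x) (\<lambda>x. f' x - g' x)"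
  by (auto simp: C1_Icc_def intro!: derivative_eq_intros continuous_intros)

lemma C1_Icc_mult:
  assumes f: "C1_Icc a b f f'" and g: "C1_Icc a b g g'"
  shows "C1_Icc a b (\<lambda>x. f x * g x) (\<lambda>x. f' x * g x + f x * g' x)"
  using assms C1_Icc_continuous[OF f] C1_Icc_continuous[OF g]
  by (auto simp: C1_Icc_def intro!: derivative_eq_intros continuous_intros)

lemma C1_Icc_cmult: "C1_Icc a b f f' \<Longrightarrow> C1_Icc a b (\<lambda>x. c * f x) (\<lambda>x. c * f' x)"
  using C1_Icc_mult[OF C1_Icc_const] by simp

lemma C1_Icc_subset:
  "C1_Icc a b f f' \<Longrightarrow> {c..d} \<subseteq> {a..b} \<Longrightarrow> C1_Icc c d f f'"
  unfolding C1_Icc_def by (meson has_field_derivative_subset continuous_on_subset subsetD)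

lemma C1_Icc_cong:
  assumes "C1_Icc a b f f'" "\<And>x. x \<in> {a..b} \<Longrightarrow> f x = g x"
  shows "C1_Icc a b g f'"
proof (rule C1_IccI)
  show "(g has_real_derivative f' x) (at x within {a..b})" if "x \<in> {a..b}" for x
    by (rule has_field_derivative_transform_within[OF C1_Icc_has_derivative[OF assms(1) that] zero_less_one that])
      (rule assms(2))
qed (rule C1_Icc_continuous_derivative[OF assms(1)])

lemma C1_Icc_integral: "continuous_on {a..b} f \<Longrightarrow> C1_Icc a b (\<lambda>x. integral {a..x} f) f"
  by (intro C1_IccI integral_has_real_derivative)

lemma C1_Icc_FTC: "a \<le> b \<Longrightarrow> C1_Icc a b f f' \<Longrightarrow> (LINT x:{a..b}|lborel. f' x) = f b - f a"
  unfolding C1_Icc_def set_lebesgue_integral_def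
  by (intro integral_FTC_atLeastAtMost) (auto simp: has_real_derivative_iff_has_vector_derivative)

lemma L2inner_by_parts:
  assumes "0 \<le> L" and f: "C1_Icc 0 L f f'" and g: "C1_Icc 0 L g g'"
  shows "L2inner L f g' = f L * g L - f 0 * g 0 - L2inner L f' g"
proof -
  have "(LINT x:{0..L}|lborel. f' x * g x + f x * g' x) = f L * g L - f 0 * g 0"
    by (rule C1_Icc_FTC[OF assms(1) C1_Icc_mult[OF f g]])
  moreover have "(LINT x:{0..L}|lborel. f' x * g x + f x * g' x) = L2inner L f' g + L2inner L f g'"
    unfolding L2inner_def
    by (intro set_integral_add borel_integrable_atLeastAtMost' continuous_intros
        C1_Icc_continuous[OF f] C1_Icc_continuous[OF g]
        C1_Icc_continuous_derivative[OF f] C1_Icc_continuous_derivative[OF g])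
  ultimately show ?thesis
    by simp
qed

lemma L2inner_const_derivative:
  assumes "0 \<le> L" "C1_Icc 0 L f f'" "f 0 = 0" "f L = 0"
  shows "L2inner L (\<lambda>x. c) f' = 0"
  using L2inner_by_parts[OF assms(1) C1_Icc_const assms(2)] assms(3,4) by (simp add: L2inner_def)

text \<open>Integration by parts against the primitive of a merely square integrable function is Fubini's theorem on
  the triangle \<open>t \<le> x\<close>.\<close>

lemma dominated_curve_triangle:
  fixes g :: "real \<Rightarrow> real"
  assumes g: "integrable lborel g"
  shows "dominated_curve L (\<lambda>t x. if t \<le> x then g t else 0) (\<lambda>t. \<bar>g t\<bar>)"
proof
  have [measurable]: "g \<in> borel_measurable borel"
    using borel_measurable_integrable[OF g] by simp
  have "(\<lambda>(t, x). if t \<le> x then g t else 0) \<in> borel_measurable (lborel \<Otimes>\<^sub>M lborel)"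
    by measurable
  moreover have "{0..} \<times> {0..L} \<in> sets (borel :: (real \<times> real) measure)"
    by (intro borel_closed closed_Times) auto
  ultimately show "set_borel_measurable lborel ({0..} \<times> {0..L}) (\<lambda>(t, x). if t \<le> x then g t else 0)"
    unfolding set_borel_measurable_def lborel_prod
    by (intro borel_measurable_scaleR borel_measurable_indicator) simp_all
  show "set_integrable lborel {0..T} (\<lambda>t. \<bar>g t\<bar>)" for T
    using integrable_mult_indicator[OF _ integrable_abs[OF g]] by (simp add: set_integrable_def)
qed auto

lemma L2inner_by_parts_primitive:
  assumes L: "0 \<le> L" and D: "in_L2 L D" and f: "C1_Icc 0 L f f'"
  shows "L2inner L D f
    = (LINT s:{0..L}|lborel. D s) * f L - L2inner L (\<lambda>x. LINT s:{0..x}|lborel. D s) f'"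
proof -
  define g where "g x = indicator {0..L} x * D x" for x
  interpret triangle: dominated_curve L "\<lambda>t x. if t \<le> x then g t else 0" "\<lambda>t. \<bar>g t\<bar>"
    using in_L2_integrable[OF D] by (intro dominated_curve_triangle) (simp add: g_def[abs_def] set_integrable_def)
  have over_time: "(LINT t:{0..L}|lborel. if t \<le> x then g t else 0) = (LINT t:{0..x}|lborel. D t)"
    if "x \<in> {0..L}" for x
    unfolding set_lebesgue_integral_def
    by (intro Bochner_Integration.integral_cong) (use that in \<open>auto simp: g_def split: split_indicator\<close>)
  have over_space: "(LINT x:{0..L}|lborel. (if t \<le> x then g t else 0) * f' x) = D t * (f L - f t)"
    if t: "t \<in> {0..L}" for t
  proof -
    have "(LINT x:{0..L}|lborel. (if t \<le> x then g t else 0) * f' x) = (LINT x:{t..L}|lborel. D t * f' x)"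
      unfolding set_lebesgue_integral_def
      by (intro Bochner_Integration.integral_cong) (use t in \<open>auto simp: g_def split: split_indicator\<close>)
    also have "\<dots> = D t * (f L - f t)"
      using C1_Icc_FTC[OF _ C1_Icc_subset[OF f], of t L] t by simp
    finally show ?thesis .
  qed
  have "L2inner L (\<lambda>x. LINT s:{0..x}|lborel. D s) f'
      = (LINT x:{0..L}|lborel. (LINT t:{0..L}|lborel. if t \<le> x then g t else 0) * f' x)"
    unfolding L2inner_def by (rule set_lebesgue_integral_cong) (auto simp: over_time)
  also have "\<dots> = (LINT t:{0..L}|lborel. LINT x:{0..L}|lborel. (if t \<le> x then g t else 0) * f' x)"
    by (intro triangle.LINT_time_space_swap borel_integrable_atLeastAtMost' C1_Icc_continuous_derivative[OF f]) simp
  also have "\<dots> = (LINT t:{0..L}|lborel. D t * f L - D t * f t)"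
    by (rule set_lebesgue_integral_cong) (auto simp: over_space right_diff_distrib)
  also have "\<dots> = (LINT t:{0..L}|lborel. D t * f L) - (LINT t:{0..L}|lborel. D t * f t)"
    by (intro set_integral_diff set_integrable_mult_left in_L2_integrable[OF D]
        set_integrable_mult_L2[OF D in_L2_continuous[OF C1_Icc_continuous[OF f]]])
  also have "\<dots> = (LINT t:{0..L}|lborel. D t) * f L - L2inner L D f"
    by (simp add: L2inner_def)
  finally show ?thesis
    by simp
qed

lemma continuous_on_LINT_primitive:
  fixes g :: "real \<Rightarrow> real"
  assumes g: "set_integrable lborel {a..b} g"
  shows "continuous_on {a..b} (\<lambda>x. LINT s:{a..x}|lborel. g s)"
proof (rule continuous_on_eq)
  show "continuous_on {a..b} (\<lambda>x. integral {a..x} g)"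
    by (rule indefinite_integral_continuous_1[OF set_borel_integral_eq_integral(1)[OF g]])
  show "integral {a..x} g = (LINT s:{a..x}|lborel. g s)" if "x \<in> {a..b}" for x
    using that by (intro set_borel_integral_eq_integral(2)[symmetric] set_integrable_subset[OF g]) auto
qed

section \<open>Spatial regularity of weak solutions\<close>

lemma continuous_antiderivative:
  fixes f :: "real \<Rightarrow> real"
  assumes "continuous_on UNIV f"
  obtains F where "\<And>x. (F has_real_derivative f x) (at x)" "F 0 = 0" "continuous_on UNIV F"
proof -
  have "\<exists>F. \<forall>x::real. - \<infinity> < ereal x \<longrightarrow> ereal x < \<infinity> \<longrightarrow> (F has_vector_derivative f x) (at x)"
    by (rule einterval_antiderivative) (use assms in \<open>auto simp: continuous_on_eq_continuous_at\<close>)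
  then obtain F where F: "\<And>x. (F has_real_derivative f x) (at x)"
    by (auto simp: has_real_derivative_iff_has_vector_derivative)
  have F0: "((\<lambda>x. F x - F 0) has_real_derivative f x) (at x)" for x
    by (auto intro!: derivative_eq_intros F)
  then show ?thesis
    using that[of "\<lambda>x. F x - F 0"] DERIV_isCont[OF F0] by (simp add: continuous_at_imp_continuous_on)
qed

lemma kdv_test_C1:
  assumes "kdv_test L b b1 b2 b3"
  shows "C1_Icc 0 L b b1" "C1_Icc 0 L b1 b2" "C1_Icc 0 L b2 b3"
proof -
  have derivative: "(b has_real_derivative b1 x) (at x within A)" "(b1 has_real_derivative b2 x) (at x within A)"
    "(b2 has_real_derivative b3 x) (at x within A)" for x A
    using assms unfolding kdv_test_def by (simp_all add: has_field_derivative_at_within)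
  moreover have "continuous_on {0..L} b3"
    using assms unfolding kdv_test_def by (blast intro: continuous_on_subset)
  ultimately show "C1_Icc 0 L b b1" "C1_Icc 0 L b1 b2" "C1_Icc 0 L b2 b3"
    using DERIV_continuous_on[OF derivative(2)] DERIV_continuous_on[OF derivative(3)]
    by (simp_all add: C1_Icc_def)
qed

lemma kdv_test_with_third_derivative:
  assumes L: "0 < L" and e: "continuous_on {0..L} e"
  obtains b b1 b2 b3 where "kdv_test L b b1 b2 b3" "\<And>x. x \<in> {0..L} \<Longrightarrow> b3 x = e x"
proof -
  define b3 where "b3 = ext_cont e 0 L"
  have b3: "continuous_on UNIV b3"
    unfolding b3_def using e by (intro continuous_on_ext_cont) simp
  obtain B2 where B2: "\<And>x. (B2 has_real_derivative b3 x) (at x)" "B2 0 = 0" "continuous_on UNIV B2"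
    using continuous_antiderivative[OF b3] by blast
  obtain B1 where B1: "\<And>x. (B1 has_real_derivative B2 x) (at x)" "B1 0 = 0" "continuous_on UNIV B1"
    using continuous_antiderivative[OF B2(3)] by blast
  obtain B where B: "\<And>x. (B has_real_derivative B1 x) (at x)" "B 0 = 0"
    using continuous_antiderivative[OF B1(3)] by blast
  define d where "d = - 2 * B L / L\<^sup>2"
  have "kdv_test L (\<lambda>x. B x + d * x\<^sup>2 / 2) (\<lambda>x. B1 x + d * x) (\<lambda>x. B2 x + d) b3"
    using L b3 B(2) B1(2) unfolding kdv_test_def
    by (auto intro!: derivative_eq_intros B B1(1) B2(1) simp: d_def field_simps)
  then show ?thesis
    by (rule that) (simp add: b3_def)
qed

lemma C2_with_kdv_boundary_conditions:
  assumes L: "0 < L" and p: "continuous_on {0..L} p"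
  obtains c U U1 where "C1_Icc 0 L U U1" "C1_Icc 0 L U1 (\<lambda>x. c + p x)" "U 0 = 0" "U L = 0" "U1 L = 0"
proof -
  define P where "P x = integral {0..x} p" for x
  have P: "C1_Icc 0 L P p"
    unfolding P_def[abs_def] by (rule C1_Icc_integral[OF p])
  define PP where "PP x = integral {0..x} P" for x
  have PP: "C1_Icc 0 L PP P"
    unfolding PP_def[abs_def] by (rule C1_Icc_integral[OF C1_Icc_continuous[OF P]])
  define c where "c = 2 * (PP L - P L * L) / L\<^sup>2"
  define U where "U x = c * (x\<^sup>2 / 2 - L * x) + PP x - P L * x" for x
  define U1 where "U1 x = c * (x - L) + P x - P L" for x
  show ?thesis
  proof (rule that)
    show "C1_Icc 0 L U U1"
      unfolding U_def[abs_def] U1_def[abs_def]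
      by (intro C1_IccI) (auto intro!: derivative_eq_intros continuous_intros
          C1_Icc_has_derivative[OF PP] C1_Icc_continuous[OF P])
    show "C1_Icc 0 L U1 (\<lambda>x. c + p x)"
      unfolding U1_def[abs_def]
      by (intro C1_IccI) (auto intro!: derivative_eq_intros continuous_intros C1_Icc_has_derivative[OF P] p)
    show "U 0 = 0" "U L = 0" "U1 L = 0"
      using L by (simp_all add: U_def U1_def c_def PP_def power2_eq_square field_simps)
  qed
qed

lemma L2inner_kdv_test_third_derivative:
  assumes L: "0 \<le> L" and b: "kdv_test L b b1 b2 b3"
    and U: "C1_Icc 0 L U U1" "C1_Icc 0 L U1 U2" "U 0 = 0" "U L = 0" "U1 L = 0"
  shows "L2inner L U b3 = L2inner L U2 b1"
proof -
  have "b1 0 = 0"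
    using b by (simp add: kdv_test_def)
  then show ?thesis
    using L2inner_by_parts[OF L U(1) kdv_test_C1(3)[OF b]] L2inner_by_parts[OF L U(2) kdv_test_C1(2)[OF b]] U(3-5)
    by simp
qed

text \<open>A profile is a weak solution of \<open>D + u' + u''' + q' = 0\<close> with the boundary conditions of the KdV system.\<close>

locale kdv_profile =
  fixes L :: real and D u q :: "real \<Rightarrow> real"
  assumes L_pos: "0 < L" and D_in_L2: "in_L2 L D"
    and u_continuous: "continuous_on {0..L} u" and q_continuous: "continuous_on {0..L} q"
    and u_0: "u 0 = 0" and u_L: "u L = 0"
    and weak: "\<And>b b1 b2 b3. kdv_test L b b1 b2 b3 \<Longrightarrow>
      L2inner L D b = L2inner L u (\<lambda>x. b1 x + b3 x) + L2inner L q b1"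
begin

definition flux :: "real \<Rightarrow> real" where
  "flux x = - (LINT s:{0..x}|lborel. D s) - q x - u x"

lemma continuous_on_flux: "continuous_on {0..L} flux"
  unfolding flux_def[abs_def]
  by (intro continuous_intros continuous_on_LINT_primitive in_L2_integrable D_in_L2 q_continuous u_continuous)

lemma L2inner_D:
  assumes f: "C1_Icc 0 L f f'" and fL: "f L = 0"
  shows "L2inner L D f = L2inner L flux f' + L2inner L q f' + L2inner L u f'"
proof -
  note in_L2 = continuous_on_flux q_continuous u_continuous C1_Icc_continuous_derivative[OF f]
  have "L2inner L D f = L2inner L (\<lambda>x. - (LINT s:{0..x}|lborel. D s)) f'"
    using L2inner_by_parts_primitive[OF _ D_in_L2 f] L2inner_scale_left[of L "-1"] fL L_pos by simp
  also have "\<dots> = L2inner L (\<lambda>x. flux x + q x + u x) f'"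
    by (simp add: flux_def)
  finally show ?thesis
    using in_L2[THEN in_L2_continuous] by (simp add: L2inner_bilinear)
qed

lemma profile_unique:
  assumes U: "C1_Icc 0 L U U1" "C1_Icc 0 L U1 (\<lambda>x. c + flux x)" "U 0 = 0" "U L = 0" "U1 L = 0"
    and x: "x \<in> {0..L}"
  shows "u x = U x"
proof -
  define e where "e = (\<lambda>x. u x - U x)"
  have e: "continuous_on {0..L} e"
    unfolding e_def by (intro continuous_intros u_continuous C1_Icc_continuous[OF U(1)])
  obtain b b1 b2 b3 where b: "kdv_test L b b1 b2 b3" and b3: "\<And>x. x \<in> {0..L} \<Longrightarrow> b3 x = e x"
    using kdv_test_with_third_derivative[OF L_pos e] by blast
  have b0: "b 0 = 0" "b L = 0"
    using b by (auto simp: kdv_test_def)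
  note C1 = kdv_test_C1[OF b] and L = less_imp_le[OF L_pos]
  note in_L2 = in_L2_continuous[OF continuous_on_flux] in_L2_continuous[OF u_continuous]
    in_L2_continuous[OF C1_Icc_continuous[OF U(1)]] in_L2_continuous[OF C1_Icc_continuous_derivative[OF C1(1)]]
    in_L2_continuous[OF C1_Icc_continuous_derivative[OF C1(3)]]
  have "L2inner L u b3 = L2inner L flux b1"
    using weak[OF b] L2inner_D[OF C1(1) b0(2)] in_L2 by (simp add: L2inner_add_right)
  moreover have "L2inner L U b3 = L2inner L flux b1"
    using L2inner_kdv_test_third_derivative[OF L b U] L2inner_const_derivative[OF L C1(1) b0, of c] in_L2
    by (simp add: L2inner_add_left)
  ultimately have "L2inner L e b3 = 0"
    unfolding e_def using in_L2 by (simp add: L2inner_diff_left)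
  moreover have "L2inner L e e = L2inner L e b3"
    by (rule L2inner_cong) (simp add: b3)
  ultimately have "e x = 0"
    using L2inner_self_eq_0_imp_eq_0[OF L_pos e _ x] by simp
  then show ?thesis
    by (simp add: e_def)
qed

lemma profile_regularity:
  obtains u1 u2 where "C1_Icc 0 L u u1" "C1_Icc 0 L u1 u2" "u1 L = 0"
    "\<And>f f'. C1_Icc 0 L f f' \<Longrightarrow> f 0 = 0 \<Longrightarrow> f L = 0 \<Longrightarrow>
       L2inner L D f = L2inner L (\<lambda>x. q x + u x + u2 x) f'"
proof -
  obtain c U U1 where U: "C1_Icc 0 L U U1" "C1_Icc 0 L U1 (\<lambda>x. c + flux x)" "U 0 = 0" "U L = 0" "U1 L = 0"
    using C2_with_kdv_boundary_conditions[OF L_pos continuous_on_flux] by metis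
  show ?thesis
  proof (rule that[of U1 "\<lambda>x. c + flux x"])
    show "C1_Icc 0 L u U1"
      using profile_unique[OF U] by (intro C1_Icc_cong[OF U(1)]) simp
    fix f f' assume f: "C1_Icc 0 L f f'" "f 0 = 0" "f L = 0"
    have in_L2: "in_L2 L flux" "in_L2 L q" "in_L2 L u" "in_L2 L f'"
      by (intro in_L2_continuous continuous_on_flux q_continuous u_continuous
          C1_Icc_continuous_derivative[OF f(1)])+
    show "L2inner L D f = L2inner L (\<lambda>x. q x + u x + (c + flux x)) f'"
      using L2inner_D[OF f(1,3)] L2inner_const_derivative[OF less_imp_le[OF L_pos] f, of c] in_L2
      by (simp add: L2inner_add_left)
  qed (rule U)+
qed

end

section \<open>Wirtinger's inequality\<close>

lemma Riccati_energy_inequality: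
  assumes ab: "a \<le> b" and v: "C1_Icc a b v v'" "v a = 0" "v b = 0"
    and p: "C1_Icc a b p (\<lambda>x. - \<kappa> - (p x)\<^sup>2)"
  shows "\<kappa> * (LINT x:{a..b}|lborel. (v x)\<^sup>2) \<le> (LINT x:{a..b}|lborel. (v' x)\<^sup>2)"
proof -
  note continuous = C1_Icc_continuous[OF v(1)] C1_Icc_continuous_derivative[OF v(1)] C1_Icc_continuous[OF p]
  define g where "g x = (- \<kappa> - (p x)\<^sup>2) * (v x * v x) + p x * (v' x * v x + v x * v' x)" for x
  have pv: "C1_Icc a b (\<lambda>x. p x * (v x * v x)) g"
    unfolding g_def[abs_def] by (intro C1_Icc_mult p v)
  have g: "(LINT x:{a..b}|lborel. g x) = 0"
    using C1_Icc_FTC[OF ab pv] v(2,3) by simp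
  have "0 \<le> (LINT x:{a..b}|lborel. (v' x - p x * v x)\<^sup>2)"
    by (rule set_integral_nonneg) simp
  also have "\<dots> = (LINT x:{a..b}|lborel. (v' x)\<^sup>2 - \<kappa> * (v x)\<^sup>2 - g x)"
    by (rule set_lebesgue_integral_cong) (auto simp: g_def power2_eq_square algebra_simps)
  also have "\<dots> = (LINT x:{a..b}|lborel. (v' x)\<^sup>2) - \<kappa> * (LINT x:{a..b}|lborel. (v x)\<^sup>2) - (LINT x:{a..b}|lborel. g x)"
    by (subst set_integral_diff(2), (intro borel_integrable_atLeastAtMost' continuous_intros continuous
          C1_Icc_continuous_derivative[OF pv])+)+ simp
  finally show ?thesis
    using g by simp
qed

lemma C1_Icc_tan_Riccati:
  assumes k: "0 < k" "k * (b - a) < pi"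
  defines "p \<equiv> \<lambda>x. - k * tan (k * (x - (a + b) / 2))"
  shows "C1_Icc a b p (\<lambda>x. - k\<^sup>2 - (p x)\<^sup>2)"
proof -
  define \<theta> where "\<theta> x = k * (x - (a + b) / 2)" for x
  have cos: "cos (\<theta> x) \<noteq> 0" if "x \<in> {a..b}" for x
  proof -
    have "\<bar>\<theta> x\<bar> \<le> k * ((b - a) / 2)"
      unfolding \<theta>_def abs_mult using k that by (intro mult_mono) (auto simp: abs_le_iff field_simps)
    also have "\<dots> < pi / 2"
      using k by simp
    finally have "0 < cos (\<theta> x)"
      by (intro cos_gt_zero_pi) linarith+
    then show ?thesis
      by simp
  qed
  have p': "(p has_real_derivative - k\<^sup>2 - (p x)\<^sup>2) (at x within {a..b})" if "x \<in> {a..b}" for x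
  proof -
    have "(p has_real_derivative - k * (inverse ((cos (\<theta> x))\<^sup>2) * k)) (at x within {a..b})"
      unfolding p_def \<theta>_def using cos[OF that, unfolded \<theta>_def] by (auto intro!: derivative_eq_intros)
    moreover have "inverse ((cos (\<theta> x))\<^sup>2) = 1 + (tan (\<theta> x))\<^sup>2"
      by (simp only: tan_sec[OF cos[OF that]] power_inverse)
    moreover have "- k * ((1 + (tan (\<theta> x))\<^sup>2) * k) = - k\<^sup>2 - (- k * tan (\<theta> x))\<^sup>2"
      by (simp add: power2_eq_square algebra_simps)
    ultimately show ?thesis
      by (simp only: p_def \<theta>_def)
  qed
  have "continuous_on {a..b} p"
    by (rule DERIV_continuous_on[OF p'])
  then have "continuous_on {a..b} (\<lambda>x. - k\<^sup>2 - (p x)\<^sup>2)"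
    by (intro continuous_intros)
  with p' show ?thesis
    by (rule C1_IccI)
qed

lemma Wirtinger_inequality_Dirichlet:
  assumes ab: "a < b" and v: "C1_Icc a b v v'" "v a = 0" "v b = 0"
  shows "(pi / (b - a))\<^sup>2 * (LINT x:{a..b}|lborel. (v x)\<^sup>2) \<le> (LINT x:{a..b}|lborel. (v' x)\<^sup>2)"
proof (rule field_le_mult_one_interval)
  fix z :: real assume z: "0 < z" "z < 1"
  define k where "k = sqrt z * (pi / (b - a))"
  have "0 < k" "k * (b - a) < pi"
    using z ab by (auto simp: k_def)
  then have "k\<^sup>2 * (LINT x:{a..b}|lborel. (v x)\<^sup>2) \<le> (LINT x:{a..b}|lborel. (v' x)\<^sup>2)"
    using Riccati_energy_inequality[OF less_imp_le[OF ab] v C1_Icc_tan_Riccati] by blast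
  then show "z * ((pi / (b - a))\<^sup>2 * (LINT x:{a..b}|lborel. (v x)\<^sup>2)) \<le> (LINT x:{a..b}|lborel. (v' x)\<^sup>2)"
    using z by (simp add: k_def power_mult_distrib power_divide mult.assoc)
qed

section \<open>Solutions as curves in L2(0,L)\<close>

locale kdv_trajectory = L2_curve L y m
  for L :: real and y :: "real \<Rightarrow> real \<Rightarrow> real" and m :: "real \<Rightarrow> real" +
  assumes L_pos: "0 < L"
    and trajectory_boundary: "AE t in lborel. 0 \<le> t \<longrightarrow> y t 0 = 0 \<and> y t L = 0"
    and trajectory_weak: "\<And>b b1 b2 b3 t. kdv_test L b b1 b2 b3 \<Longrightarrow> 0 \<le> t \<Longrightarrow>
      L2inner L (y t) b - L2inner L (y 0) b =
        (LINT s:{0..t}|lborel. LINT x:{0..L}|lborel. y s x * (b1 x + b3 x) + (y s x)\<^sup>2 / 2 * b1 x)"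
begin

lemma trajectory_weak_increment:
  assumes b: "kdv_test L b b1 b2 b3" and t: "0 \<le> t" and h: "0 \<le> h"
  shows "L2inner L (y (t + h)) b - L2inner L (y t) b =
    (LINT s:{t..t+h}|lborel. L2inner L (y s) (\<lambda>x. b1 x + b3 x))
    + (LINT s:{t..t+h}|lborel. L2inner L (\<lambda>x. (y s x)\<^sup>2 / 2) b1)"
proof -
  define G where "G s = (LINT x:{0..L}|lborel. y s x * (b1 x + b3 x) + (y s x)\<^sup>2 / 2 * b1 x)" for s
  define G1 where "G1 s = L2inner L (y s) (\<lambda>x. b1 x + b3 x)" for s
  define G2 where "G2 s = L2inner L (\<lambda>x. (y s x)\<^sup>2 / 2) b1" for s
  have b_continuous: "continuous_on {0..L} b1" "continuous_on {0..L} b3"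
    using kdv_test_C1[OF b] by (auto intro: C1_Icc_continuous C1_Icc_continuous_derivative)
  have b_in_L2: "in_L2 L b1" "in_L2 L (\<lambda>x. b1 x + b3 x)"
    by (intro in_L2_continuous continuous_intros b_continuous)+
  have G_eq: "G s = G1 s + G2 s" if "0 \<le> s" for s
  proof -
    have "set_integrable lborel {0..L} (\<lambda>x. 1 / 2 * (y s x * (b1 x * y s x)))"
      using set_integrable_mult_L2[OF curve_in_L2[OF that]
          in_L2_mult_continuous[OF curve_in_L2[OF that] b_continuous(1)]]
      by (rule set_integrable_mult_right)
    then have "set_integrable lborel {0..L} (\<lambda>x. (y s x)\<^sup>2 / 2 * b1 x)"
      by (simp add: power2_eq_square mult_ac)
    then show ?thesis
      unfolding G_def G1_def G2_def L2inner_def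
      by (rule set_integral_add(2)[OF set_integrable_mult_L2[OF curve_in_L2[OF that] b_in_L2(2)]])
  qed
  have G12_integrable: "set_integrable lborel {s..t} G1" "set_integrable lborel {s..t} G2" if "0 \<le> s" for s t
    unfolding G1_def G2_def L2inner_def
    by (intro curve.set_integrable_LINT_space energy.set_integrable_LINT_space in_L2_integrable that b_in_L2)+
  have G_integrable: "set_integrable lborel {0..t} G" for t
    using set_integral_add(1)[OF G12_integrable[OF order_refl]]
    by (subst set_integrable_cong[OF refl refl G_eq]) auto
  have "L2inner L (y (t + h)) b - L2inner L (y t) b = (LINT s:{0..t+h}|lborel. G s) - (LINT s:{0..t}|lborel. G s)"
    using trajectory_weak[OF b, of t] trajectory_weak[OF b, of "t + h"] t h unfolding G_def by simp
  also have "\<dots> = (LINT s:{t..t+h}|lborel. G s)"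
    using LINT_Icc_combine[OF t _ G_integrable, of "t + h"] h by simp
  also have "\<dots> = (LINT s:{t..t+h}|lborel. G1 s + G2 s)"
    using t by (intro set_lebesgue_integral_cong) (auto simp: G_eq)
  also have "\<dots> = (LINT s:{t..t+h}|lborel. G1 s) + (LINT s:{t..t+h}|lborel. G2 s)"
    by (intro set_integral_add G12_integrable t)
  finally show ?thesis
    unfolding G1_def G2_def .
qed

lemma steklov_boundary:
  assumes t: "0 \<le> t" and x: "x = 0 \<or> x = L"
  shows "steklov y h t x = 0"
proof -
  have "(LINT s|lborel. indicator {t..t+h} s *\<^sub>R y s x) = 0"
  proof (rule integral_eq_zero_AE)
    show "AE s in lborel. indicator {t..t+h} s *\<^sub>R y s x = 0"
      using trajectory_boundary by eventually_elim (use t x in \<open>auto simp: indicator_def\<close>)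
  qed
  then show ?thesis
    by (simp add: steklov_def set_lebesgue_integral_def)
qed

lemma kdv_profile_steklov:
  assumes t: "0 \<le> t" and h: "0 < h"
  shows "kdv_profile L (\<lambda>x. (y (t + h) x - y t x) / h) (steklov y h t) (steklov (\<lambda>s x. (y s x)\<^sup>2 / 2) h t)"
proof
  show "in_L2 L (\<lambda>x. (y (t + h) x - y t x) / h)"
    using t h by (intro in_L2_divide in_L2_diff curve_in_L2) auto
  show "continuous_on {0..L} (steklov y h t)" "continuous_on {0..L} (steklov (\<lambda>s x. (y s x)\<^sup>2 / 2) h t)"
    by (intro curve.continuous_on_steklov energy.continuous_on_steklov curve_continuous energy_continuous t)+
  fix b b1 b2 b3 assume b: "kdv_test L b b1 b2 b3"
  note C1 = kdv_test_C1[OF b]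
  have in_L2: "in_L2 L b" "in_L2 L b1" "in_L2 L (\<lambda>x. b1 x + b3 x)"
    using C1[THEN C1_Icc_continuous] C1_Icc_continuous_derivative[OF C1(3)]
    by (simp_all add: in_L2_continuous)
  have "L2inner L (\<lambda>x. (y (t + h) x - y t x) / h) b = (L2inner L (y (t + h)) b - L2inner L (y t) b) / h"
    using t h in_L2 by (simp add: L2inner_divide_left L2inner_diff_left curve_in_L2)
  also have "\<dots> = L2inner L (steklov y h t) (\<lambda>x. b1 x + b3 x) + L2inner L (steklov (\<lambda>s x. (y s x)\<^sup>2 / 2) h t) b1"
    using trajectory_weak_increment[OF b t less_imp_le[OF h]]
    by (simp add: curve.L2inner_steklov[OF t in_L2(3)] energy.L2inner_steklov[OF t in_L2(2)] add_divide_distrib)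
  finally show "L2inner L (\<lambda>x. (y (t + h) x - y t x) / h) b
      = L2inner L (steklov y h t) (\<lambda>x. b1 x + b3 x) + L2inner L (steklov (\<lambda>s x. (y s x)\<^sup>2 / 2) h t) b1" .
qed (use L_pos steklov_boundary[OF t] in auto)

end

lemma
  fixes f :: "real \<Rightarrow> real \<Rightarrow> real"
  assumes "\<And>T. 0 \<le> T \<Longrightarrow> set_integrable lborel ({0..T} \<times> {0..L}) (\<lambda>(t, x). f t x)"
  shows AE_set_integrable_slice: "AE t in lborel. 0 \<le> t \<longrightarrow> set_integrable lborel {0..L} (f t)"
    and set_integrable_LINT_slice: "set_integrable lborel {0..T} (\<lambda>t. LINT x:{0..L}|lborel. f t x)"
proof -
  have integrable: "integrable (lborel \<Otimes>\<^sub>M lborel) (\<lambda>(t, x). indicator {0..T} t * (indicator {0..L} x *\<^sub>R f t x))"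
    if "0 \<le> T" for T
  proof -
    have "(\<lambda>(t, x). indicator {0..T} t * (indicator {0..L} x *\<^sub>R f t x))
        = (\<lambda>z. indicator ({0..T} \<times> {0..L}) z *\<^sub>R (case z of (t, x) \<Rightarrow> f t x))"
      by (auto simp: indicator_def)
    then show ?thesis
      using assms[OF that] by (simp add: set_integrable_def lborel_prod)
  qed
  show "set_integrable lborel {0..T} (\<lambda>t. LINT x:{0..L}|lborel. f t x)"
  proof (cases "0 \<le> T")
    case True
    then show ?thesis
      using lborel_pair.integrable_fst[OF integrable[OF True]]
      by (simp add: set_integrable_def set_lebesgue_integral_def)
  qed simp
  have "AE t in lborel. \<forall>n::nat. integrable lborel (\<lambda>x. indicator {0..real n} t * (indicator {0..L} x *\<^sub>R f t x))"
    unfolding AE_all_countable using lborel_pair.AE_integrable_fst[OF integrable] by auto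
  then show "AE t in lborel. 0 \<le> t \<longrightarrow> set_integrable lborel {0..L} (f t)"
  proof eventually_elim
    case (elim t)
    obtain n :: nat where "t \<le> real n"
      using real_arch_simple by blast
    then show ?case
      using elim[rule_format, of n] by (auto simp: set_integrable_def)
  qed
qed

lemma
  fixes f g :: "real \<Rightarrow> real" and L :: real
  assumes L: "0 \<le> L" and g: "set_integrable lborel {0..L} g" "set_integrable lborel {0..L} (\<lambda>x. (g x)\<^sup>2)"
    and f: "\<And>x. x \<in> {0..L} \<Longrightarrow> f x = (LINT s:{0..x}|lborel. g s)"
  shows continuous_on_primitive: "continuous_on {0..L} f"
    and primitive_0: "f 0 = 0"
    and primitive_square_le: "x \<in> {0..L} \<Longrightarrow> (f x)\<^sup>2 \<le> L * (LINT x:{0..L}|lborel. (g x)\<^sup>2)"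
proof -
  show "continuous_on {0..L} f"
    by (rule continuous_on_eq[OF continuous_on_LINT_primitive[OF g(1)]]) (simp add: f)
  show "f 0 = 0"
    using f[of 0] L by (simp only: LINT_Icc_self) simp
  have "in_L2 L g"
    using g by (auto simp: in_L2_def set_integrable_def set_borel_measurable_def)
  then have "\<bar>f x\<bar> \<le> sqrt L * L2norm L g" if "x \<in> {0..L}" for x
    using abs_primitive_le_L2norm[OF L _ that] f[OF that] by simp
  then show "(f x)\<^sup>2 \<le> L * (LINT x:{0..L}|lborel. (g x)\<^sup>2)" if "x \<in> {0..L}"
    using power_mono[of "\<bar>f x\<bar>" "sqrt L * L2norm L g" 2] that L
    by (simp add: power_mult_distrib L2norm_def set_integral_nonneg)
qed

lemma
  assumes "kdv_solution L y0 y"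
  shows kdv_solution_initial_norm: "L2norm L (y 0) = L2norm L y0"
    and kdv_solution_initial_L2inner: "kdv_test L b b1 b2 b3 \<Longrightarrow> L2inner L (y 0) b = L2inner L y0 b"
proof -
  have "\<bar>L2norm L (y 0) - L2norm L y0\<bar> \<le> L2norm L (\<lambda>x. y 0 x - y0 x)"
    using assms unfolding kdv_solution_def by (intro abs_L2norm_diff_le) auto
  then show "L2norm L (y 0) = L2norm L y0"
    using assms by (simp add: kdv_solution_def)
  assume "kdv_test L b b1 b2 b3"
  then have "L2inner L (y 0) b - L2inner L y0 b =
      (LINT s:{0..0}|lborel. LINT x:{0..L}|lborel. y s x * (b1 x + b3 x) + (y s x)\<^sup>2 / 2 * b1 x)"
    using assms unfolding kdv_solution_def L2inner_def by blast
  also have "\<dots> = 0"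
    by (rule LINT_Icc_self)
  finally show "L2inner L (y 0) b = L2inner L y0 b"
    by simp
qed

text \<open>The spatial derivative of a solution enters the argument only through the bound \<open>m t\<close> for the square of
  the supremum of \<open>y t\<close>, which is locally integrable in time.\<close>

lemma kdv_solution_supremum_bound:
  assumes sol: "kdv_solution L y0 y" and L: "0 \<le> L"
  obtains m where "\<And>t. 0 \<le> m t" "\<And>T. set_integrable lborel {0..T} m"
    "AE t in lborel. 0 \<le> t \<longrightarrow> continuous_on {0..L} (y t) \<and> y t 0 = 0 \<and> y t L = 0
      \<and> (\<forall>x\<in>{0..L}. (y t x)\<^sup>2 \<le> m t)"
proof -
  obtain yx where
    yx_square: "\<And>T. 0 \<le> T \<Longrightarrow> set_integrable lborel ({0..T} \<times> {0..L}) (\<lambda>(t, x). (yx t x)\<^sup>2)" and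
    primitive: "AE t in lborel. t \<ge> 0 \<longrightarrow>
      (\<forall>x\<in>{0..L}. set_integrable lborel {0..x} (yx t) \<and> y t x = (LINT s:{0..x}|lborel. yx t s)) \<and> y t L = 0"
    using sol unfolding kdv_solution_def by blast
  define m where "m t = L * (LINT x:{0..L}|lborel. (yx t x)\<^sup>2)" for t
  have yx_slice: "AE t in lborel. 0 \<le> t \<longrightarrow> set_integrable lborel {0..L} (\<lambda>x. (yx t x)\<^sup>2)"
    and m_integrable: "\<And>T. set_integrable lborel {0..T} m"
    using AE_set_integrable_slice[of L "\<lambda>t x. (yx t x)\<^sup>2"] set_integrable_LINT_slice[of L "\<lambda>t x. (yx t x)\<^sup>2"]
      yx_square by (simp_all add: m_def[abs_def])
  have "AE t in lborel. 0 \<le> t \<longrightarrow> continuous_on {0..L} (y t) \<and> y t 0 = 0 \<and> y t L = 0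
      \<and> (\<forall>x\<in>{0..L}. (y t x)\<^sup>2 \<le> m t)"
    using primitive yx_slice
  proof eventually_elim
    case (elim t)
    show ?case
    proof
      assume t: "0 \<le> t"
      have yx: "set_integrable lborel {0..L} (yx t)" "set_integrable lborel {0..L} (\<lambda>x. (yx t x)\<^sup>2)"
        and y: "\<And>x. x \<in> {0..L} \<Longrightarrow> y t x = (LINT s:{0..x}|lborel. yx t s)"
        using elim t L by auto
      show "continuous_on {0..L} (y t) \<and> y t 0 = 0 \<and> y t L = 0 \<and> (\<forall>x\<in>{0..L}. (y t x)\<^sup>2 \<le> m t)"
        using continuous_on_primitive[OF L yx y] primitive_0[OF L yx y] primitive_square_le[OF L yx y] elim t
        by (simp add: m_def)
    qed
  qed
  moreover have "0 \<le> m t" for t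
    using L by (simp add: m_def set_integral_nonneg)
  ultimately show ?thesis
    using m_integrable by (intro that)
qed

lemma kdv_solution_trajectory:
  assumes sol: "kdv_solution L y0 y" and L: "0 < L"
  obtains m where "kdv_trajectory L y m"
proof -
  obtain m where m: "\<And>t. 0 \<le> m t" "\<And>T. set_integrable lborel {0..T} m"
    and slices: "AE t in lborel. 0 \<le> t \<longrightarrow> continuous_on {0..L} (y t) \<and> y t 0 = 0 \<and> y t L = 0
      \<and> (\<forall>x\<in>{0..L}. (y t x)\<^sup>2 \<le> m t)"
    using kdv_solution_supremum_bound[OF sol less_imp_le[OF L]] by blast
  have "kdv_trajectory L y m"
  proof
    show "set_borel_measurable lborel ({0..} \<times> {0..L}) (\<lambda>(t, x). y t x)"
      using sol by (simp add: kdv_solution_def)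
    show "AE t in lborel. 0 \<le> t \<longrightarrow> continuous_on {0..L} (y t)"
      "AE t in lborel. 0 \<le> t \<longrightarrow> (\<forall>x\<in>{0..L}. (y t x)\<^sup>2 \<le> m t)"
      "AE t in lborel. 0 \<le> t \<longrightarrow> y t 0 = 0 \<and> y t L = 0"
      using slices by (eventually_elim, blast)+
    show "L2_tendsto L y (y t) (at t within {0..})" if "0 \<le> t" for t
      using sol that by (auto simp: kdv_solution_def L2_tendsto_def eventually_at_filter)
    show "L2inner L (y t) b - L2inner L (y 0) b =
        (LINT s:{0..t}|lborel. LINT x:{0..L}|lborel. y s x * (b1 x + b3 x) + (y s x)\<^sup>2 / 2 * b1 x)"
      if "kdv_test L b b1 b2 b3" "0 \<le> t" for b b1 b2 b3 t
      unfolding kdv_solution_initial_L2inner[OF sol that(1)]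
      using sol that unfolding kdv_solution_def L2inner_def by blast
  qed (rule L m)+
  then show ?thesis
    by (rule that)
qed

section \<open>The critical length\<close>

abbreviation L2inner_2pi :: "(real \<Rightarrow> real) \<Rightarrow> (real \<Rightarrow> real) \<Rightarrow> real" ("\<langle>_,/ _\<rangle>") where
  "\<langle>f, g\<rangle> \<equiv> L2inner (2 * pi) f g"

abbreviation L2norm_2pi :: "(real \<Rightarrow> real) \<Rightarrow> real" ("\<parallel>_\<parallel>") where
  "\<parallel>f\<parallel> \<equiv> L2norm (2 * pi) f"

lemma sqrt_2pi_le: "sqrt (2 * pi) \<le> 3"
  using pi_approx by (intro real_le_lsqrt) auto

lemma abs_inner_le:
  assumes "in_L2 (2 * pi) f" "continuous_on {0..2 * pi} g"
    and "\<And>x. x \<in> {0..2 * pi} \<Longrightarrow> \<bar>g x\<bar> \<le> B" "0 \<le> B"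
  shows "\<bar>\<langle>f, g\<rangle>\<bar> \<le> 3 * B * \<parallel>f\<parallel>"
proof -
  have "\<bar>\<langle>f, g\<rangle>\<bar> \<le> sqrt (2 * pi) * B * \<parallel>f\<parallel>"
    using assms by (intro abs_L2inner_bounded_le) auto
  also have "\<dots> \<le> 3 * B * \<parallel>f\<parallel>"
    using assms(4) by (intro mult_right_mono sqrt_2pi_le) auto
  finally show ?thesis .
qed

definition phi :: "real \<Rightarrow> real" where
  "phi x = 1 - cos x"

lemma phi_has_derivative: "(phi has_real_derivative sin x) (at x within A)"
  unfolding phi_def[abs_def] by (auto intro!: derivative_eq_intros)

lemma continuous_on_phi [continuous_intros]: "continuous_on A phi"
  unfolding phi_def[abs_def] by (intro continuous_intros)

lemma phi_bounds: "0 \<le> phi x" "\<bar>phi x\<bar> \<le> 2"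
  using cos_le_one[of x] cos_ge_minus_one[of x] by (auto simp: phi_def)

lemma phi_in_L2 [simp]: "in_L2 (2 * pi) phi"
  by (intro in_L2_continuous continuous_intros)

lemma kdv_test_phi: "kdv_test (2 * pi) phi sin cos (\<lambda>x. - sin x)"
  unfolding kdv_test_def using phi_has_derivative[where A = UNIV]
  by (auto intro!: derivative_eq_intros continuous_intros simp: phi_def)

lemma inner_phi_phi: "\<langle>phi, phi\<rangle> = 3 * pi"
proof -
  define F where "F x = 3 * x / 2 - 2 * sin x + sin x * cos x / 2" for x :: real
  have "C1_Icc 0 (2 * pi) F (\<lambda>x. phi x * phi x)"
  proof (rule C1_IccI)
    fix x :: real
    have sin_square: "sin x * sin x = 1 - cos x * cos x"
      using sin_cos_squared_add[of x] by (simp add: power2_eq_square)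
    have "3 / 2 - 2 * cos x + (cos x * cos x - sin x * sin x) / 2 = phi x * phi x"
      unfolding sin_square phi_def by (simp add: field_simps)
    then show "(F has_real_derivative phi x * phi x) (at x within {0..2 * pi})"
      unfolding F_def[abs_def] by (auto intro!: derivative_eq_intros simp: field_simps)
  qed (intro continuous_intros)
  then have "\<langle>phi, phi\<rangle> = F (2 * pi) - F 0"
    unfolding L2inner_def by (intro C1_Icc_FTC) auto
  then show ?thesis
    by (simp add: F_def)
qed

lemma inner_phi_phi_sin: "\<langle>\<lambda>x. phi x * phi x, sin\<rangle> = 0"
proof -
  have "C1_Icc 0 (2 * pi) (\<lambda>x. phi x ^ 3 / 3) (\<lambda>x. phi x * phi x * sin x)"
    by (intro C1_IccI)
      (auto intro!: derivative_eq_intros phi_has_derivative continuous_intros simp: power2_eq_square)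
  from C1_Icc_FTC[OF _ this] show ?thesis
    by (simp add: L2inner_def phi_def)
qed

subsection \<open>A Poincare inequality on the orthogonal complement of phi\<close>

text \<open>\<open>hump\<close> solves \<open>h + h'' = phi / 2\<close>, \<open>h 0 = h (2\<pi>) = 0\<close> and \<open>h \<pi> = 1\<close>. Subtracting \<open>w \<pi> * hump\<close> from \<open>w\<close>
  produces a function vanishing at \<open>0\<close>, \<open>\<pi>\<close> and \<open>2\<pi>\<close>, to which Wirtinger's inequality applies on both halves; the
  cross terms disappear because \<open>w\<close> is orthogonal to \<open>phi\<close>.\<close>

definition hump :: "real \<Rightarrow> real" where
  "hump x = (1 - cos x - (x - pi) * sin x / 2) / 2"

definition hump1 :: "real \<Rightarrow> real" where
  "hump1 x = (sin x - (x - pi) * cos x) / 4"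

lemma hump_C1: "C1_Icc a b hump hump1" "C1_Icc a b hump1 (\<lambda>x. phi x / 2 - hump x)"
  unfolding C1_Icc_def hump_def[abs_def] hump1_def[abs_def] phi_def[abs_def]
  by (auto intro!: derivative_eq_intros continuous_intros simp: field_simps)

lemma hump_values: "hump 0 = 0" "hump pi = 1" "hump (2 * pi) = 0"
  by (simp_all add: hump_def)

lemma hump_nonneg:
  assumes "x \<in> {0..2 * pi}"
  shows "0 \<le> hump x"
proof -
  have "(x - pi) * sin x \<le> 0"
  proof (cases "x \<le> pi")
    case True
    then show ?thesis
      using assms by (intro mult_nonpos_nonneg sin_ge_zero) auto
  next
    case False
    then show ?thesis
      using assms sin_le_zero[of x] by (cases "x = 2 * pi") (auto intro!: mult_nonneg_nonpos)
  qed
  then have "0 \<le> 1 - cos x - (x - pi) * sin x / 2"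
    using cos_le_one[of x] by linarith
  then show ?thesis
    by (simp add: hump_def)
qed

lemma inner_derivative_hump1:
  assumes "C1_Icc 0 (2 * pi) w w1" "w 0 = 0" "w (2 * pi) = 0"
  shows "\<langle>w1, hump1\<rangle> = \<langle>w, hump\<rangle> - \<langle>w, phi\<rangle> / 2"
proof -
  have w: "in_L2 (2 * pi) w" and hump: "in_L2 (2 * pi) hump"
    by (intro in_L2_continuous C1_Icc_continuous[OF assms(1)] C1_Icc_continuous[OF hump_C1(1)])+
  have "\<langle>w, \<lambda>x. phi x / 2 - hump x\<rangle> = - \<langle>w1, hump1\<rangle>"
    using L2inner_by_parts[OF _ assms(1) hump_C1(2)] assms(2,3) by simp
  then show ?thesis
    using w hump by (simp add: L2inner_bilinear L2inner_commute[of _ w "\<lambda>x. phi x / 2"] L2inner_commute[of _ phi])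
qed

lemma L2inner_2pi_split:
  assumes "continuous_on {0..2 * pi} f"
  shows "\<langle>f, f\<rangle> = (LINT x:{0..pi}|lborel. (f x)\<^sup>2) + (LINT x:{pi..2 * pi}|lborel. (f x)\<^sup>2)"
  using LINT_Icc_combine[of 0 pi "2 * pi" "\<lambda>x. (f x)\<^sup>2"] assms
  by (simp add: L2inner_def power2_eq_square borel_integrable_atLeastAtMost' continuous_intros)

lemma Poincare_orthogonal_phi:
  assumes w: "C1_Icc 0 (2 * pi) w w1" "w 0 = 0" "w (2 * pi) = 0" and orthogonal: "\<langle>w, phi\<rangle> = 0"
  shows "\<langle>w, w\<rangle> \<le> \<langle>w1, w1\<rangle>"
proof -
  define k where "k = w pi"
  define v where "v = (\<lambda>x. w x - k * hump x)"
  define v1 where "v1 = (\<lambda>x. w1 x - k * hump1 x)"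
  have v: "C1_Icc 0 (2 * pi) v v1"
    unfolding v_def v1_def by (intro C1_Icc_diff C1_Icc_cmult w hump_C1)
  have in_L2: "in_L2 (2 * pi) w" "in_L2 (2 * pi) w1" "in_L2 (2 * pi) hump" "in_L2 (2 * pi) hump1"
    using w(1) hump_C1 by (auto intro!: in_L2_continuous intro: C1_Icc_continuous C1_Icc_continuous_derivative)
  have "(LINT x:{a..a + pi}|lborel. (v x)\<^sup>2) \<le> (LINT x:{a..a + pi}|lborel. (v1 x)\<^sup>2)" if "a = 0 \<or> a = pi" for a
    using Wirtinger_inequality_Dirichlet[of a "a + pi" v v1] C1_Icc_subset[OF v, of a "a + pi"] that
    by (auto simp: v_def hump_values w(2,3) k_def)
  from this[of 0] this[of pi] have "\<langle>v, v\<rangle> \<le> \<langle>v1, v1\<rangle>"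
    using L2inner_2pi_split[OF C1_Icc_continuous[OF v]] L2inner_2pi_split[OF C1_Icc_continuous_derivative[OF v]]
    by simp
  moreover have "\<langle>v, v\<rangle> = \<langle>w, w\<rangle> - 2 * k * \<langle>w, hump\<rangle> + k\<^sup>2 * \<langle>hump, hump\<rangle>"
    "\<langle>v1, v1\<rangle> = \<langle>w1, w1\<rangle> - 2 * k * \<langle>w1, hump1\<rangle> + k\<^sup>2 * \<langle>hump1, hump1\<rangle>"
    unfolding v_def v1_def using in_L2 by (simp_all add: L2norm_diff_scale_power2 flip: L2norm_power2)
  moreover have "\<langle>w1, hump1\<rangle> = \<langle>w, hump\<rangle>"
    using inner_derivative_hump1[OF w] orthogonal by simp
  moreover have "k\<^sup>2 * \<langle>hump1, hump1\<rangle> \<le> k\<^sup>2 * \<langle>hump, hump\<rangle>"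
  proof (rule mult_left_mono)
    have "0 \<le> \<langle>hump, phi\<rangle>"
      unfolding L2inner_def by (intro set_integral_nonneg mult_nonneg_nonneg hump_nonneg phi_bounds)
    then show "\<langle>hump1, hump1\<rangle> \<le> \<langle>hump, hump\<rangle>"
      using inner_derivative_hump1[OF hump_C1(1)] by (simp add: hump_values)
  qed simp
  ultimately show ?thesis
    by simp
qed

subsection \<open>The corrector\<close>

text \<open>The corrector solves the adjoint problem \<open>b' + b''' = phi * sin\<close>, \<open>b 0 = b (2\<pi>) = b' 0 = 0\<close>; it cancels the
  quadratic coupling of the critical mode, and \<open>\<integral> phi\<^sup>2 b' = b' (2\<pi>)\<^sup>2 = \<pi>\<^sup>2\<close> is the rate of its cubic damping.\<close>

definition corrector :: "real \<Rightarrow> real" where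
  "corrector x = - (x * sin x) / 2 + (cos x - cos (2 * x)) / 12"

definition corrector1 :: "real \<Rightarrow> real" where
  "corrector1 x = - sin x / 2 - x * cos x / 2 + (2 * sin (2 * x) - sin x) / 12"

definition corrector2 :: "real \<Rightarrow> real" where
  "corrector2 x = - cos x + x * sin x / 2 + (4 * cos (2 * x) - cos x) / 12"

definition corrector3 :: "real \<Rightarrow> real" where
  "corrector3 x = 3 / 2 * sin x + x * cos x / 2 + (sin x - 8 * sin (2 * x)) / 12"

lemma corrector_has_derivative:
  "(corrector has_real_derivative corrector1 x) (at x within A)"
  "(corrector1 has_real_derivative corrector2 x) (at x within A)"
  "(corrector2 has_real_derivative corrector3 x) (at x within A)"
  unfolding corrector_def[abs_def] corrector1_def[abs_def] corrector2_def[abs_def] corrector3_def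
  by (auto intro!: derivative_eq_intros simp: field_simps)

lemma continuous_on_corrector [continuous_intros]:
  "continuous_on A corrector" "continuous_on A corrector1" "continuous_on A corrector3"
  unfolding corrector_def[abs_def] corrector1_def[abs_def] corrector3_def[abs_def]
  by (intro continuous_intros; simp)+

lemma corrector_adjoint_equation: "corrector1 x + corrector3 x = phi x * sin x"
  by (simp only: corrector1_def corrector3_def phi_def sin_double) (simp add: field_simps)

lemma kdv_test_corrector: "kdv_test (2 * pi) corrector corrector1 corrector2 corrector3"
  unfolding kdv_test_def using corrector_has_derivative[where A = UNIV]
  by (auto intro!: continuous_intros simp: corrector_def corrector1_def)

lemma corrector_bounds:
  assumes "x \<in> {0..2 * pi}"
  shows "\<bar>corrector x\<bar> \<le> 4" "\<bar>corrector1 x\<bar> \<le> 4"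
proof -
  have x: "0 \<le> x" "x \<le> 6.3"
    using assms pi_approx by auto
  have "\<bar>x * sin x\<bar> \<le> 6.3 * 1" "\<bar>x * cos x\<bar> \<le> 6.3 * 1"
    unfolding abs_mult using x by (intro mult_mono; auto)+
  moreover have "\<bar>sin x\<bar> \<le> 1" "\<bar>cos x\<bar> \<le> 1" "\<bar>sin (2 * x)\<bar> \<le> 1" "\<bar>cos (2 * x)\<bar> \<le> 1"
    by auto
  ultimately show "\<bar>corrector x\<bar> \<le> 4" "\<bar>corrector1 x\<bar> \<le> 4"
    unfolding corrector_def corrector1_def diff_divide_distrib minus_divide_left[symmetric] by linarith+
qed

lemma inner_phi_phi_corrector1: "\<langle>\<lambda>x. phi x * phi x, corrector1\<rangle> = pi\<^sup>2"
proof -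
  define F where
    "F x = phi x * phi x * corrector x - corrector x * corrector x - 2 * (corrector x * corrector2 x)
      + corrector1 x * corrector1 x" for x
  have "C1_Icc 0 (2 * pi) F (\<lambda>x. phi x * phi x * corrector1 x)"
  proof (rule C1_IccI)
    fix x :: real
    have third: "corrector3 x = phi x * sin x - corrector1 x"
      using corrector_adjoint_equation[of x] by simp
    show "(F has_real_derivative phi x * phi x * corrector1 x) (at x within {0..2 * pi})"
      unfolding F_def[abs_def]
      by (rule derivative_eq_intros phi_has_derivative corrector_has_derivative refl)+
        (simp add: third algebra_simps)
  qed (intro continuous_intros)
  then have "\<langle>\<lambda>x. phi x * phi x, corrector1\<rangle> = F (2 * pi) - F 0"
    unfolding L2inner_def by (intro C1_Icc_FTC) auto
  moreover have "cos (4 * pi) = 1" "sin (4 * pi) = 0"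
    using cos_npi[of 4] sin_npi[of 4] by simp_all
  ultimately show ?thesis
    by (simp add: F_def phi_def corrector_def corrector1_def corrector2_def power2_eq_square)
qed

section \<open>The Lyapunov functional\<close>

definition mode :: "(real \<Rightarrow> real) \<Rightarrow> real" where
  "mode u = \<langle>u, phi\<rangle> / (3 * pi)"

definition perp :: "(real \<Rightarrow> real) \<Rightarrow> real \<Rightarrow> real" where
  "perp u x = u x - mode u * phi x"

definition weight :: "real \<Rightarrow> real" where
  "weight x = 1 + x"

text \<open>\<open>48\<^sup>2 = 2304\<close> comes from Young's inequality for the coupling \<open>48 a\<^sup>2 \<parallel>w\<parallel>\<close> in the weighted energy balance.\<close>

definition energy_weight :: real where
  "energy_weight = 1 / 2304"

definition lyap :: "(real \<Rightarrow> real) \<Rightarrow> real" where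
  "lyap u = (3 * pi / 2 - \<langle>u, corrector\<rangle>) * (mode u)\<^sup>2
     + energy_weight / 2 * \<langle>perp u, \<lambda>x. weight x * perp u x\<rangle>"

definition dlyap :: "(real \<Rightarrow> real) \<Rightarrow> (real \<Rightarrow> real) \<Rightarrow> real" where
  "dlyap u D = (3 * pi - 2 * \<langle>u, corrector\<rangle>) * mode u * mode D - \<langle>D, corrector\<rangle> * (mode u)\<^sup>2
     + energy_weight * \<langle>perp D, \<lambda>x. weight x * perp u x\<rangle>"

lemma weight_bounds: "x \<in> {0..2 * pi} \<Longrightarrow> 1 \<le> weight x" "x \<in> {0..2 * pi} \<Longrightarrow> \<bar>weight x\<bar> \<le> 8"
  using pi_approx by (auto simp: weight_def)

lemma continuous_on_weight [continuous_intros]: "continuous_on A weight"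
  unfolding weight_def[abs_def] by (intro continuous_intros)

lemma corrector_in_L2 [simp]: "in_L2 (2 * pi) corrector"
  by (intro in_L2_continuous continuous_intros)

lemma in_L2_perp [simp]: "in_L2 (2 * pi) u \<Longrightarrow> in_L2 (2 * pi) (perp u)"
  by (simp add: perp_def[abs_def])

lemma inner_perp_phi: "in_L2 (2 * pi) u \<Longrightarrow> \<langle>perp u, phi\<rangle> = 0"
  by (simp add: perp_def[abs_def] mode_def L2inner_bilinear inner_phi_phi)

lemma norm_mode_perp:
  assumes "in_L2 (2 * pi) u"
  shows "\<parallel>u\<parallel>\<^sup>2 = 3 * pi * (mode u)\<^sup>2 + \<parallel>perp u\<parallel>\<^sup>2"
proof -
  have "\<langle>u, phi\<rangle> = 3 * pi * mode u" "\<parallel>phi\<parallel>\<^sup>2 = 3 * pi"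
    by (simp_all add: mode_def L2norm_power2 inner_phi_phi)
  then show ?thesis
    unfolding perp_def[abs_def] L2norm_diff_scale_power2[OF assms phi_in_L2]
    by (simp add: power2_eq_square[of "mode u"])
qed

lemma mode_le_norm:
  assumes "in_L2 (2 * pi) u"
  shows "\<bar>mode u\<bar> \<le> \<parallel>u\<parallel>"
proof (rule power2_le_imp_le)
  have "1 * (mode u)\<^sup>2 \<le> 3 * pi * (mode u)\<^sup>2"
    using pi_approx by (intro mult_right_mono) auto
  then show "\<bar>mode u\<bar>\<^sup>2 \<le> \<parallel>u\<parallel>\<^sup>2"
    unfolding power2_abs using norm_mode_perp[OF assms] zero_le_power2[of "\<parallel>perp u\<parallel>"] by linarith
qed simp

lemma norm_perp_le: "in_L2 (2 * pi) u \<Longrightarrow> \<parallel>perp u\<parallel> \<le> \<parallel>u\<parallel>"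
  by (rule power2_le_imp_le) (simp_all add: norm_mode_perp)

lemma inner_weight_perp_bounds:
  assumes u: "in_L2 (2 * pi) u"
  shows "\<parallel>perp u\<parallel>\<^sup>2 \<le> \<langle>perp u, \<lambda>x. weight x * perp u x\<rangle>"
    and "\<langle>perp u, \<lambda>x. weight x * perp u x\<rangle> \<le> 8 * \<parallel>perp u\<parallel>\<^sup>2"
proof -
  have weighted: "in_L2 (2 * pi) (\<lambda>x. weight x * perp u x)"
    using u by (intro in_L2_mult_continuous in_L2_perp continuous_intros)
  show "\<parallel>perp u\<parallel>\<^sup>2 \<le> \<langle>perp u, \<lambda>x. weight x * perp u x\<rangle>"
    unfolding L2norm_power2 L2inner_def
  proof (rule set_integral_mono)
    show "perp u x * perp u x \<le> perp u x * (weight x * perp u x)" if "x \<in> {0..2 * pi}" for x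
      using mult_right_mono[OF weight_bounds(1)[OF that], of "perp u x * perp u x"] by (simp add: mult_ac)
  qed (intro set_integrable_mult_L2 in_L2_perp u weighted)+
  show "\<langle>perp u, \<lambda>x. weight x * perp u x\<rangle> \<le> 8 * \<parallel>perp u\<parallel>\<^sup>2"
    using abs_L2inner_mult_le[OF in_L2_perp[OF u] in_L2_perp[OF u] continuous_on_weight weight_bounds(2)]
    by (simp add: power2_eq_square)
qed

lemma inner_corrector_le: "in_L2 (2 * pi) u \<Longrightarrow> \<bar>\<langle>u, corrector\<rangle>\<bar> \<le> 12 * \<parallel>u\<parallel>"
  using abs_inner_le[of u corrector 4] corrector_bounds by (simp add: continuous_intros)

lemma lyap_bounds:
  assumes u: "in_L2 (2 * pi) u" and small: "\<parallel>u\<parallel> \<le> 1 / 12"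
  shows "energy_weight / 2 * \<parallel>u\<parallel>\<^sup>2 \<le> lyap u" "lyap u \<le> 8 * \<parallel>u\<parallel>\<^sup>2"
proof -
  define a2 where "a2 = (mode u)\<^sup>2"
  define W where "W = \<langle>perp u, \<lambda>x. weight x * perp u x\<rangle>"
  have "\<bar>\<langle>u, corrector\<rangle>\<bar> \<le> 1"
    using inner_corrector_le[OF u] small by simp
  then have "3 * a2 \<le> (3 * pi / 2 - \<langle>u, corrector\<rangle>) * a2" "(3 * pi / 2 - \<langle>u, corrector\<rangle>) * a2 \<le> 6 * a2"
    unfolding a2_def using pi_approx by (intro mult_right_mono; auto)+
  moreover have "9 * a2 \<le> 3 * pi * a2" "3 * pi * a2 \<le> 10 * a2"
    unfolding a2_def using pi_approx by (intro mult_right_mono; auto)+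
  moreover have "\<parallel>perp u\<parallel>\<^sup>2 \<le> W" "W \<le> 8 * \<parallel>perp u\<parallel>\<^sup>2"
    unfolding W_def by (rule inner_weight_perp_bounds[OF u])+
  moreover have "0 \<le> a2" "0 \<le> \<parallel>perp u\<parallel>\<^sup>2"
    by (auto simp: a2_def)
  ultimately show "energy_weight / 2 * \<parallel>u\<parallel>\<^sup>2 \<le> lyap u" "lyap u \<le> 8 * \<parallel>u\<parallel>\<^sup>2"
    unfolding lyap_def norm_mode_perp[OF u] energy_weight_def a2_def[symmetric] W_def[symmetric]
    by (simp_all add: field_simps)
qed

lemma lyap_tendsto:
  assumes U: "L2_tendsto (2 * pi) U u F"
  shows "((\<lambda>n. lyap (U n)) \<longlongrightarrow> lyap u) F"
proof -
  have inner: "((\<lambda>n. \<langle>U n, f\<rangle>) \<longlongrightarrow> \<langle>u, f\<rangle>) F" if "in_L2 (2 * pi) f" for f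
    by (intro L2_tendsto_L2inner U L2_tendsto_const that)
  have mode: "((\<lambda>n. mode (U n)) \<longlongrightarrow> mode u) F"
    unfolding mode_def by (intro tendsto_intros inner) auto
  have perp: "L2_tendsto (2 * pi) (\<lambda>n. perp (U n)) (perp u) F"
    unfolding perp_def[abs_def] by (intro L2_tendsto_diff U L2_tendsto_scale_fixed mode phi_in_L2)
  show ?thesis
    unfolding lyap_def
    by (intro tendsto_intros inner mode corrector_in_L2 L2_tendsto_L2inner L2_tendsto_mult_continuous perp
        continuous_on_weight)
qed

lemma lyap_has_derivative:
  assumes U: "has_L2_derivative (2 * pi) U D t"
  shows "((\<lambda>s. lyap (U s)) has_real_derivative dlyap (U t) D) (at t)"
proof -
  have inner: "((\<lambda>s. \<langle>U s, f\<rangle>) has_real_derivative \<langle>D, f\<rangle>) (at t)" if "in_L2 (2 * pi) f" for f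
    using has_L2_derivative_L2inner[OF U has_L2_derivative_scale_fixed[OF DERIV_const that, of 1]]
    by (simp add: L2inner_def)
  have mode: "((\<lambda>s. mode (U s)) has_real_derivative mode D) (at t)"
    unfolding mode_def by (intro DERIV_cdivide inner phi_in_L2)
  have perp: "has_L2_derivative (2 * pi) (\<lambda>s. perp (U s)) (perp D) t"
    unfolding perp_def[abs_def] by (intro has_L2_derivative_diff U has_L2_derivative_scale_fixed mode phi_in_L2)
  have "((\<lambda>s. \<langle>perp (U s), \<lambda>x. weight x * perp (U s) x\<rangle>) has_real_derivative
      \<langle>perp D, \<lambda>x. weight x * perp (U t) x\<rangle> + \<langle>perp (U t), \<lambda>x. weight x * perp D x\<rangle>) (at t)"
    by (intro has_L2_derivative_L2inner has_L2_derivative_mult_continuous perp continuous_intros)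
  also have "\<langle>perp (U t), \<lambda>x. weight x * perp D x\<rangle> = \<langle>perp D, \<lambda>x. weight x * perp (U t) x\<rangle>"
    by (simp add: L2inner_def mult_ac)
  finally have weighted: "((\<lambda>s. \<langle>perp (U s), \<lambda>x. weight x * perp (U s) x\<rangle>) has_real_derivative
      \<langle>perp D, \<lambda>x. weight x * perp (U t) x\<rangle> + \<langle>perp D, \<lambda>x. weight x * perp (U t) x\<rangle>) (at t)" .
  show ?thesis
    unfolding lyap_def dlyap_def
    by (rule derivative_eq_intros weighted inner[OF corrector_in_L2] mode refl)+
      (simp add: algebra_simps power2_eq_square)
qed

section \<open>Dissipation of the Lyapunov functional\<close>

lemma kdv_multiplier_identity:
  assumes L: "0 \<le> L" and w: "C1_Icc 0 L w w1" "C1_Icc 0 L w1 w2" "w 0 = 0" "w L = 0" "w1 L = 0"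
  shows "L2inner L (\<lambda>x. w x + w2 x) (\<lambda>x. w x + (1 + x) * w1 x)
    = (L2norm L w)\<^sup>2 / 2 - 3 / 2 * (L2norm L w1)\<^sup>2 - (w1 0)\<^sup>2 / 2"
proof -
  define F where "F x = (1 + x) * w x * w x / 2 + w x * w1 x + (1 + x) * w1 x * w1 x / 2" for x
  define p where "p x = (w x + w2 x) * (w x + (1 + x) * w1 x)" for x
  note continuous = C1_Icc_continuous[OF w(1)] C1_Icc_continuous[OF w(2)] C1_Icc_continuous_derivative[OF w(2)]
  have p: "continuous_on {0..L} p"
    unfolding p_def[abs_def] by (intro continuous_intros continuous)
  have "C1_Icc 0 L F (\<lambda>x. p x - 1 / 2 * (w x * w x) + 3 / 2 * (w1 x * w1 x))"
  proof (rule C1_IccI)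
    fix x assume x: "x \<in> {0..L}"
    show "(F has_real_derivative p x - 1 / 2 * (w x * w x) + 3 / 2 * (w1 x * w1 x)) (at x within {0..L})"
      unfolding F_def[abs_def]
      by (rule derivative_eq_intros C1_Icc_has_derivative[OF w(1) x] C1_Icc_has_derivative[OF w(2) x] refl | simp)+
        (simp add: p_def field_simps)
  qed (intro continuous_intros continuous p)
  then have "(LINT x:{0..L}|lborel. p x - 1 / 2 * (w x * w x) + 3 / 2 * (w1 x * w1 x)) = F L - F 0"
    by (rule C1_Icc_FTC[OF L])
  also have "F L - F 0 = - (w1 0)\<^sup>2 / 2"
    by (simp add: F_def w(3-5) power2_eq_square)
  also have "(LINT x:{0..L}|lborel. p x - 1 / 2 * (w x * w x) + 3 / 2 * (w1 x * w1 x))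
      = (LINT x:{0..L}|lborel. p x - 1 / 2 * (w x * w x)) + (LINT x:{0..L}|lborel. 3 / 2 * (w1 x * w1 x))"
    by (intro set_integral_add borel_integrable_atLeastAtMost' continuous_intros continuous p)
  also have "(LINT x:{0..L}|lborel. p x - 1 / 2 * (w x * w x))
      = (LINT x:{0..L}|lborel. p x) - (LINT x:{0..L}|lborel. 1 / 2 * (w x * w x))"
    by (intro set_integral_diff borel_integrable_atLeastAtMost' continuous_intros continuous p)
  finally show ?thesis
    unfolding L2norm_power2 L2inner_def p_def by (simp only: set_integral_mult_right)
qed

lemma abs_mult_le_mult:
  fixes x y :: real
  assumes "\<bar>x\<bar> \<le> c" "\<bar>y\<bar> \<le> d"
  shows "\<bar>x * y\<bar> \<le> c * d"
  unfolding abs_mult using assms by (intro mult_mono) auto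

text \<open>In the ball of this radius the errors of total size \<open>51 * radius * (a ^ 4 + \<parallel>w\<parallel>\<^sup>2)\<close> stay below
  \<open>energy_weight / 8 * (a ^ 4 + \<parallel>w\<parallel>\<^sup>2)\<close>.\<close>

definition radius :: real where
  "radius = 1 / 1000000"

definition decay_rate :: real where
  "decay_rate = 1 / 4000000"

locale kdv_profile_2pi = kdv_profile "2 * pi" D u q for D u q +
  fixes u1 u2 :: "real \<Rightarrow> real"
  assumes u_C1: "C1_Icc 0 (2 * pi) u u1" and u1_C1: "C1_Icc 0 (2 * pi) u1 u2" and u1_2pi: "u1 (2 * pi) = 0"
    and inner_D: "\<And>f f'. C1_Icc 0 (2 * pi) f f' \<Longrightarrow> f 0 = 0 \<Longrightarrow> f (2 * pi) = 0 \<Longrightarrow>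
      \<langle>D, f\<rangle> = \<langle>\<lambda>x. q x + u x + u2 x, f'\<rangle>"
    and q_ge: "\<And>x. x \<in> {0..2 * pi} \<Longrightarrow> (u x)\<^sup>2 / 2 \<le> q x"
    and small: "\<parallel>u\<parallel> \<le> radius"
begin

definition perp1 :: "real \<Rightarrow> real" where
  "perp1 x = u1 x - mode u * sin x"

definition perp2 :: "real \<Rightarrow> real" where
  "perp2 x = u2 x - mode u * cos x"

definition weighted_perp1 :: "real \<Rightarrow> real" where
  "weighted_perp1 x = perp u x + weight x * perp1 x"

definition excess :: "real \<Rightarrow> real" where
  "excess x = q x - (u x)\<^sup>2 / 2"

lemma perp_C1: "C1_Icc 0 (2 * pi) (perp u) perp1"
  unfolding perp_def[abs_def] perp1_def[abs_def]
  by (intro C1_Icc_diff u_C1 C1_Icc_cmult C1_IccI phi_has_derivative continuous_intros)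

lemma perp1_C1: "C1_Icc 0 (2 * pi) perp1 perp2"
  unfolding perp1_def[abs_def] perp2_def[abs_def]
  by (intro C1_Icc_diff u1_C1 C1_Icc_cmult C1_IccI continuous_intros) (auto intro!: derivative_eq_intros)

lemma weighted_perp_C1: "C1_Icc 0 (2 * pi) (\<lambda>x. weight x * perp u x) weighted_perp1"
proof -
  have "C1_Icc 0 (2 * pi) weight (\<lambda>_. 1)"
    unfolding weight_def[abs_def] by (intro C1_IccI) (auto intro!: derivative_eq_intros)
  then show ?thesis
    using C1_Icc_mult[OF _ perp_C1, of weight "\<lambda>_. 1"] by (simp add: weighted_perp1_def[abs_def])
qed

lemma perp_boundary: "perp u 0 = 0" "perp u (2 * pi) = 0" "perp1 (2 * pi) = 0"
  by (simp_all add: perp_def perp1_def phi_def u_0 u_L u1_2pi)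

lemma excess_continuous: "continuous_on {0..2 * pi} excess"
  unfolding excess_def[abs_def] by (intro continuous_intros q_continuous u_continuous) simp

lemmas weighted_perp1_continuous = C1_Icc_continuous_derivative[OF weighted_perp_C1]

lemmas profile_continuous [continuous_intros] = u_continuous q_continuous
  C1_Icc_continuous[OF perp_C1] C1_Icc_continuous[OF perp1_C1] C1_Icc_continuous_derivative[OF perp1_C1]
  weighted_perp1_continuous excess_continuous

lemmas u_in_L2 = in_L2_continuous[OF u_continuous]
  and perp_in_L2 = in_L2_continuous[OF C1_Icc_continuous[OF perp_C1]]
  and excess_in_L2 = in_L2_continuous[OF excess_continuous]

lemmas profile_in_L2 = D_in_L2 profile_continuous[THEN in_L2_continuous]

lemma norm_perp_le_norm_perp1: "\<parallel>perp u\<parallel> \<le> \<parallel>perp1\<parallel>"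
proof (rule power2_le_imp_le)
  show "\<parallel>perp u\<parallel>\<^sup>2 \<le> \<parallel>perp1\<parallel>\<^sup>2"
    unfolding L2norm_power2
    by (rule Poincare_orthogonal_phi[OF perp_C1 perp_boundary(1,2) inner_perp_phi[OF u_in_L2]])
qed simp

lemma abs_perp_le: "x \<in> {0..2 * pi} \<Longrightarrow> \<bar>perp u x\<bar> \<le> 3 * \<parallel>perp1\<parallel>"
proof -
  assume x: "x \<in> {0..2 * pi}"
  then have "perp u x = (LINT s:{0..x}|lborel. perp1 s)"
    using C1_Icc_FTC[OF _ C1_Icc_subset[OF perp_C1], of 0 x] perp_boundary(1) by auto
  also have "\<bar>\<dots>\<bar> \<le> sqrt (2 * pi) * \<parallel>perp1\<parallel>"
    using x profile_in_L2 by (intro abs_primitive_le_L2norm) auto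
  also have "\<dots> \<le> 3 * \<parallel>perp1\<parallel>"
    by (intro mult_right_mono sqrt_2pi_le L2norm_nonneg)
  finally show ?thesis .
qed

lemma norm_weighted_perp1_le: "\<parallel>weighted_perp1\<parallel> \<le> 9 * \<parallel>perp1\<parallel>"
proof -
  have "\<parallel>weighted_perp1\<parallel> \<le> \<parallel>perp u\<parallel> + \<parallel>\<lambda>x. weight x * perp1 x\<parallel>"
    unfolding weighted_perp1_def[abs_def]
    by (intro L2norm_add_le in_L2_mult_continuous profile_in_L2 continuous_on_weight)
  also have "\<parallel>\<lambda>x. weight x * perp1 x\<parallel> \<le> 8 * \<parallel>perp1\<parallel>"
    by (intro L2norm_mult_le profile_in_L2 continuous_on_weight weight_bounds(2)) auto
  finally show ?thesis
    using norm_perp_le_norm_perp1 by simp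
qed

lemma excess_nonneg: "x \<in> {0..2 * pi} \<Longrightarrow> 0 \<le> excess x"
  using q_ge[of x] by (simp add: excess_def)

lemma inner_excess_nonneg: "0 \<le> \<langle>excess, \<lambda>_. 1\<rangle>"
  unfolding L2inner_def by (intro set_integral_nonneg) (simp add: excess_nonneg)

lemma abs_inner_excess_le:
  assumes g: "continuous_on {0..2 * pi} g" and B: "\<And>x. x \<in> {0..2 * pi} \<Longrightarrow> \<bar>g x\<bar> \<le> B"
  shows "\<bar>\<langle>excess, g\<rangle>\<bar> \<le> B * \<langle>excess, \<lambda>_. 1\<rangle>"
proof -
  have "\<bar>\<langle>excess, g\<rangle>\<bar> \<le> (LINT x:{0..2 * pi}|lborel. \<bar>excess x * g x\<bar>)"
    unfolding L2inner_def
    using set_integral_norm_bound[OF set_integrable_mult_L2[OF excess_in_L2 in_L2_continuous[OF g]]] by simp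
  also have "\<dots> \<le> (LINT x:{0..2 * pi}|lborel. B * (excess x * 1))"
  proof (rule set_integral_mono)
    show "\<bar>excess x * g x\<bar> \<le> B * (excess x * 1)" if "x \<in> {0..2 * pi}" for x
      using mult_left_mono[OF B[OF that] excess_nonneg[OF that]] excess_nonneg[OF that]
      by (simp add: abs_mult mult_ac)
  qed (intro borel_integrable_atLeastAtMost' continuous_intros g)+
  also have "\<dots> = B * \<langle>excess, \<lambda>_. 1\<rangle>"
    by (simp add: L2inner_def)
  finally show ?thesis .
qed

lemma abs_inner_perp_perp_le:
  assumes "continuous_on {0..2 * pi} g" "\<And>x. x \<in> {0..2 * pi} \<Longrightarrow> \<bar>g x\<bar> \<le> B" "0 \<le> B"
  shows "\<bar>\<langle>perp u, \<lambda>x. perp u x * g x\<rangle>\<bar> \<le> B * \<parallel>perp u\<parallel>\<^sup>2"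
  using abs_L2inner_mult_le[OF perp_in_L2 perp_in_L2 assms] by (simp add: power2_eq_square mult_ac)

lemma inner_q:
  assumes g: "continuous_on {0..2 * pi} g"
  shows "\<langle>q, g\<rangle> = (mode u)\<^sup>2 / 2 * \<langle>\<lambda>x. phi x * phi x, g\<rangle> + mode u * \<langle>perp u, \<lambda>x. phi x * g x\<rangle>
      + \<langle>perp u, \<lambda>x. perp u x * g x\<rangle> / 2 + \<langle>excess, g\<rangle>"
proof -
  have in_L2: "in_L2 (2 * pi) (\<lambda>x. phi x * phi x)" "in_L2 (2 * pi) (\<lambda>x. perp u x * phi x)"
    "in_L2 (2 * pi) (\<lambda>x. perp u x * perp u x)" "in_L2 (2 * pi) g"
    by (intro in_L2_continuous continuous_intros g)+
  have "\<langle>q, g\<rangle> = \<langle>\<lambda>x. (mode u)\<^sup>2 / 2 * (phi x * phi x) + mode u * (perp u x * phi x)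
      + 1 / 2 * (perp u x * perp u x) + excess x, g\<rangle>"
    by (rule L2inner_cong) (simp add: excess_def perp_def power2_eq_square algebra_simps)
  also have "\<dots> = (mode u)\<^sup>2 / 2 * \<langle>\<lambda>x. phi x * phi x, g\<rangle> + mode u * \<langle>\<lambda>x. perp u x * phi x, g\<rangle>
      + 1 / 2 * \<langle>\<lambda>x. perp u x * perp u x, g\<rangle> + \<langle>excess, g\<rangle>"
    using in_L2 excess_in_L2 by (simp add: L2inner_add_left L2inner_scale_left del: times_divide_eq_left)
  finally show ?thesis
    unfolding L2inner_mult_assoc[of _ "perp u"] by simp
qed

lemma mode_D:
  "3 * pi * mode D = mode u * \<langle>perp u, \<lambda>x. phi x * sin x\<rangle> + \<langle>perp u, \<lambda>x. perp u x * sin x\<rangle> / 2 + \<langle>excess, sin\<rangle>"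
proof -
  have "3 * pi * mode D = \<langle>D, phi\<rangle>"
    by (simp add: mode_def)
  also have "\<dots> = \<langle>u, \<lambda>x. sin x + - sin x\<rangle> + \<langle>q, sin\<rangle>"
    by (rule weak[OF kdv_test_phi])
  also have "\<langle>u, \<lambda>x. sin x + - sin x\<rangle> = 0"
    by (simp add: L2inner_def)
  finally show ?thesis
    using inner_q[of sin] by (simp add: inner_phi_phi_sin continuous_intros)
qed

lemma inner_D_corrector:
  "\<langle>D, corrector\<rangle> = \<langle>perp u, \<lambda>x. phi x * sin x\<rangle> + pi\<^sup>2 / 2 * (mode u)\<^sup>2
    + mode u * \<langle>perp u, \<lambda>x. phi x * corrector1 x\<rangle> + \<langle>perp u, \<lambda>x. perp u x * corrector1 x\<rangle> / 2
    + \<langle>excess, corrector1\<rangle>"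
proof -
  have phi_sin: "in_L2 (2 * pi) (\<lambda>x. phi x * sin x)"
    by (intro in_L2_continuous continuous_intros)
  have "\<langle>D, corrector\<rangle> = \<langle>u, \<lambda>x. corrector1 x + corrector3 x\<rangle> + \<langle>q, corrector1\<rangle>"
    by (rule weak[OF kdv_test_corrector])
  also have "\<langle>u, \<lambda>x. corrector1 x + corrector3 x\<rangle> = \<langle>\<lambda>x. perp u x + mode u * phi x, \<lambda>x. phi x * sin x\<rangle>"
    by (simp add: corrector_adjoint_equation perp_def)
  also have "\<dots> = \<langle>perp u, \<lambda>x. phi x * sin x\<rangle>"
    using phi_sin perp_in_L2 inner_phi_phi_sin
    by (simp add: L2inner_add_left L2inner_scale_left L2inner_mult_assoc[of _ phi])
  finally show ?thesis
    using inner_q[of corrector1] by (simp add: inner_phi_phi_corrector1 continuous_intros)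
qed

lemma inner_D_weighted_perp:
  "\<langle>D, \<lambda>x. weight x * perp u x\<rangle> = \<parallel>perp u\<parallel>\<^sup>2 / 2 - 3 / 2 * \<parallel>perp1\<parallel>\<^sup>2 - (perp1 0)\<^sup>2 / 2
    - (mode u)\<^sup>2 * \<langle>perp u, \<lambda>x. weight x * (phi x * sin x)\<rangle> + mode u * \<langle>perp u, \<lambda>x. phi x * weighted_perp1 x\<rangle>
    + \<langle>perp u, \<lambda>x. perp u x * weighted_perp1 x\<rangle> / 2 + \<langle>excess, weighted_perp1\<rangle>"
proof -
  have weighted: "weight 0 * perp u 0 = 0" "weight (2 * pi) * perp u (2 * pi) = 0"
    by (simp_all add: perp_boundary)
  have "\<langle>D, \<lambda>x. weight x * perp u x\<rangle> = \<langle>\<lambda>x. q x + u x + u2 x, weighted_perp1\<rangle>"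
    by (rule inner_D[OF weighted_perp_C1 weighted])
  also have "\<dots> = \<langle>\<lambda>x. q x + (mode u + (perp u x + perp2 x)), weighted_perp1\<rangle>"
    by (rule L2inner_cong) (simp add: perp_def perp2_def phi_def algebra_simps)
  also have "\<dots> = \<langle>q, weighted_perp1\<rangle> + \<langle>\<lambda>x. mode u, weighted_perp1\<rangle>
      + \<langle>\<lambda>x. perp u x + perp2 x, weighted_perp1\<rangle>"
    using profile_in_L2 by (simp add: L2inner_add_left)
  also have "\<langle>\<lambda>x. mode u, weighted_perp1\<rangle> = 0"
    by (rule L2inner_const_derivative[OF _ weighted_perp_C1 weighted]) simp
  also have "\<langle>\<lambda>x. perp u x + perp2 x, weighted_perp1\<rangle>
      = \<parallel>perp u\<parallel>\<^sup>2 / 2 - 3 / 2 * \<parallel>perp1\<parallel>\<^sup>2 - (perp1 0)\<^sup>2 / 2"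
    using kdv_multiplier_identity[OF _ perp_C1 perp1_C1 perp_boundary]
    by (simp add: weighted_perp1_def[abs_def] weight_def[abs_def])
  finally have "\<langle>D, \<lambda>x. weight x * perp u x\<rangle>
      = \<langle>q, weighted_perp1\<rangle> + (\<parallel>perp u\<parallel>\<^sup>2 / 2 - 3 / 2 * \<parallel>perp1\<parallel>\<^sup>2 - (perp1 0)\<^sup>2 / 2)"
    by simp
  moreover have "\<langle>\<lambda>x. phi x * phi x, weighted_perp1\<rangle> = - 2 * \<langle>perp u, \<lambda>x. weight x * (phi x * sin x)\<rangle>"
  proof -
    have "C1_Icc 0 (2 * pi) (\<lambda>x. phi x * phi x) (\<lambda>x. sin x * phi x + phi x * sin x)"
      by (intro C1_Icc_mult C1_IccI phi_has_derivative continuous_intros)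
    from L2inner_by_parts[OF _ this weighted_perp_C1]
    have "\<langle>\<lambda>x. phi x * phi x, weighted_perp1\<rangle> = - \<langle>\<lambda>x. sin x * phi x + phi x * sin x, \<lambda>x. weight x * perp u x\<rangle>"
      by (simp add: perp_boundary)
    also have "\<langle>\<lambda>x. sin x * phi x + phi x * sin x, \<lambda>x. weight x * perp u x\<rangle>
        = \<langle>\<lambda>x. 2 * perp u x, \<lambda>x. weight x * (phi x * sin x)\<rangle>"
      by (rule L2inner_cong) simp
    finally show ?thesis
      by (simp add: L2inner_scale_left)
  qed
  ultimately show ?thesis
    using inner_q[OF weighted_perp1_continuous] by simp
qed

lemma small_bounds:
  "\<bar>mode u\<bar> \<le> radius" "\<parallel>perp u\<parallel> \<le> radius" "\<bar>\<langle>u, corrector\<rangle>\<bar> \<le> 12 * radius"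
  using mode_le_norm[of u] norm_perp_le[of u] inner_corrector_le[of u] small u_in_L2
  by linarith+

lemma abs_phi_mult_le: "\<bar>c\<bar> \<le> B \<Longrightarrow> \<bar>phi x * c\<bar> \<le> 2 * B"
  by (intro abs_mult_le_mult phi_bounds)

lemma abs_mode_D_le: "\<bar>mode D\<bar> \<le> \<bar>mode u\<bar> * \<parallel>perp u\<parallel> + \<parallel>perp u\<parallel>\<^sup>2 + \<langle>excess, \<lambda>_. 1\<rangle>"
proof -
  let ?X1 = "\<langle>perp u, \<lambda>x. phi x * sin x\<rangle>" and ?X2 = "\<langle>perp u, \<lambda>x. perp u x * sin x\<rangle>"
  have "9 * \<bar>mode D\<bar> \<le> 3 * pi * \<bar>mode D\<bar>"
    using pi_approx by (intro mult_right_mono) auto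
  also have "\<dots> = \<bar>mode u * ?X1 + ?X2 / 2 + \<langle>excess, sin\<rangle>\<bar>"
    by (simp add: mode_D[symmetric] abs_mult)
  also have "\<dots> \<le> \<bar>mode u * ?X1\<bar> + \<bar>?X2\<bar> / 2 + \<bar>\<langle>excess, sin\<rangle>\<bar>"
    by linarith
  also have "\<bar>mode u * ?X1\<bar> \<le> \<bar>mode u\<bar> * (3 * (2 * 1) * \<parallel>perp u\<parallel>)"
    by (intro abs_mult_le_mult abs_inner_le abs_phi_mult_le profile_in_L2 continuous_intros) auto
  also have "\<bar>?X2\<bar> \<le> 1 * \<parallel>perp u\<parallel>\<^sup>2"
    by (intro abs_inner_perp_perp_le continuous_intros) auto
  also have "\<bar>\<langle>excess, sin\<rangle>\<bar> \<le> 1 * \<langle>excess, \<lambda>_. 1\<rangle>"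
    by (intro abs_inner_excess_le continuous_intros) auto
  finally have "9 * \<bar>mode D\<bar> \<le> 6 * (\<bar>mode u\<bar> * \<parallel>perp u\<parallel>) + \<parallel>perp u\<parallel>\<^sup>2 / 2 + \<langle>excess, \<lambda>_. 1\<rangle>"
    by simp
  moreover have "0 \<le> \<bar>mode u\<bar> * \<parallel>perp u\<parallel>" "0 \<le> \<parallel>perp u\<parallel>\<^sup>2"
    by simp_all
  ultimately show ?thesis
    using inner_excess_nonneg by linarith
qed

text \<open>The corrector cancels the term \<open>(mode u)\<^sup>2 * \<langle>perp u, phi * sin\<rangle>\<close>, the only one that the damping
  \<open>(mode u) ^ 4 + \<parallel>perp u\<parallel>\<^sup>2\<close> would not absorb with a small factor.\<close>

lemma mode_energy_eq:
  "3 * pi * mode u * mode D - \<langle>D, corrector\<rangle> * (mode u)\<^sup>2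
    = mode u * \<langle>perp u, \<lambda>x. perp u x * sin x\<rangle> / 2 + mode u * \<langle>excess, sin\<rangle> - pi\<^sup>2 / 2 * mode u ^ 4
      - mode u * ((mode u)\<^sup>2 * \<langle>perp u, \<lambda>x. phi x * corrector1 x\<rangle>)
      - (mode u)\<^sup>2 * \<langle>perp u, \<lambda>x. perp u x * corrector1 x\<rangle> / 2 - (mode u)\<^sup>2 * \<langle>excess, corrector1\<rangle>"
proof -
  have "3 * pi * mode u * mode D = mode u * (3 * pi * mode D)"
    by simp
  then show ?thesis
    unfolding mode_D inner_D_corrector by (simp add: algebra_simps power2_eq_square power4_eq_xxxx)
qed

lemma mode_energy_le:
  "3 * pi * mode u * mode D - \<langle>D, corrector\<rangle> * (mode u)\<^sup>2
    \<le> - (9 / 2) * mode u ^ 4 + 15 * radius * (mode u ^ 4 + \<parallel>perp u\<parallel>\<^sup>2) + \<langle>excess, \<lambda>_. 1\<rangle>"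
proof -
  define a where "a = mode u"
  define S where "S = \<parallel>perp u\<parallel>"
  define E where "E = \<langle>excess, \<lambda>_. 1\<rangle>"
  have a: "\<bar>a\<bar> \<le> radius" and E: "0 \<le> E"
    using small_bounds inner_excess_nonneg by (auto simp: a_def E_def)
  have a2: "\<bar>a\<^sup>2\<bar> \<le> radius"
    using abs_mult_le_mult[OF a, of a 1] a by (simp add: power2_eq_square radius_def)
  have "\<bar>a * \<langle>perp u, \<lambda>x. perp u x * sin x\<rangle>\<bar> \<le> radius * (1 * S\<^sup>2)"
    unfolding S_def by (intro abs_mult_le_mult a abs_inner_perp_perp_le continuous_intros) auto
  moreover have "\<bar>a * \<langle>excess, sin\<rangle>\<bar> \<le> radius * (1 * E)"
    unfolding E_def by (intro abs_mult_le_mult a abs_inner_excess_le continuous_intros) auto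
  moreover have "\<bar>a * (a\<^sup>2 * \<langle>perp u, \<lambda>x. phi x * corrector1 x\<rangle>)\<bar> \<le> radius * (12 * (a ^ 4 + S\<^sup>2))"
  proof (rule abs_mult_le_mult[OF a])
    have "\<bar>a\<^sup>2 * \<langle>perp u, \<lambda>x. phi x * corrector1 x\<rangle>\<bar> \<le> a\<^sup>2 * (3 * (2 * 4) * S)"
      unfolding S_def
      by (intro abs_mult_le_mult abs_inner_le abs_phi_mult_le corrector_bounds profile_in_L2 continuous_intros) auto
    also have "\<dots> \<le> 12 * (a ^ 4 + S\<^sup>2)"
      using sum_squares_bound[of "a\<^sup>2" S] by (simp flip: power_mult)
    finally show "\<bar>a\<^sup>2 * \<langle>perp u, \<lambda>x. phi x * corrector1 x\<rangle>\<bar> \<le> 12 * (a ^ 4 + S\<^sup>2)" .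
  qed
  moreover have "\<bar>a\<^sup>2 * \<langle>perp u, \<lambda>x. perp u x * corrector1 x\<rangle>\<bar> \<le> radius * (4 * S\<^sup>2)"
    unfolding S_def by (intro abs_mult_le_mult a2 abs_inner_perp_perp_le corrector_bounds continuous_intros) auto
  moreover have "\<bar>a\<^sup>2 * \<langle>excess, corrector1\<rangle>\<bar> \<le> radius * (4 * E)"
    unfolding E_def by (intro abs_mult_le_mult a2 abs_inner_excess_le corrector_bounds continuous_intros) auto
  moreover have "9 / 2 * a ^ 4 \<le> pi\<^sup>2 / 2 * a ^ 4"
    using power_mono[of 3 pi 2] pi_approx by (intro mult_right_mono) auto
  moreover have "0 \<le> a ^ 4" "0 \<le> S\<^sup>2"
    by simp_all
  ultimately show ?thesis
    unfolding mode_energy_eq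
    unfolding a_def[symmetric] S_def[symmetric] E_def[symmetric] radius_def abs_le_iff distrib_left
    using E by linarith
qed

lemma mode_coupling_le:
  "- 2 * \<langle>u, corrector\<rangle> * mode u * mode D
    \<le> 36 * radius * (mode u ^ 4 + \<parallel>perp u\<parallel>\<^sup>2) + \<langle>excess, \<lambda>_. 1\<rangle>"
proof -
  define a where "a = mode u"
  define S where "S = \<parallel>perp u\<parallel>"
  define E where "E = \<langle>excess, \<lambda>_. 1\<rangle>"
  have a: "\<bar>a\<bar> \<le> radius" and E: "0 \<le> E"
    using small_bounds inner_excess_nonneg by (auto simp: a_def E_def)
  have "\<bar>a * mode D\<bar> \<le> \<bar>a\<bar> * (\<bar>a\<bar> * S + S\<^sup>2 + E)"
    using abs_mode_D_le by (intro abs_mult_le_mult) (auto simp: a_def S_def E_def)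
  also have "\<dots> = a\<^sup>2 * S + \<bar>a\<bar> * S\<^sup>2 + \<bar>a\<bar> * E"
    by (simp add: algebra_simps power2_eq_square)
  also have "\<dots> \<le> (a ^ 4 + S\<^sup>2) / 2 + 1 * S\<^sup>2 + 1 * E"
    using sum_squares_bound[of "a\<^sup>2" S] a E
    by (intro add_mono mult_right_mono) (auto simp: radius_def simp flip: power_mult)
  finally have "\<bar>a * mode D\<bar> \<le> (a ^ 4 + S\<^sup>2) / 2 + S\<^sup>2 + E"
    by simp
  moreover have "\<bar>- 2 * \<langle>u, corrector\<rangle>\<bar> \<le> 24 * radius"
    using small_bounds(3) by (simp add: abs_mult)
  ultimately have "\<bar>- 2 * \<langle>u, corrector\<rangle> * (a * mode D)\<bar> \<le> 24 * radius * ((a ^ 4 + S\<^sup>2) / 2 + S\<^sup>2 + E)"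
    by (rule abs_mult_le_mult[rotated])
  moreover have "0 \<le> a ^ 4" "0 \<le> S\<^sup>2"
    by simp_all
  ultimately have "- 2 * \<langle>u, corrector\<rangle> * (a * mode D) \<le> 36 * radius * (a ^ 4 + S\<^sup>2) + E"
    using E unfolding radius_def abs_le_iff distrib_left add_divide_distrib by linarith
  then show ?thesis
    by (simp add: a_def S_def E_def mult_ac)
qed

lemma abs_inner_weight_perp_le:
  assumes g: "continuous_on {0..2 * pi} g" and B: "\<And>x. x \<in> {0..2 * pi} \<Longrightarrow> \<bar>g x\<bar> \<le> B" "0 \<le> B"
  shows "\<bar>\<langle>perp u, \<lambda>x. weight x * (phi x * g x)\<rangle>\<bar> \<le> 48 * B * \<parallel>perp u\<parallel>"
proof -
  have "\<bar>\<langle>perp u, \<lambda>x. weight x * (phi x * g x)\<rangle>\<bar> \<le> 3 * (8 * (2 * B)) * \<parallel>perp u\<parallel>"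
    using B(2)
    by (intro abs_inner_le abs_mult_le_mult abs_phi_mult_le weight_bounds B(1) profile_in_L2
        continuous_intros g) auto
  then show ?thesis
    by simp
qed

lemma mode_square_coupling_le:
  "\<bar>(mode u)\<^sup>2 * \<langle>perp u, \<lambda>x. weight x * (phi x * sin x)\<rangle>\<bar> \<le> \<parallel>perp u\<parallel>\<^sup>2 / 4 + 2304 * mode u ^ 4"
proof -
  have "\<bar>(mode u)\<^sup>2 * \<langle>perp u, \<lambda>x. weight x * (phi x * sin x)\<rangle>\<bar> \<le> (mode u)\<^sup>2 * (48 * 1 * \<parallel>perp u\<parallel>)"
    by (intro abs_mult_le_mult abs_inner_weight_perp_le continuous_intros) auto
  also have "\<dots> \<le> \<parallel>perp u\<parallel>\<^sup>2 / 4 + 2304 * mode u ^ 4"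
    using sum_squares_bound[of "\<parallel>perp u\<parallel> / 2" "48 * (mode u)\<^sup>2"]
    by (simp add: power_mult_distrib power_divide mult_ac flip: power_mult)
  finally show ?thesis .
qed

lemma mode_weighted_coupling_le:
  "\<bar>mode u * \<langle>perp u, \<lambda>x. phi x * weighted_perp1 x\<rangle>\<bar> \<le> radius * (18 * \<parallel>perp1\<parallel>\<^sup>2)"
proof (rule abs_mult_le_mult[OF small_bounds(1)])
  have "\<bar>\<langle>perp u, \<lambda>x. phi x * weighted_perp1 x\<rangle>\<bar> \<le> 2 * \<parallel>perp u\<parallel> * \<parallel>weighted_perp1\<parallel>"
    by (intro abs_L2inner_mult_le profile_in_L2 phi_bounds continuous_intros) auto
  also have "\<dots> \<le> 2 * \<parallel>perp1\<parallel> * (9 * \<parallel>perp1\<parallel>)"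
    by (intro mult_mono norm_perp_le_norm_perp1 norm_weighted_perp1_le) auto
  finally show "\<bar>\<langle>perp u, \<lambda>x. phi x * weighted_perp1 x\<rangle>\<bar> \<le> 18 * \<parallel>perp1\<parallel>\<^sup>2"
    by (simp add: power2_eq_square)
qed

lemma perp_weighted_coupling_le:
  "\<bar>\<langle>perp u, \<lambda>x. perp u x * weighted_perp1 x\<rangle>\<bar> \<le> radius * (27 * \<parallel>perp1\<parallel>\<^sup>2)"
proof -
  have "\<bar>\<langle>perp u, \<lambda>x. perp u x * weighted_perp1 x\<rangle>\<bar> \<le> (3 * \<parallel>perp1\<parallel>) * \<parallel>perp u\<parallel> * \<parallel>weighted_perp1\<parallel>"
    by (intro abs_L2inner_mult_le profile_in_L2 abs_perp_le continuous_intros) auto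
  also have "\<dots> \<le> (3 * \<parallel>perp1\<parallel>) * radius * (9 * \<parallel>perp1\<parallel>)"
    by (intro mult_mono small_bounds(2) norm_weighted_perp1_le) (auto simp: radius_def)
  finally show ?thesis
    by (simp add: power2_eq_square mult_ac)
qed

lemma excess_weighted_coupling_le:
  "\<bar>\<langle>excess, weighted_perp1\<rangle>\<bar> \<le> \<parallel>perp1\<parallel>\<^sup>2 / 4 + 81 * \<parallel>excess\<parallel>\<^sup>2"
proof -
  have "\<bar>\<langle>excess, weighted_perp1\<rangle>\<bar> \<le> \<parallel>excess\<parallel> * \<parallel>weighted_perp1\<parallel>"
    by (intro L2_Cauchy_Schwarz profile_in_L2)
  also have "\<dots> \<le> \<parallel>excess\<parallel> * (9 * \<parallel>perp1\<parallel>)"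
    by (intro mult_left_mono norm_weighted_perp1_le) simp
  also have "\<dots> \<le> \<parallel>perp1\<parallel>\<^sup>2 / 4 + 81 * \<parallel>excess\<parallel>\<^sup>2"
    using sum_squares_bound[of "\<parallel>perp1\<parallel> / 2" "9 * \<parallel>excess\<parallel>"]
    by (simp add: power_mult_distrib power_divide mult_ac)
  finally show ?thesis .
qed

lemma mode_D_coupling_le:
  "\<bar>mode D * \<langle>perp u, \<lambda>x. weight x * (phi x * 1)\<rangle>\<bar> \<le> 96 * radius * \<parallel>perp1\<parallel>\<^sup>2 + 48 * radius * \<langle>excess, \<lambda>_. 1\<rangle>"
proof -
  define a where "a = \<bar>mode u\<bar>"
  define S where "S = \<parallel>perp u\<parallel>"
  define N where "N = \<parallel>perp1\<parallel>"
  define E where "E = \<langle>excess, \<lambda>_. 1\<rangle>"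
  have a: "a \<le> radius" and S: "0 \<le> S" "S \<le> radius" "S \<le> N" and E: "0 \<le> E"
    using small_bounds inner_excess_nonneg norm_perp_le_norm_perp1 by (auto simp: a_def S_def N_def E_def)
  have S2: "S\<^sup>2 \<le> N\<^sup>2"
    using S by (intro power_mono)
  have "\<bar>mode D * \<langle>perp u, \<lambda>x. weight x * (phi x * 1)\<rangle>\<bar> \<le> (a * S + S\<^sup>2 + E) * (48 * 1 * S)"
    unfolding S_def a_def E_def by (intro abs_mult_le_mult abs_mode_D_le abs_inner_weight_perp_le) auto
  also have "\<dots> = 48 * (a * S\<^sup>2 + S * S\<^sup>2 + S * E)"
    by (simp add: algebra_simps power2_eq_square)
  also have "\<dots> \<le> 48 * (radius * N\<^sup>2 + radius * N\<^sup>2 + radius * E)"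
    using a S S2 E by (intro mult_left_mono add_mono mult_mono) (auto simp: radius_def)
  finally show ?thesis
    by (simp add: N_def E_def)
qed

lemma inner_perp_D_weighted:
  "\<langle>perp D, \<lambda>x. weight x * perp u x\<rangle>
    = \<langle>D, \<lambda>x. weight x * perp u x\<rangle> - mode D * \<langle>perp u, \<lambda>x. weight x * (phi x * 1)\<rangle>"
proof -
  have "in_L2 (2 * pi) (\<lambda>x. weight x * perp u x)"
    by (intro in_L2_continuous continuous_intros)
  then have "\<langle>perp D, \<lambda>x. weight x * perp u x\<rangle>
      = \<langle>D, \<lambda>x. weight x * perp u x\<rangle> - mode D * \<langle>phi, \<lambda>x. weight x * perp u x\<rangle>"
    using profile_in_L2 by (simp add: perp_def[of D, abs_def] L2inner_diff_left L2inner_scale_left)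
  also have "\<langle>phi, \<lambda>x. weight x * perp u x\<rangle> = \<langle>perp u, \<lambda>x. weight x * (phi x * 1)\<rangle>"
    by (simp add: L2inner_def mult_ac)
  finally show ?thesis .
qed

lemma weighted_energy_le:
  "\<langle>perp D, \<lambda>x. weight x * perp u x\<rangle>
    \<le> - (1 / 4) * \<parallel>perp u\<parallel>\<^sup>2 + 2304 * mode u ^ 4 + \<langle>excess, \<lambda>_. 1\<rangle> + 81 * \<parallel>excess\<parallel>\<^sup>2"
proof -
  have "\<parallel>perp u\<parallel>\<^sup>2 \<le> \<parallel>perp1\<parallel>\<^sup>2"
    by (intro power_mono norm_perp_le_norm_perp1) simp
  moreover have "0 \<le> (perp1 0)\<^sup>2" "0 \<le> \<parallel>perp1\<parallel>\<^sup>2"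
    by simp_all
  moreover note mode_square_coupling_le mode_weighted_coupling_le perp_weighted_coupling_le
    excess_weighted_coupling_le mode_D_coupling_le inner_excess_nonneg
  ultimately show ?thesis
    unfolding inner_perp_D_weighted inner_D_weighted_perp radius_def abs_le_iff distrib_left by linarith
qed

lemma norm_power4_le: "\<parallel>u\<parallel> ^ 4 \<le> 200 * (mode u ^ 4 + \<parallel>perp u\<parallel>\<^sup>2)"
proof -
  define a2 where "a2 = (mode u)\<^sup>2"
  define S2 where "S2 = \<parallel>perp u\<parallel>\<^sup>2"
  have S2: "0 \<le> S2" "S2 \<le> 1"
    using small_bounds(2) by (auto simp: S2_def radius_def intro: power_le_one)
  have "\<parallel>u\<parallel>\<^sup>2 = 3 * pi * a2 + S2"
    using u_in_L2 by (simp add: norm_mode_perp a2_def S2_def)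
  also have "\<dots> \<le> 10 * a2 + S2"
    unfolding a2_def using pi_approx by (intro add_right_mono mult_right_mono) auto
  finally have "(\<parallel>u\<parallel>\<^sup>2)\<^sup>2 \<le> (10 * a2 + S2)\<^sup>2"
    by (intro power_mono) auto
  also have "\<dots> \<le> 2 * ((10 * a2)\<^sup>2 + S2\<^sup>2)"
    using sum_squares_bound[of "10 * a2" S2] by (simp add: power2_sum)
  also have "S2\<^sup>2 \<le> S2"
    using mult_left_mono[OF S2(2,1)] by (simp add: power2_eq_square)
  finally have "\<parallel>u\<parallel> ^ 4 \<le> 200 * mode u ^ 4 + 2 * S2"
    by (simp add: a2_def power_mult_distrib flip: power_mult)
  then show ?thesis
    using S2(1) unfolding S2_def[symmetric] by simp
qed

lemma dlyap_le: "dlyap u D \<le> - decay_rate * \<parallel>u\<parallel> ^ 4 + 3 * \<langle>excess, \<lambda>_. 1\<rangle> + \<parallel>excess\<parallel>\<^sup>2"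
proof -
  define K where "K = energy_weight * \<langle>perp D, \<lambda>x. weight x * perp u x\<rangle>"
  have "K \<le> (- (1 / 4) * \<parallel>perp u\<parallel>\<^sup>2 + 2304 * mode u ^ 4 + \<langle>excess, \<lambda>_. 1\<rangle> + 81 * \<parallel>excess\<parallel>\<^sup>2) / 2304"
    using weighted_energy_le by (simp add: K_def energy_weight_def)
  moreover have "dlyap u D = (3 * pi * mode u * mode D - \<langle>D, corrector\<rangle> * (mode u)\<^sup>2)
      + (- 2 * \<langle>u, corrector\<rangle> * mode u * mode D) + K"
    by (simp add: dlyap_def K_def algebra_simps)
  moreover have "0 \<le> mode u ^ 4" "0 \<le> \<parallel>perp u\<parallel>\<^sup>2" "0 \<le> \<parallel>excess\<parallel>\<^sup>2"
    by simp_all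
  ultimately show ?thesis
    using mode_energy_le mode_coupling_le norm_power4_le inner_excess_nonneg unfolding decay_rate_def radius_def
      distrib_left add_divide_distrib by linarith
qed

end

lemma lyap_dissipation:
  assumes "kdv_profile (2 * pi) D u q" and "\<And>x. x \<in> {0..2 * pi} \<Longrightarrow> (u x)\<^sup>2 / 2 \<le> q x" and "\<parallel>u\<parallel> \<le> radius"
  defines "r \<equiv> \<lambda>x. q x - (u x)\<^sup>2 / 2"
  shows "dlyap u D \<le> - decay_rate * \<parallel>u\<parallel> ^ 4 + 3 * \<langle>r, \<lambda>_. 1\<rangle> + \<parallel>r\<parallel>\<^sup>2"
proof -
  interpret kdv_profile "2 * pi" D u q
    by (rule assms(1))
  obtain u1 u2 where "C1_Icc 0 (2 * pi) u u1" "C1_Icc 0 (2 * pi) u1 u2" "u1 (2 * pi) = 0"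
    "\<And>f f'. C1_Icc 0 (2 * pi) f f' \<Longrightarrow> f 0 = 0 \<Longrightarrow> f (2 * pi) = 0 \<Longrightarrow> \<langle>D, f\<rangle> = \<langle>\<lambda>x. q x + u x + u2 x, f'\<rangle>"
    using profile_regularity by blast
  then interpret kdv_profile_2pi D u q u1 u2
    by unfold_locales (use assms in auto)
  show ?thesis
    using dlyap_le by (simp add: r_def excess_def[abs_def])
qed

section \<open>Stability and decay\<close>

lemma continuous_bootstrap:
  fixes N :: "real \<Rightarrow> real"
  assumes N: "continuous_on {0..} N" and init: "N 0 < e"
    and step: "\<And>t. 0 \<le> t \<Longrightarrow> (\<And>s. s \<in> {0..t} \<Longrightarrow> N s \<le> e) \<Longrightarrow> N t < e"
    and t: "0 \<le> t"
  shows "N t < e"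
proof (rule ccontr)
  assume "\<not> N t < e"
  then have Nt: "e \<le> N t"
    by simp
  have crossing: "\<exists>x\<ge>0. x \<le> r \<and> N x = e" if "0 \<le> r" "e \<le> N r" for r
    using that init by (intro IVT' continuous_on_subset[OF N]) auto
  define H where "H = {x \<in> {0..t}. N x = e}"
  have "closed H"
    unfolding H_def
    by (intro continuous_closed_preimage_constant continuous_on_subset[OF N]) auto
  then have "compact H"
    using compact_Int_closed[OF compact_Icc[of 0 t], of H] by (simp add: H_def Int_def conj_ac)
  moreover have "H \<noteq> {}"
    using crossing[OF t Nt] by (auto simp: H_def)
  ultimately obtain t1 where t1: "t1 \<in> H" "\<And>x. x \<in> H \<Longrightarrow> t1 \<le> x"
    using compact_attains_inf[of H] by blast
  have "N s \<le> e" if s: "s \<in> {0..t1}" for s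
  proof (rule ccontr)
    assume Ns: "\<not> N s \<le> e"
    then obtain x where x: "0 \<le> x" "x \<le> s" "N x = e"
      using crossing[of s] s by auto
    then have "t1 \<le> x"
      using t1 s by (auto simp: H_def)
    then have "x = s"
      using x s by simp
    then show False
      using x Ns by simp
  qed
  then have "N t1 < e"
    using t1(1) by (intro step) (auto simp: H_def)
  then show False
    using t1(1) by (simp add: H_def)
qed

locale kdv_trajectory_2pi = kdv_trajectory "2 * pi" y m for y m
begin

lemma lyap_steklov_has_derivative:
  "0 < t \<Longrightarrow> 0 < h \<Longrightarrow>
    ((\<lambda>t. lyap (steklov y h t)) has_real_derivative dlyap (steklov y h t) (\<lambda>x. (y (t + h) x - y t x) / h)) (at t)"
  by (intro lyap_has_derivative has_L2_derivative_steklov)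

lemma dlyap_steklov_le:
  assumes t: "0 \<le> t" and h: "0 < h"
    and close: "\<And>s. s \<in> {t..t+h} \<Longrightarrow> \<parallel>\<lambda>x. y s x - y t x\<parallel> \<le> \<omega>"
    and l: "l \<le> \<parallel>y t\<parallel>" and small: "\<parallel>y t\<parallel> + \<omega> \<le> radius"
  shows "dlyap (steklov y h t) (\<lambda>x. (y (t + h) x - y t x) / h)
    \<le> - decay_rate * (max 0 (l - \<omega>)) ^ 4 + \<omega>\<^sup>2 * (2 + (LINT s:{t..t+h}|lborel. m s) / h)"
proof -
  let ?u = "steklov y h t"
  define avg where "avg = (LINT s:{t..t+h}|lborel. m s) / h"
  have avg: "0 \<le> avg"
    unfolding avg_def using h by (intro divide_nonneg_pos set_integral_nonneg bound_nonneg)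
  have "\<bar>\<parallel>?u\<parallel> - \<parallel>y t\<parallel>\<bar> \<le> \<omega>"
    using abs_L2norm_diff_le[OF in_L2_steklov[OF t] curve_in_L2[OF t], of h]
      L2norm_steklov_diff_le[OF t h curve_in_L2[OF t] close] by linarith
  then have u: "\<parallel>?u\<parallel> \<le> radius" "max 0 (l - \<omega>) \<le> \<parallel>?u\<parallel>"
    using l small by auto
  have square_le: "(steklov y h t x)\<^sup>2 / 2 \<le> steklov (\<lambda>s x. (y s x)\<^sup>2 / 2) h t x" if "x \<in> {0..2 * pi}" for x
    using time_variance_nonneg[OF t h that] by (simp add: time_variance_def)
  have "dlyap ?u (\<lambda>x. (y (t + h) x - y t x) / h)
      \<le> - decay_rate * \<parallel>?u\<parallel> ^ 4 + 3 * \<langle>time_variance h t, \<lambda>_. 1\<rangle> + \<parallel>time_variance h t\<parallel>\<^sup>2"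
    using lyap_dissipation[OF kdv_profile_steklov[OF t h] square_le u(1)] by (simp add: time_variance_def[abs_def])
  moreover have "decay_rate * max 0 (l - \<omega>) ^ 4 \<le> decay_rate * \<parallel>?u\<parallel> ^ 4"
    using u(2) by (intro mult_left_mono power_mono) (auto simp: decay_rate_def)
  moreover have "\<langle>time_variance h t, \<lambda>_. 1\<rangle> \<le> \<omega>\<^sup>2 / 2"
    by (rule L2inner_time_variance_le[OF t h close])
  moreover have "\<parallel>time_variance h t\<parallel>\<^sup>2 \<le> \<omega>\<^sup>2 / 4 * avg"
    unfolding avg_def by (rule L2norm_time_variance_le[OF t h _ close]) simp_all
  moreover have "0 \<le> \<omega>\<^sup>2 * avg" "0 \<le> \<omega>\<^sup>2"
    using avg by simp_all
  ultimately have "dlyap ?u (\<lambda>x. (y (t + h) x - y t x) / h)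
      \<le> - decay_rate * (max 0 (l - \<omega>)) ^ 4 + \<omega>\<^sup>2 * (2 + avg)"
    unfolding distrib_left by linarith
  then show ?thesis
    by (simp only: avg_def)
qed

lemma lyap_steklov_le:
  assumes s: "0 < s" "s \<le> t" and h: "0 < h" "h \<le> 1"
    and bounds: "\<And>\<tau>. \<tau> \<in> {s..t} \<Longrightarrow> l \<le> \<parallel>y \<tau>\<parallel> \<and> \<parallel>y \<tau>\<parallel> + \<omega> \<le> radius"
    and close: "\<And>\<tau> \<sigma>. \<tau> \<in> {s..t} \<Longrightarrow> \<sigma> \<in> {\<tau>..\<tau>+h} \<Longrightarrow> \<parallel>\<lambda>x. y \<sigma> x - y \<tau> x\<parallel> \<le> \<omega>"
  shows "lyap (steklov y h t) \<le> lyap (steklov y h s) - decay_rate * (max 0 (l - \<omega>)) ^ 4 * (t - s)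
    + \<omega>\<^sup>2 * (2 * (t - s) + (LINT r:{0..t+1}|lborel. m r))"
proof -
  define \<kappa> where "\<kappa> = decay_rate * (max 0 (l - \<omega>)) ^ 4"
  obtain F where F: "\<And>\<tau>. 0 < \<tau> \<Longrightarrow> (F has_real_derivative (LINT r:{\<tau>..\<tau>+h}|lborel. m r) / h) (at \<tau>)"
    "\<And>\<tau>. 0 \<le> \<tau> \<Longrightarrow> 0 \<le> F \<tau>" "\<And>\<tau>. 0 \<le> \<tau> \<Longrightarrow> F \<tau> \<le> (LINT r:{0..\<tau>+h}|lborel. m r)"
    using average_antiderivative[OF bound_nonneg bound_integrable h(1)] by metis
  define G where "G \<tau> = lyap (steklov y h \<tau>) + \<kappa> * \<tau> - \<omega>\<^sup>2 * (2 * \<tau> + F \<tau>)" for \<tau>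
  have "G t \<le> G s"
  proof (rule DERIV_nonpos_imp_nonincreasing[OF s(2)])
    fix \<tau> assume \<tau>: "s \<le> \<tau>" "\<tau> \<le> t"
    then have \<tau>_pos: "0 < \<tau>"
      using s by simp
    define D where "D = dlyap (steklov y h \<tau>) (\<lambda>x. (y (\<tau> + h) x - y \<tau> x) / h) + \<kappa>
        - \<omega>\<^sup>2 * (2 + (LINT r:{\<tau>..\<tau>+h}|lborel. m r) / h)"
    have "(G has_real_derivative D) (at \<tau>)"
      unfolding G_def[abs_def] D_def
      by (rule derivative_eq_intros lyap_steklov_has_derivative[OF \<tau>_pos h(1)] F(1)[OF \<tau>_pos] refl)+ simp
    moreover have "D \<le> 0"
      using dlyap_steklov_le[OF less_imp_le[OF \<tau>_pos] h(1) close, of l] bounds[of \<tau>] \<tau> by (simp add: D_def \<kappa>_def)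
    ultimately show "\<exists>D. (G has_real_derivative D) (at \<tau>) \<and> D \<le> 0"
      by blast
  qed
  moreover have "\<omega>\<^sup>2 * F t \<le> \<omega>\<^sup>2 * (LINT r:{0..t+1}|lborel. m r)"
  proof (rule mult_left_mono)
    have "(LINT r:{0..t+1}|lborel. m r) = (LINT r:{0..t+h}|lborel. m r) + (LINT r:{t+h..t+1}|lborel. m r)"
      using s h by (intro LINT_Icc_combine bound_integrable) auto
    moreover have "0 \<le> (LINT r:{t+h..t+1}|lborel. m r)"
      by (intro set_integral_nonneg bound_nonneg)
    ultimately show "F t \<le> (LINT r:{0..t+1}|lborel. m r)"
      using F(3)[of t] s by simp
  qed simp
  moreover have "0 \<le> \<omega>\<^sup>2 * F s"
    using F(2)[of s] s by simp
  ultimately show ?thesis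
    unfolding G_def \<kappa>_def[symmetric] by (simp add: algebra_simps)
qed

lemma lyap_tendsto_curve: "0 \<le> t \<Longrightarrow> ((\<lambda>s. lyap (y s)) \<longlongrightarrow> lyap (y t)) (at t within {0..})"
  by (intro lyap_tendsto curve_tendsto)

lemma lyap_le_with_modulus:
  assumes s: "0 < s" "s \<le> t" and \<omega>: "0 < \<omega>"
    and bounds: "\<And>\<tau>. \<tau> \<in> {s..t} \<Longrightarrow> l \<le> \<parallel>y \<tau>\<parallel> \<and> \<parallel>y \<tau>\<parallel> + \<omega> \<le> radius"
  shows "lyap (y t) \<le> lyap (y s) - decay_rate * (max 0 (l - \<omega>)) ^ 4 * (t - s)
    + \<omega>\<^sup>2 * (2 * (t - s) + (LINT r:{0..t+1}|lborel. m r))" (is "_ \<le> _ - ?decay + ?error")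
proof (rule tendsto_le[OF trivial_limit_at_right_real])
  obtain d where d: "0 < d"
    "\<And>\<sigma> \<tau>. \<sigma> \<in> {0..t+1} \<Longrightarrow> \<tau> \<in> {0..t+1} \<Longrightarrow> \<bar>\<sigma> - \<tau>\<bar> < d \<Longrightarrow> \<parallel>\<lambda>x. y \<sigma> x - y \<tau> x\<parallel> < \<omega>"
    using uniformly_continuous_curve[OF \<omega>, of "t + 1"] by blast
  show "\<forall>\<^sub>F h in at_right 0. lyap (steklov y h t) \<le> lyap (steklov y h s) - ?decay + ?error"
    unfolding eventually_at_right_field
  proof (intro exI[of _ "min 1 d"] conjI allI impI)
    fix h assume "0 < h" "h < min 1 d"
    then show "lyap (steklov y h t) \<le> lyap (steklov y h s) - ?decay + ?error"
      using s by (intro lyap_steklov_le bounds less_imp_le[OF d(2)]) auto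
  qed (use d(1) in simp)
  show "((\<lambda>h. lyap (steklov y h t)) \<longlongrightarrow> lyap (y t)) (at_right 0)"
    using s by (intro lyap_tendsto steklov_tendsto) auto
  show "((\<lambda>h. lyap (steklov y h s) - ?decay + ?error) \<longlongrightarrow> lyap (y s) - ?decay + ?error) (at_right 0)"
    using s by (intro tendsto_intros lyap_tendsto steklov_tendsto) auto
qed

lemma lyap_decrease:
  assumes s: "0 \<le> s" "s \<le> t" and l: "0 \<le> l"
    and bounds: "\<And>\<tau>. \<tau> \<in> {s..t} \<Longrightarrow> l \<le> \<parallel>y \<tau>\<parallel> \<and> \<parallel>y \<tau>\<parallel> \<le> radius / 2"
  shows "lyap (y t) \<le> lyap (y s) - decay_rate * l ^ 4 * (t - s)"
proof -
  have positive_time: "lyap (y t) \<le> lyap (y r) - decay_rate * l ^ 4 * (t - r)" if r: "0 < r" "r \<in> {s..t}" for r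
  proof -
    let ?bound = "\<lambda>\<omega>. lyap (y r) - decay_rate * (max 0 (l - \<omega>)) ^ 4 * (t - r)
        + \<omega>\<^sup>2 * (2 * (t - r) + (LINT q:{0..t+1}|lborel. m q))"
    have "(?bound \<longlongrightarrow> lyap (y r) - decay_rate * (max 0 (l - 0)) ^ 4 * (t - r)
        + 0\<^sup>2 * (2 * (t - r) + (LINT q:{0..t+1}|lborel. m q))) (at_right 0)"
      by (intro tendsto_intros)
    moreover have "\<forall>\<^sub>F \<omega> in at_right 0. lyap (y t) \<le> ?bound \<omega>"
      unfolding eventually_at_right_field
    proof (intro exI[of _ "radius / 2"] conjI allI impI)
      show "lyap (y t) \<le> ?bound \<omega>" if "0 < \<omega>" "\<omega> < radius / 2" for \<omega>
      proof (rule lyap_le_with_modulus)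
        show "l \<le> \<parallel>y \<tau>\<parallel> \<and> \<parallel>y \<tau>\<parallel> + \<omega> \<le> radius" if "\<tau> \<in> {r..t}" for \<tau>
          using bounds[of \<tau>] that \<open>r \<in> {s..t}\<close> \<open>\<omega> < radius / 2\<close> by simp
      qed (use that r in auto)
    qed (simp add: radius_def)
    ultimately have "lyap (y t) \<le> lyap (y r) - decay_rate * (max 0 (l - 0)) ^ 4 * (t - r)
        + 0\<^sup>2 * (2 * (t - r) + (LINT q:{0..t+1}|lborel. m q))"
      by (rule tendsto_lowerbound) simp
    then show ?thesis
      using l by simp
  qed
  consider (trivial) "s = t" | (positive) "0 < s" | (initial) "s = 0" "0 < t"
    using s by linarith
  then show ?thesis
  proof cases
    case initial
    have "((\<lambda>r. lyap (y r)) \<longlongrightarrow> lyap (y 0)) (at_right 0)"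
      by (rule tendsto_within_subset[OF lyap_tendsto_curve]) auto
    then have "((\<lambda>r. lyap (y r) - decay_rate * l ^ 4 * (t - r))
        \<longlongrightarrow> lyap (y 0) - decay_rate * l ^ 4 * (t - 0)) (at_right 0)"
      by (intro tendsto_intros)
    moreover have "\<forall>\<^sub>F r in at_right 0. lyap (y t) \<le> lyap (y r) - decay_rate * l ^ 4 * (t - r)"
      unfolding eventually_at_right_field using initial by (auto intro!: exI[of _ t] positive_time)
    ultimately show ?thesis
      unfolding \<open>s = 0\<close> by (rule tendsto_lowerbound) simp
  qed (use s positive_time[of s] in auto)
qed

lemma lyap_curve_bounds:
  assumes "0 \<le> t" "\<parallel>y t\<parallel> \<le> radius / 2"
  shows "energy_weight / 2 * \<parallel>y t\<parallel>\<^sup>2 \<le> lyap (y t)" "lyap (y t) \<le> 8 * \<parallel>y t\<parallel>\<^sup>2"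
  using lyap_bounds[OF curve_in_L2[OF assms(1)]] assms(2) by (auto simp: radius_def)

lemma norm_growth:
  assumes s: "0 \<le> s" "s \<le> t" and small: "\<And>\<tau>. \<tau> \<in> {s..t} \<Longrightarrow> \<parallel>y \<tau>\<parallel> \<le> radius / 2"
  shows "\<parallel>y t\<parallel> \<le> 192 * \<parallel>y s\<parallel>"
proof (rule power2_le_imp_le)
  have "energy_weight / 2 * \<parallel>y t\<parallel>\<^sup>2 \<le> lyap (y t)"
    using s small by (intro lyap_curve_bounds) auto
  also have "\<dots> \<le> lyap (y s) - decay_rate * 0 ^ 4 * (t - s)"
    using s small by (intro lyap_decrease) auto
  also have "\<dots> \<le> 8 * \<parallel>y s\<parallel>\<^sup>2"
    using lyap_curve_bounds(2)[of s] s small by simp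
  finally show "\<parallel>y t\<parallel>\<^sup>2 \<le> (192 * \<parallel>y s\<parallel>)\<^sup>2"
    by (simp add: energy_weight_def power_mult_distrib)
qed simp

lemma norm_stays_small:
  assumes init: "\<parallel>y 0\<parallel> < radius / 384" and t: "0 \<le> t"
  shows "\<parallel>y t\<parallel> < radius / 2"
proof (rule continuous_bootstrap[OF continuous_on_L2norm_curve _ _ t])
  show "\<parallel>y 0\<parallel> < radius / 2"
    using init by (simp add: radius_def)
  fix t :: real assume "0 \<le> t" "\<And>s. s \<in> {0..t} \<Longrightarrow> \<parallel>y s\<parallel> \<le> radius / 2"
  then have "\<parallel>y t\<parallel> \<le> 192 * \<parallel>y 0\<parallel>"
    by (intro norm_growth) auto
  then show "\<parallel>y t\<parallel> < radius / 2"
    using init by simp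
qed

lemma stability:
  assumes "\<parallel>y 0\<parallel> < radius / 384" "0 \<le> t"
  shows "\<parallel>y t\<parallel> \<le> 192 * \<parallel>y 0\<parallel>"
  using norm_stays_small[OF assms(1)] assms(2) by (intro norm_growth) (auto intro: less_imp_le)

lemma algebraic_decay:
  assumes init: "\<parallel>y 0\<parallel> < radius / 384" and t: "0 \<le> t"
  shows "decay_rate * (\<parallel>y t\<parallel> / 192) ^ 4 * t \<le> 8 * \<parallel>y 0\<parallel>\<^sup>2"
proof -
  note small = norm_stays_small[OF init, THEN less_imp_le]
  have "lyap (y t) \<le> lyap (y 0) - decay_rate * (\<parallel>y t\<parallel> / 192) ^ 4 * (t - 0)"
  proof (rule lyap_decrease)
    fix \<tau> assume "\<tau> \<in> {0..t}"
    then show "\<parallel>y t\<parallel> / 192 \<le> \<parallel>y \<tau>\<parallel> \<and> \<parallel>y \<tau>\<parallel> \<le> radius / 2"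
      using norm_growth[of \<tau> t] small by auto
  qed (use t in auto)
  moreover have "0 \<le> energy_weight / 2 * \<parallel>y t\<parallel>\<^sup>2"
    by (simp add: energy_weight_def)
  ultimately show ?thesis
    using lyap_curve_bounds(1)[OF t small[OF t]] lyap_curve_bounds(2)[OF order_refl small[OF order_refl]] by simp
qed

lemma norm_tendsto_zero:
  assumes init: "\<parallel>y 0\<parallel> < radius / 384"
  shows "((\<lambda>t. \<parallel>y t\<parallel>) \<longlongrightarrow> 0) at_top"
proof (rule tendstoI)
  fix e :: real assume e: "0 < e"
  define T where "T = 8 * \<parallel>y 0\<parallel>\<^sup>2 / (decay_rate * (e / 192) ^ 4)"
  have rate: "0 < decay_rate * (e / 192) ^ 4"
    using e by (simp add: decay_rate_def)
  show "\<forall>\<^sub>F t in at_top. dist \<parallel>y t\<parallel> 0 < e"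
    using eventually_gt_at_top[of "max 0 T"]
  proof eventually_elim
    case (elim t)
    have "decay_rate * (\<parallel>y t\<parallel> / 192) ^ 4 * t \<le> 8 * \<parallel>y 0\<parallel>\<^sup>2"
      using elim by (intro algebraic_decay init) simp
    also have "\<dots> < decay_rate * (e / 192) ^ 4 * t"
      using elim rate by (simp add: T_def divide_less_eq mult.commute)
    finally have "\<parallel>y t\<parallel> ^ 4 < e ^ 4"
      using elim by (simp add: decay_rate_def power_divide)
    then show ?case
      using e power_less_imp_less_base[of "\<parallel>y t\<parallel>" 4 e] by simp
  qed
qed

end

theorem theorem1p1:
  fixes L :: real
  assumes "L = 2 * pi"
  shows "(\<forall>\<epsilon>>0. \<exists>\<delta>>0. \<forall>y0 y. kdv_solution L y0 y \<and> L2norm L y0 < \<delta> \<longrightarrow>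
             (\<forall>t\<ge>0. L2norm L (y t) < \<epsilon>))
       \<and> (\<exists>\<delta>1>0. \<forall>y0 y. kdv_solution L y0 y \<and> L2norm L y0 < \<delta>1 \<longrightarrow>
             ((\<lambda>t. L2norm L (y t)) \<longlongrightarrow> 0) at_top)"
proof -
  have trajectory: "\<exists>m. kdv_trajectory_2pi y m" "\<parallel>y 0\<parallel> = \<parallel>y0\<parallel>" if "kdv_solution L y0 y" for y0 y
    using that kdv_solution_trajectory[of L y0 y] kdv_solution_initial_norm[of L y0 y]
    by (auto simp: assms kdv_trajectory_2pi_def)
  have "\<forall>y0 y. kdv_solution L y0 y \<and> L2norm L y0 < min (\<epsilon> / 192) (radius / 384) \<longrightarrow> (\<forall>t\<ge>0. L2norm L (y t) < \<epsilon>)"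
    for \<epsilon>
    using trajectory kdv_trajectory_2pi.stability unfolding assms by fastforce
  moreover have "0 < min (\<epsilon> / 192) (radius / 384)" if "0 < \<epsilon>" for \<epsilon>
    using that by (simp add: radius_def)
  moreover have "\<forall>y0 y. kdv_solution L y0 y \<and> L2norm L y0 < radius / 384 \<longrightarrow> ((\<lambda>t. L2norm L (y t)) \<longlongrightarrow> 0) at_top"
    using trajectory kdv_trajectory_2pi.norm_tendsto_zero unfolding assms by metis
  moreover have "0 < radius / 384"
    by (simp add: radius_def)
  ultimately show ?thesis
    by blast
qed

end
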